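(* Let $m\ge2$ be an integer, $0<\alpha<1$, $d\in\mathbb R$ with $\alpha m<1$ and $2d+\alpha m<1$. Let $$\Lambda_m=\sup_{\|\xi\|_{\mathfrak H_{\mathbb R}}\le1}\left|\langle Q_1,\xi^{\otimes m}\rangle_{\mathfrak H_{\mathbb R}^{\otimes m}}\right|.$$ Then $$0<L_{m,\alpha,d}\le\Lambda_m<(m!)^{-1/2},$$ with strict inequality on the right, where $$L_{m,\alpha,d}:=\Big(\frac{2-\alpha}{2(1-\alpha)}\Big)^{m/2}\frac{\sum_{k=0}^m\binom mk\mathrm B\big(1-d+(1-\alpha)k,\;1+(1-\alpha)(m-k)\big)}{(m!\,I_{m,\alpha,d})^{1/2}},\qquad I_{m,\alpha,d}=\frac{2\,\mathrm B(1-d,1-\alpha m)}{2-2d-\alpha m},$$ with $\mathrm B(\cdot,\cdot)$ the beta function.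
   Context: $\mathfrak H_{\mathbb R}:=\{h\in L^2(\mathbb R;\mathbb C):h(-x)=\overline{h(x)}\}$ is a real Hilbert space with inner product $\langle h,g\rangle=\operatorname{Re}\int_{\mathbb R}h\overline g\,dx$; tensor powers are over this real Hilbert space, so for Hermitian-symmetric $F\in L^2(\mathbb R^m;\mathbb C)$, $\langle F,\xi^{\otimes m}\rangle_{\mathfrak H_{\mathbb R}^{\otimes m}}=\operatorname{Re}\int_{\mathbb R^m}F(x)\prod_{j=1}^m\overline{\xi(x_j)}\,dx$. The kernel is $$Q_1(x_1,\dots,x_m)=C_{m,\alpha,d}\Big(\int_0^1y^{-d}e^{iy(x_1+\cdots+x_m)}\,dy\Big)\prod_{j=1}^m|x_j|^{(\alpha-1)/2},\qquad C_{m,\alpha,d}=\epsilon\,(m!\,c_\alpha^m\,I_{m,\alpha,d})^{-1/2},$$ where $\epsilon\in\{-1,1\}$ is a fixed sign (in the paper, the sign of a Hermite coefficient $J_m\neq0$), $c_\alpha=2\Gamma(\alpha)\cos(\pi\alpha/2)$, and $I_{m,\alpha,d}=\int_0^1\int_0^1y^{-d}z^{-d}|y-z|^{-\alpha m}\,dy\,dz$, which equals the beta-function expression in the claim. *)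

theory Defs
  imports "HOL-Analysis.Analysis"
begin

text \<open>
  Elements of \<open>L\<^sup>2\<close> are represented by square-integrable functions, with identities between
  them holding almost everywhere.
\<close>

definition hermitian_L2 :: "(real \<Rightarrow> complex) set" where
  "hermitian_L2 =
     {h. h \<in> borel_measurable lborel \<and> integrable lborel (\<lambda>x. (cmod (h x))\<^sup>2) \<and>
         (AE x in lborel. h (- x) = cnj (h x))}"

definition herm_inner :: "(real \<Rightarrow> complex) \<Rightarrow> (real \<Rightarrow> complex) \<Rightarrow> real" where
  "herm_inner h g = Re (\<integral>x. h x * cnj (g x) \<partial>lborel)"

definition herm_norm :: "(real \<Rightarrow> complex) \<Rightarrow> real" where
  "herm_norm h = sqrt (herm_inner h h)"

text \<open>
  Points of \<open>\<real>\<^sup>m\<close> are functions on \<open>{..<m}\<close>, with the \<open>m\<close>-fold product of Lebesgue measure.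
  The Bochner integral below converges whenever \<open>F\<close> and \<open>\<xi>\<close> are square-integrable.
\<close>

definition tensor_pairing :: "nat \<Rightarrow> ((nat \<Rightarrow> real) \<Rightarrow> complex) \<Rightarrow> (real \<Rightarrow> complex) \<Rightarrow> real" where
  "tensor_pairing m F \<xi> =
     Re (\<integral>x. F x * (\<Prod>j<m. cnj (\<xi> (x j))) \<partial>(\<Pi>\<^sub>M j\<in>{..<m}. lborel))"

definition c_alpha :: "real \<Rightarrow> real" where
  "c_alpha \<alpha> = 2 * Gamma \<alpha> * cos (pi * \<alpha> / 2)"

text \<open>
  Here and in \<open>Q1\<close>, the convention \<open>0 powr a = 0\<close> only affects null sets.
\<close>

definition I_const :: "nat \<Rightarrow> real \<Rightarrow> real \<Rightarrow> real" where
  "I_const m \<alpha> d =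
     (LINT y:{0..1}|lborel. (LINT z:{0..1}|lborel.
        y powr (- d) * z powr (- d) * \<bar>y - z\<bar> powr (- (\<alpha> * real m))))"

definition C_const :: "real \<Rightarrow> nat \<Rightarrow> real \<Rightarrow> real \<Rightarrow> real" where
  "C_const \<epsilon> m \<alpha> d = \<epsilon> * (fact m * c_alpha \<alpha> ^ m * I_const m \<alpha> d) powr (- 1 / 2)"

definition Q1 :: "real \<Rightarrow> nat \<Rightarrow> real \<Rightarrow> real \<Rightarrow> (nat \<Rightarrow> real) \<Rightarrow> complex" where
  "Q1 \<epsilon> m \<alpha> d x =
     complex_of_real (C_const \<epsilon> m \<alpha> d) *
     (LINT y:{0..1}|lborel.
        complex_of_real (y powr (- d)) * exp (\<i> * complex_of_real (y * (\<Sum>j<m. x j)))) *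
     complex_of_real (\<Prod>j<m. \<bar>x j\<bar> powr ((\<alpha> - 1) / 2))"

text \<open>
  The supremum is taken in the extended reals, so that it is meaningful without presupposing
  boundedness.
\<close>

definition Lambda_sup :: "real \<Rightarrow> nat \<Rightarrow> real \<Rightarrow> real \<Rightarrow> ereal" where
  "Lambda_sup \<epsilon> m \<alpha> d =
     (SUP \<xi> \<in> {\<xi> \<in> hermitian_L2. herm_norm \<xi> \<le> 1}. ereal \<bar>tensor_pairing m (Q1 \<epsilon> m \<alpha> d) \<xi>\<bar>)"

definition L_const :: "nat \<Rightarrow> real \<Rightarrow> real \<Rightarrow> real" where
  "L_const m \<alpha> d =
     ((2 - \<alpha>) / (2 * (1 - \<alpha>))) powr (real m / 2) *
     (\<Sum>k=0..m. real (m choose k) *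
        Beta (1 - d + (1 - \<alpha>) * real k) (1 + (1 - \<alpha>) * (real m - real k))) /
     (fact m * I_const m \<alpha> d) powr (1 / 2)"

end

theory Submission
  imports Defs "HOL-Probability.Characteristic_Functions"
begin

text \<open>
  With \<open>g\<close> the (real) Fourier transform of \<open>\<bar>x\<bar> powr ((\<alpha> - 1) / 2) * cnj (\<xi> x)\<close>, the pairing is a
  constant times the integral of \<open>g ^ m\<close> against \<open>y powr (- d)\<close> on \<open>[0, 1]\<close>. Split \<open>g = a + b\<close> into
  the contributions of \<open>Re \<xi>\<close> (even) and \<open>Im \<xi>\<close> (odd), of squared norms \<open>p\<^sup>2\<close> and \<open>q\<^sup>2\<close> with
  \<open>p\<^sup>2 + q\<^sup>2 \<le> 1\<close>. By Cauchy--Schwarz the integral of \<open>a ^ k * b ^ (m - k)\<close> is at most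
  \<open>p ^ k * q ^ (m - k) * sqrt (N k)\<close>, where \<open>N k\<close> is the mutual energy of the even and odd parts of the
  Riesz kernel, and the \<open>N k\<close>, weighted by binomial coefficients, add up to the total energy. So the
  supremum is at most the maximum over the quarter disc of a polynomial in \<open>p, q\<close>, which by
  Cauchy--Schwarz for sums is strictly smaller than the root of the total energy: equality would make
  \<open>N k\<close> geometric and hence the even and odd kernels proportional.

  The weight \<open>\<bar>x\<bar> powr (\<alpha> - 1)\<close> is not integrable, so its Fourier transform is reached by writing it
  as a mixture of Gaussians \<open>exp (- s * x\<^sup>2)\<close> and cutting off small \<open>s\<close>. The truncated weights and
  kernels increase to the full ones, so all bounds survive the limit.

  The lower bound comes from the \<open>\<xi>\<close> for which \<open>g\<close> is proportional to the Riesz potential of the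
  indicator of \<open>[0, 1]\<close>.
\<close>

section \<open>Gaussian integrals and the Riesz kernel\<close>

text \<open>Strictness is the obstacle. The Hilbert norm of \<open>Q1\<close> is exactly
  \<open>fact m powr (- 1 / 2)\<close>, since \<open>C_const\<close> normalises the total energy
  \<open>c_alpha \<alpha> ^ m * I_const m \<alpha> d\<close>. The unit ball is not norm compact, so
  a strict inequality for each \<xi> would not yet give one for the supremum. Parity leaves only two
  numbers p and q of \<xi> in the bound; they range over a compact set, where a maximum is attained.
  Parity is a natural splitting: Hermitian symmetry lets Re \<xi> meet only cosines and Im \<xi>
  only sines, and on the unit square both resulting kernels are nonnegative, so their mixed powers
  have nonnegative energies that grow when a cutoff is removed. Powers of g are treated by
  multiplying positive semidefinite kernels one factor at a time, a Schur product argument that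
  replaces tensor products of Hilbert spaces. It is carried out for bounded kernels, which is a
  second use of the cutoff.\<close>

lemma has_bochner_integral_nonneg_has_integral:
  fixes f :: "real \<Rightarrow> real"
  assumes S: "S \<in> sets borel" and f: "f \<in> borel_measurable borel"
    and nonneg: "\<And>x. x \<in> S \<Longrightarrow> 0 \<le> f x" and I: "(f has_integral I) S"
  shows "has_bochner_integral lborel (\<lambda>x. indicator S x * f x) I"
proof (rule has_bochner_integral_nn_integral)
  show "(\<lambda>x. indicator S x * f x) \<in> borel_measurable lborel"
    using S f by measurable
  show "AE x in lborel. 0 \<le> indicator S x * f x"
    using nonneg by (auto simp: indicator_def)
  show "0 \<le> I" using I nonneg by (rule has_integral_nonneg)
  show "(\<integral>\<^sup>+ x. ennreal (indicator S x * f x) \<partial>lborel) = ennreal I"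
    by (intro nn_integral_has_integral_lebesgue nonneg I)
qed

section \<open>Gamma integrals, the Gaussian transform and the Fourier constant\<close>

text \<open>Read with \<open>b = (1 - \<alpha>) / 2\<close> and c the square of x, this writes
  \<open>\<bar>x\<bar> powr (\<alpha> - 1)\<close> as a mixture of Gaussians in x.\<close>

lemma has_bochner_integral_Gamma_scaled:
  fixes b c :: real
  assumes b: "b > 0" and c: "c > 0"
  shows "has_bochner_integral lborel
    (\<lambda>s. indicator {0<..} s * (s powr (b - 1) * exp (- (c * s)))) (Gamma b * c powr (- b))"
proof -
  have "((\<lambda>t. t powr (b - 1) / exp t) has_integral Gamma b) {0<..}"
  proof -
    have "((\<lambda>t. if t \<in> {0<..} then t powr (b - 1) / exp t else 0) has_integral Gamma b) {0..}"
      using Gamma_integral_real[OF b] by (rule has_integral_spike [of "{0}", rotated 2]) auto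
    also have "?this \<longleftrightarrow> ?thesis"
      by (subst has_integral_restrict) auto
    finally show ?thesis .
  qed
  then have "has_bochner_integral lborel (\<lambda>s. indicator {0<..} s * (s powr (b - 1) / exp s)) (Gamma b)"
    by (intro has_bochner_integral_nonneg_has_integral) auto
  then have 1: "has_bochner_integral lborel
      (\<lambda>s. indicator {0<..} (0 + c * s) * ((0 + c * s) powr (b - 1) / exp (0 + c * s))) (Gamma b /\<^sub>R \<bar>c\<bar>)"
    using c by (subst (asm) lborel_has_bochner_integral_real_affine_iff[where t = 0 and c = c]) auto
  have "has_bochner_integral lborel
      (\<lambda>s. c powr (1 - b) * (indicator {0<..} (0 + c * s) * ((0 + c * s) powr (b - 1) / exp (0 + c * s))))
      (c powr (1 - b) * (Gamma b /\<^sub>R \<bar>c\<bar>))"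
    by (rule has_bochner_integral_mult_right) (use 1 in auto)
  also have "c powr (1 - b) * (Gamma b /\<^sub>R \<bar>c\<bar>) = Gamma b * c powr (- b)"
    using c by (simp add: powr_diff powr_minus field_simps)
  also have "(\<lambda>s. c powr (1 - b) * (indicator {0<..} (0 + c * s) * ((0 + c * s) powr (b - 1) / exp (0 + c * s))))
     = (\<lambda>s. indicator {0<..} s * (s powr (b - 1) * exp (- (c * s))))"
  proof
    fix s
    have "c powr (1 - b) * (c powr (b - 1) * x) = x" for x
      using c by (simp add: mult.assoc[symmetric] powr_add[symmetric])
    then show "c powr (1 - b) * (indicator {0<..} (0 + c * s) * ((0 + c * s) powr (b - 1) / exp (0 + c * s)))
     = indicator {0<..} s * (s powr (b - 1) * exp (- (c * s)))"
      using c by (auto simp: indicator_def zero_less_mult_iff powr_mult exp_minus field_simps)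
  qed
  finally show ?thesis .
qed

text \<open>The transform of a Gaussian with parameter s has s in the denominator of its exponent,
  so the mixture of the transforms is a Gamma integral in 1/s. Inverting the variable reduces it to
  the previous lemma, and the Jacobian shifts the power.\<close>

lemma has_bochner_integral_Gamma_inverse:
  fixes b c :: real
  assumes b: "b > 0" and c: "c > 0"
  shows "has_bochner_integral lborel
    (\<lambda>s. indicator {0<..} s * (s powr (- b - 1) * exp (- (c / s)))) (Gamma b * c powr (- b))"
proof -
  let ?f = "\<lambda>s. s powr (b - 1) * exp (- (c * s))"
  let ?g = "\<lambda>s::real. 1 / s"
  have hb: "has_bochner_integral lborel (\<lambda>s. indicator {0<..} s * ?f s) (Gamma b * c powr (- b))"
    by (rule has_bochner_integral_Gamma_scaled[OF b c])
  have img: "?g ` {0<..} = {0<..}"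
  proof
    show "{0<..} \<subseteq> ?g ` {0<..}"
    proof
      fix x :: real assume "x \<in> {0<..}"
      then show "x \<in> ?g ` {0<..}" by (intro image_eqI[where x = "1 / x"]) auto
    qed
  qed auto
  have ai: "?f absolutely_integrable_on ?g ` {0<..}"
    unfolding img set_integrable_def
    using hb by (subst integrable_completion) (auto simp: has_bochner_integral_iff)
  have "(LINT s:{0<..}|lborel. ?f s) = integral {0<..} ?f"
    by (rule set_borel_integral_eq_integral)
       (use hb in \<open>auto simp: set_integrable_def has_bochner_integral_iff\<close>)
  then have int: "integral (?g ` {0<..}) ?f = Gamma b * c powr (- b)"
    unfolding img using hb by (auto simp: set_lebesgue_integral_def has_bochner_integral_iff)
  have der: "(?g has_field_derivative - (1 / x\<^sup>2)) (at x within {0<..})" if "x \<in> {0<..}" for x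
    using that by (auto intro!: derivative_eq_intros simp: power2_eq_square)
  have inj: "inj_on ?g {0<..}" by (auto intro!: inj_onI)
  have "(\<lambda>x. \<bar>- (1 / x\<^sup>2)\<bar> * ?f (?g x)) absolutely_integrable_on {0<..} \<and>
      integral {0<..} (\<lambda>x. \<bar>- (1 / x\<^sup>2)\<bar> * ?f (?g x)) = Gamma b * c powr (- b)"
    by (rule iffD2[OF has_absolute_integral_change_of_variables_1'[OF _ der inj]])
       (use ai int in auto)
  then have "((\<lambda>x. \<bar>- (1 / x\<^sup>2)\<bar> * ?f (?g x)) has_integral Gamma b * c powr (- b)) {0<..}"
    by (auto simp: has_integral_iff dest: set_lebesgue_integral_eq_integral(1))
  then have "has_bochner_integral lborel (\<lambda>x. indicator {0<..} x * (\<bar>- (1 / x\<^sup>2)\<bar> * ?f (?g x)))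
      (Gamma b * c powr (- b))"
    by (intro has_bochner_integral_nonneg_has_integral) auto
  also have "(\<lambda>x. indicator {0<..} x * (\<bar>- (1 / x\<^sup>2)\<bar> * ?f (?g x)))
      = (\<lambda>s. indicator {0<..} s * (s powr (- b - 1) * exp (- (c / s))))"
  proof
    fix x :: real
    have key: "x powr (- b - 1) = 1 / x\<^sup>2 * (1 / x) powr (b - 1)" if "x > 0"
    proof -
      have "x powr (- b - 1) = x powr (-2) * x powr (1 - b)"
      proof -
        have "- b - 1 = - 2 + (1 - b)" by simp
        then show ?thesis by (simp only: powr_add)
      qed
      also have "x powr (-2) = 1 / x\<^sup>2"
        using that by (simp add: powr_minus powr_numeral divide_inverse)
      also have "x powr (1 - b) = (1 / x) powr (b - 1)"
        using that powr_minus[of x "b - 1"] by (simp add: powr_divide inverse_eq_divide)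
      finally show ?thesis by simp
    qed
    show "indicator {0<..} x * (\<bar>- (1 / x\<^sup>2)\<bar> * ?f (?g x))
      = indicator {0<..} x * (x powr (- b - 1) * exp (- (c / x)))"
      by (auto simp: indicator_def key)
  qed
  finally show ?thesis .
qed

lemma has_bochner_integral_gaussian_cos:
  fixes s u :: real
  assumes s: "s > 0"
  shows "has_bochner_integral lborel (\<lambda>x. exp (- (s * x\<^sup>2)) * cos (u * x))
    (sqrt (pi / s) * exp (- (u\<^sup>2 / (4 * s))))"
proof -
  \<comment> \<open>Chosen so that half the square of c x equals s times the square of x; the
    frequency is rescaled to t accordingly, and the characteristic function of the standard normal
    law applies.\<close>
  define c where "c = sqrt (2 * s)"
  have c: "c > 0" "c\<^sup>2 = 2 * s" using s by (auto simp: c_def)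
  define t where "t = u / c"
  interpret real_distribution std_normal_distribution by (rule real_dist_normal_dist)
  have int: "integrable std_normal_distribution (\<lambda>x. iexp (t * x))"
    by (rule integrable_const_bound[where B = 1]) auto
  have "(\<integral>x. cos (t * x) \<partial>std_normal_distribution) = Re (char std_normal_distribution t)"
    unfolding char_def by (subst integral_Re[OF int, symmetric]) (simp add: Re_exp)
  also have "\<dots> = exp (- t\<^sup>2 / 2)"
    by (simp add: char_std_normal_distribution)
  finally have 1: "(\<integral>x. cos (t * x) \<partial>std_normal_distribution) = exp (- t\<^sup>2 / 2)" .
  have 2: "integrable std_normal_distribution (\<lambda>x. cos (t * x))"
    by (rule integrable_const_bound[where B = 1]) auto
  have "has_bochner_integral lborel (\<lambda>x. std_normal_density x * cos (t * x)) (exp (- t\<^sup>2 / 2))"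
    using 1 2 unfolding has_bochner_integral_iff
    by (subst (asm) integral_density, auto simp: integrable_density)
  then have 3: "has_bochner_integral lborel (\<lambda>x. std_normal_density (0 + c * x) * cos (t * (0 + c * x)))
      (exp (- t\<^sup>2 / 2) /\<^sub>R \<bar>c\<bar>)"
    using c by (subst (asm) lborel_has_bochner_integral_real_affine_iff[where t = 0 and c = c]) auto
  have "has_bochner_integral lborel (\<lambda>x. sqrt (2 * pi) * (std_normal_density (0 + c * x) * cos (t * (0 + c * x))))
      (sqrt (2 * pi) * (exp (- t\<^sup>2 / 2) /\<^sub>R \<bar>c\<bar>))"
    by (rule has_bochner_integral_mult_right) (use 3 in auto)
  also have "(\<lambda>x. sqrt (2 * pi) * (std_normal_density (0 + c * x) * cos (t * (0 + c * x))))
     = (\<lambda>x. exp (- (s * x\<^sup>2)) * cos (u * x))"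
    using c s by (auto simp: std_normal_density_def t_def power_mult_distrib)
  also have "sqrt (2 * pi) * (exp (- t\<^sup>2 / 2) /\<^sub>R \<bar>c\<bar>) = sqrt (pi / s) * exp (- (u\<^sup>2 / (4 * s)))"
    using c s by (simp add: t_def power_divide c_def real_sqrt_mult real_sqrt_divide field_simps)
  finally show ?thesis .
qed

text \<open>The Gaussian mixture yields the Fourier constant as a quotient of Gamma values at half
  arguments. Legendre duplication at \<open>\<alpha> / 2\<close> and reflection at
  \<open>(1 + \<alpha>) / 2\<close> identify it with the cosine form.\<close>

lemma c_alpha_eq:
  assumes \<alpha>: "0 < \<alpha>" "\<alpha> < 1"
  shows "c_alpha \<alpha> = sqrt pi * 2 powr \<alpha> * Gamma (\<alpha> / 2) / Gamma ((1 - \<alpha>) / 2)"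
proof -
  have np: "complex_of_real x \<notin> \<int>\<^sub>\<le>\<^sub>0" if "x > 0" for x
    using that by (auto elim!: nonpos_Ints_cases simp: complex_eq_iff)
  have "Gamma (of_real (\<alpha>/2)) * Gamma (of_real (\<alpha>/2) + 1/2 :: complex) =
      exp ((1 - 2 * of_real (\<alpha>/2)) * of_real (ln 2)) * of_real (sqrt pi) * Gamma (2 * of_real (\<alpha>/2))"
  proof (rule Gamma_legendre_duplication)
    have "of_real (\<alpha>/2) + 1/2 = complex_of_real (\<alpha>/2 + 1/2)" by simp
    then show "of_real (\<alpha>/2) + 1/2 \<notin> (\<int>\<^sub>\<le>\<^sub>0 :: complex set)" using np[of "\<alpha>/2 + 1/2"] \<alpha> by simp
  qed (use np[of "\<alpha>/2"] \<alpha> in simp)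
  also have "of_real (\<alpha>/2) + 1/2 = complex_of_real ((1 + \<alpha>)/2)" by (simp add: field_simps)
  also have "2 * of_real (\<alpha>/2) = complex_of_real \<alpha>" by simp
  also have "exp ((1 - complex_of_real \<alpha>) * of_real (ln 2)) = of_real (2 powr (1 - \<alpha>))"
    by (simp add: powr_def exp_of_real[symmetric])
  finally have "complex_of_real (Gamma (\<alpha>/2) * Gamma ((1 + \<alpha>)/2)) =
      of_real (2 powr (1 - \<alpha>) * sqrt pi * Gamma \<alpha>)"
    by (simp only: Gamma_complex_of_real of_real_mult)
  then have dup: "Gamma (\<alpha>/2) * Gamma ((1 + \<alpha>)/2) = 2 powr (1 - \<alpha>) * sqrt pi * Gamma \<alpha>"
    by (simp only: of_real_eq_iff)
  have "Gamma (of_real ((1 + \<alpha>)/2)) * Gamma (1 - of_real ((1 + \<alpha>)/2) :: complex) =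
      of_real pi / sin (of_real pi * of_real ((1 + \<alpha>)/2))"
    by (rule Gamma_reflection_complex)
  also have "1 - of_real ((1 + \<alpha>)/2) = complex_of_real ((1 - \<alpha>)/2)" by (simp add: field_simps)
  also have "sin (complex_of_real pi * of_real ((1 + \<alpha>)/2)) = of_real (sin (pi * ((1 + \<alpha>)/2)))"
    by (simp only: of_real_mult[symmetric] sin_of_real)
  also have "sin (pi * ((1 + \<alpha>)/2)) = cos (pi * \<alpha> / 2)"
  proof -
    have "pi * ((1 + \<alpha>)/2) = pi * \<alpha> / 2 + pi / 2" by (simp add: field_simps)
    then show ?thesis by (simp only: sin_add) simp
  qed
  finally have "complex_of_real (Gamma ((1 + \<alpha>)/2) * Gamma ((1 - \<alpha>)/2)) = of_real (pi / cos (pi * \<alpha> / 2))"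
    by (simp only: Gamma_complex_of_real of_real_mult[symmetric] of_real_divide[symmetric])
  then have refl: "Gamma ((1 + \<alpha>)/2) * Gamma ((1 - \<alpha>)/2) = pi / cos (pi * \<alpha> / 2)"
    by (simp only: of_real_eq_iff)
  have "pi * \<alpha> < pi * 1" using \<alpha> by (intro mult_strict_left_mono) auto
  then have "- (pi / 2) < pi * \<alpha> / 2" "pi * \<alpha> / 2 < pi / 2"
    using \<alpha> pi_gt_zero mult_pos_pos[of pi \<alpha>] by (linarith, linarith)
  then have cos: "cos (pi * \<alpha> / 2) > 0" by (intro cos_gt_zero_pi) auto
  have G: "Gamma ((1 - \<alpha>)/2) > 0" "Gamma ((1 + \<alpha>)/2) > 0"
    using \<alpha> by (auto intro!: Gamma_real_pos)
  have "Gamma \<alpha> = Gamma (\<alpha>/2) * Gamma ((1 + \<alpha>)/2) / (2 powr (1 - \<alpha>) * sqrt pi)"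
    using dup by (simp add: field_simps)
  moreover have "cos (pi * \<alpha> / 2) = pi / (Gamma ((1 + \<alpha>)/2) * Gamma ((1 - \<alpha>)/2))"
    unfolding refl using cos by simp
  ultimately have "c_alpha \<alpha> = 2 * Gamma (\<alpha>/2) * Gamma ((1 + \<alpha>)/2) / (2 powr (1 - \<alpha>) * sqrt pi)
      * (pi / (Gamma ((1 + \<alpha>)/2) * Gamma ((1 - \<alpha>)/2)))"
    by (simp add: c_alpha_def)
  also have "\<dots> = 2 / 2 powr (1 - \<alpha>) * (pi / sqrt pi) * Gamma (\<alpha>/2) / Gamma ((1 - \<alpha>)/2)"
    using G by (simp add: field_simps)
  also have "2 / 2 powr (1 - \<alpha>) = 2 powr \<alpha>" by (simp add: powr_diff)
  also have "pi / sqrt pi = sqrt pi" by (rule real_div_sqrt) simp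
  finally show ?thesis by (simp add: mult_ac)
qed

lemma c_alpha_pos:
  assumes \<alpha>: "0 < \<alpha>" "\<alpha> < 1"
  shows "c_alpha \<alpha> > 0"
  using \<alpha> by (auto simp: c_alpha_eq intro!: mult_pos_pos divide_pos_pos)

section \<open>Truncated weight and truncated Riesz kernel\<close>

text \<open>The Gaussian mixture for \<open>\<bar>x\<bar> powr (\<alpha> - 1)\<close>, restricted to
  parameters above r. Small parameters are the wide Gaussians that build the non-integrable tail at
  infinity; the singularity at 0 stays, and it is integrable.\<close>

definition wcut :: "real \<Rightarrow> real \<Rightarrow> real \<Rightarrow> real" where
  "wcut \<alpha> r x = (\<integral>s. indicator {r<..} s * (s powr ((1 - \<alpha>) / 2 - 1) * exp (- (x\<^sup>2 * s))) \<partial>lborel)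
     / Gamma ((1 - \<alpha>) / 2)"

text \<open>The cosine transform of \<open>wcut\<close>, taken Gaussian by Gaussian. The factor
  \<open>sqrt (pi / s)\<close> of each transform lowers the exponent of s by 1/2. For positive r the
  integral converges even at \<open>u = 0\<close>, so this kernel is bounded.\<close>

definition Kcut :: "real \<Rightarrow> real \<Rightarrow> real \<Rightarrow> real" where
  "Kcut \<alpha> r u = sqrt pi *
     (\<integral>s. indicator {r<..} s * (s powr (- (\<alpha> / 2) - 1) * exp (- (u\<^sup>2 / 4 / s))) \<partial>lborel)
     / Gamma ((1 - \<alpha>) / 2)"

definition rieszK :: "real \<Rightarrow> real \<Rightarrow> real" where
  "rieszK \<alpha> u = c_alpha \<alpha> * \<bar>u\<bar> powr (- \<alpha>)"

text \<open>Stated for a general integrand because it serves three: those of the weight, of the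
  kernel, and of the difference of two kernel values.\<close>

lemma cut_integral:
  fixes f :: "real \<Rightarrow> real"
  assumes f: "has_bochner_integral lborel (\<lambda>s. indicator {0<..} s * f s) I"
    and nonneg: "\<And>s. s > 0 \<Longrightarrow> f s \<ge> 0"
  shows cut_integral_le: "r \<ge> 0 \<Longrightarrow> (\<integral>s. indicator {r<..} s * f s \<partial>lborel) \<le> I"
    and cut_integral_tendsto:
      "(\<lambda>n. \<integral>s. indicator {inverse (real (Suc n))<..} s * f s \<partial>lborel) \<longlonglongrightarrow> I"
proof -
  have int0: "integrable lborel (\<lambda>s. indicator {0<..} s * f s)"
    and I: "I = (\<integral>s. indicator {0<..} s * f s \<partial>lborel)"
    using f by (auto simp: has_bochner_integral_iff)
  \<comment> \<open>Only the restriction of f to the positive half-line is known to be measurable,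
    so every truncation is factored through it.\<close>
  have eq: "(\<lambda>s. indicator {r<..} s * f s) = (\<lambda>s. indicator {r<..} s * (indicator {0<..} s * f s))"
    if "r \<ge> 0" for r
    using that by (auto simp: indicator_def fun_eq_iff)
  have meas: "(\<lambda>s. indicator {r<..} s * f s) \<in> borel_measurable lborel" if "r \<ge> 0" for r
    unfolding eq[OF that] by (rule borel_measurable_times[OF _ borel_measurable_integrable[OF int0]]) auto
  have 1: "integrable lborel (\<lambda>s. indicator {r<..} s * f s)" if "r \<ge> 0" for r
    by (rule Bochner_Integration.integrable_bound[OF int0 meas[OF that]])
       (use that in \<open>auto simp: indicator_def\<close>)
  show "(\<integral>s. indicator {r<..} s * f s \<partial>lborel) \<le> I" if "r \<ge> 0" for r
    unfolding I by (rule integral_mono[OF 1[OF that] int0])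
      (use that nonneg in \<open>auto simp: indicator_def\<close>)
  show "(\<lambda>n. \<integral>s. indicator {inverse (real (Suc n))<..} s * f s \<partial>lborel) \<longlonglongrightarrow> I"
    unfolding I
  proof (rule integral_dominated_convergence[where w = "\<lambda>s. \<bar>indicator {0<..} s * f s\<bar>"])
    show "AE s in lborel. (\<lambda>n. indicator {inverse (real (Suc n))<..} s * f s) \<longlonglongrightarrow> indicator {0<..} s * f s"
    proof (rule AE_I2)
      fix s :: real
      show "(\<lambda>n. indicator {inverse (real (Suc n))<..} s * f s) \<longlonglongrightarrow> indicator {0<..} s * f s"
      proof (cases "s > 0")
        case True
        have "eventually (\<lambda>n. inverse (real (Suc n)) < s) sequentially"
          using LIMSEQ_inverse_real_of_nat True by (rule order_tendstoD)
        then have "eventually (\<lambda>n. indicator {inverse (real (Suc n))<..} s * f s = indicator {0<..} s * f s) sequentially"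
          by eventually_elim (use True in \<open>auto simp: indicator_def\<close>)
        then show ?thesis by (rule tendsto_eventually)
      next
        case False
        then have "\<not> inverse (real (Suc n)) < s" for n
          by (metis inverse_positive_iff_positive less_trans of_nat_0_less_iff zero_less_Suc)
        with False show ?thesis by (simp add: indicator_def)
      qed
    qed
    show "integrable lborel (\<lambda>s. \<bar>indicator {0<..} s * f s\<bar>)"
      using int0 by (rule integrable_abs)
    show "(\<lambda>s. indicator {inverse (real (Suc n))<..} s * f s) \<in> borel_measurable lborel" for n
      by (intro meas) auto
    show "AE s in lborel. norm (indicator {inverse (real (Suc n))<..} s * f s) \<le> \<bar>indicator {0<..} s * f s\<bar>" for n
    proof (rule AE_I2)
      fix s :: real
      have "inverse (real (Suc n)) > 0" by simp
      then have "inverse (real (Suc n)) < s \<Longrightarrow> 0 < s"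
        by (rule less_trans)
      then show "norm (indicator {inverse (real (Suc n))<..} s * f s) \<le> \<bar>indicator {0<..} s * f s\<bar>"
        by (auto simp: indicator_def simp del: of_nat_Suc)
    qed
  qed (use int0 in auto)
qed

lemma rieszK_nonneg: "0 < \<alpha> \<Longrightarrow> \<alpha> < 1 \<Longrightarrow> 0 \<le> rieszK \<alpha> u"
  using c_alpha_pos[of \<alpha>] by (simp add: rieszK_def)

lemma rieszK_measurable [measurable]: "rieszK \<alpha> \<in> borel_measurable borel"
  unfolding rieszK_def by measurable

lemma wcut_measurable [measurable]: "wcut \<alpha> r \<in> borel_measurable borel"
  unfolding wcut_def by measurable

lemma Kcut_measurable [measurable]: "Kcut \<alpha> r \<in> borel_measurable borel"
  unfolding Kcut_def by measurable

context
  fixes \<alpha> :: real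
  assumes \<alpha>: "0 < \<alpha>" "\<alpha> < 1"
begin

lemma Gamma_half_pos: "Gamma ((1 - \<alpha>) / 2) > 0"
  using \<alpha> by (intro Gamma_real_pos) auto

lemma wcut_base:
  assumes "x \<noteq> 0"
  shows "has_bochner_integral lborel
    (\<lambda>s. indicator {0<..} s * (s powr ((1 - \<alpha>) / 2 - 1) * exp (- (x\<^sup>2 * s))))
    (Gamma ((1 - \<alpha>) / 2) * \<bar>x\<bar> powr (\<alpha> - 1))"
proof -
  have "(x\<^sup>2) powr (- ((1 - \<alpha>) / 2)) = (\<bar>x\<bar> powr 2) powr (- ((1 - \<alpha>) / 2))"
    using assms by simp
  also have "\<dots> = \<bar>x\<bar> powr (\<alpha> - 1)"
    unfolding powr_powr by (rule arg_cong[where f = "\<lambda>e. \<bar>x\<bar> powr e"]) (simp add: field_simps)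
  finally have "(x\<^sup>2) powr (- ((1 - \<alpha>) / 2)) = \<bar>x\<bar> powr (\<alpha> - 1)" .
  then show ?thesis
    using has_bochner_integral_Gamma_scaled[of "(1 - \<alpha>) / 2" "x\<^sup>2"] \<alpha> assms by simp
qed

lemma wcut_nonneg: "0 \<le> wcut \<alpha> r x"
  unfolding wcut_def by (intro divide_nonneg_pos Gamma_half_pos Bochner_Integration.integral_nonneg) simp

lemma wcut_le: "r \<ge> 0 \<Longrightarrow> x \<noteq> 0 \<Longrightarrow> wcut \<alpha> r x \<le> \<bar>x\<bar> powr (\<alpha> - 1)"
  using cut_integral_le[OF wcut_base, of x r] Gamma_half_pos
  by (auto simp: wcut_def divide_le_eq mult_ac)

lemma wcut_tendsto:
  assumes "x \<noteq> 0"
  shows "(\<lambda>n. wcut \<alpha> (inverse (real (Suc n))) x) \<longlonglongrightarrow> \<bar>x\<bar> powr (\<alpha> - 1)"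
proof -
  have "(\<lambda>n. wcut \<alpha> (inverse (real (Suc n))) x) \<longlonglongrightarrow>
      Gamma ((1 - \<alpha>) / 2) * \<bar>x\<bar> powr (\<alpha> - 1) / Gamma ((1 - \<alpha>) / 2)"
    unfolding wcut_def
    by (rule tendsto_divide[OF cut_integral_tendsto[OF wcut_base[OF assms]] tendsto_const])
       (use Gamma_half_pos in auto)
  then show ?thesis using Gamma_half_pos by simp
qed

lemma Kcut_base:
  assumes "u \<noteq> 0"
  shows "has_bochner_integral lborel
    (\<lambda>s. indicator {0<..} s * (s powr (- (\<alpha> / 2) - 1) * exp (- (u\<^sup>2 / 4 / s))))
    (rieszK \<alpha> u * Gamma ((1 - \<alpha>) / 2) / sqrt pi)"
proof -
  have "(u\<^sup>2 / 4) powr (- (\<alpha> / 2)) = ((\<bar>u\<bar> / 2) powr 2) powr (- (\<alpha> / 2))"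
    using assms by (simp add: power_divide)
  also have "\<dots> = \<bar>u\<bar> powr (- \<alpha>) * 2 powr \<alpha>"
    unfolding powr_powr using assms by (simp add: powr_divide powr_minus_divide)
  finally have "Gamma (\<alpha> / 2) * (u\<^sup>2 / 4) powr (- (\<alpha> / 2)) = rieszK \<alpha> u * Gamma ((1 - \<alpha>) / 2) / sqrt pi"
    using Gamma_half_pos by (simp add: rieszK_def c_alpha_eq[OF \<alpha>] field_simps)
  then show ?thesis
    using has_bochner_integral_Gamma_inverse[of "\<alpha> / 2" "u\<^sup>2 / 4"] \<alpha> assms by simp
qed

lemma Kcut_0_integrable:
  assumes "r > 0"
  shows "integrable lborel (\<lambda>s. indicator {r<..} s * (s powr (- (\<alpha> / 2) - 1)))"
proof -
  have "((\<lambda>s. s powr (- (\<alpha> / 2) - 1)) has_integral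
      - (r powr (- (\<alpha> / 2) - 1 + 1)) / (- (\<alpha> / 2) - 1 + 1)) {r..}"
    by (rule has_integral_powr_to_inf) (use assms \<alpha> in auto)
  then have "integrable lborel (\<lambda>s. indicator {r..} s * (s powr (- (\<alpha> / 2) - 1)))"
    by (intro conjunct1[OF iffD1[OF has_bochner_integral_iff has_bochner_integral_nonneg_has_integral]]) auto
  then show ?thesis
    by (rule Bochner_Integration.integrable_bound) (auto simp: indicator_def)
qed

lemma Kcut_integrable:
  assumes "r > 0"
  shows "integrable lborel (\<lambda>s. indicator {r<..} s * (s powr (- (\<alpha> / 2) - 1) * exp (- (u\<^sup>2 / 4 / s))))"
proof (rule Bochner_Integration.integrable_bound[OF Kcut_0_integrable[OF assms]])
  have "\<bar>indicator {r<..} s * (s powr (- (\<alpha> / 2) - 1) * exp (- (u\<^sup>2 / 4 / s)))\<bar>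
      \<le> \<bar>indicator {r<..} s * (s powr (- (\<alpha> / 2) - 1))\<bar>" for s
  proof (cases "s > r")
    case True
    then have "s powr (- (\<alpha> / 2) - 1) * exp (- (u\<^sup>2 / 4 / s)) \<le> s powr (- (\<alpha> / 2) - 1)"
      using assms by (intro mult_left_le) auto
    with True show ?thesis by simp
  qed simp
  then show "AE s in lborel. norm (indicator {r<..} s * (s powr (- (\<alpha> / 2) - 1) * exp (- (u\<^sup>2 / 4 / s))))
      \<le> norm (indicator {r<..} s * (s powr (- (\<alpha> / 2) - 1)))"
    by (intro AE_I2) (simp only: real_norm_def)
qed measurable

lemma Kcut_nonneg: "0 \<le> Kcut \<alpha> r u"
  unfolding Kcut_def
  by (intro divide_nonneg_pos mult_nonneg_nonneg Gamma_half_pos Bochner_Integration.integral_nonneg) simp_all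

lemma Kcut_antimono:
  assumes "r > 0" "\<bar>u\<bar> \<le> \<bar>v\<bar>"
  shows "Kcut \<alpha> r v \<le> Kcut \<alpha> r u"
proof -
  have uv: "u\<^sup>2 \<le> v\<^sup>2" using assms(2) by (simp add: abs_le_square_iff)
  have "indicator {r<..} s * (s powr (- (\<alpha> / 2) - 1) * exp (- (v\<^sup>2 / 4 / s)))
      \<le> indicator {r<..} s * (s powr (- (\<alpha> / 2) - 1) * exp (- (u\<^sup>2 / 4 / s)))" for s
    using uv assms(1) by (cases "s > r") (auto intro!: mult_left_mono divide_right_mono)
  then have "(\<integral>s. indicator {r<..} s * (s powr (- (\<alpha> / 2) - 1) * exp (- (v\<^sup>2 / 4 / s))) \<partial>lborel)
      \<le> (\<integral>s. indicator {r<..} s * (s powr (- (\<alpha> / 2) - 1) * exp (- (u\<^sup>2 / 4 / s))) \<partial>lborel)"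
    by (rule integral_mono[OF Kcut_integrable[OF assms(1)] Kcut_integrable[OF assms(1)]])
  then show ?thesis
    unfolding Kcut_def using Gamma_half_pos
    by (intro divide_right_mono mult_left_mono) auto
qed

lemma Kcut_le: "r > 0 \<Longrightarrow> u \<noteq> 0 \<Longrightarrow> Kcut \<alpha> r u \<le> rieszK \<alpha> u"
  using cut_integral_le[OF Kcut_base, of u r] Gamma_half_pos
  by (auto simp: Kcut_def divide_le_eq le_divide_eq mult_ac)

lemma Kcut_tendsto:
  assumes "u \<noteq> 0"
  shows "(\<lambda>n. Kcut \<alpha> (inverse (real (Suc n))) u) \<longlonglongrightarrow> rieszK \<alpha> u"
proof -
  have "(\<lambda>n. Kcut \<alpha> (inverse (real (Suc n))) u) \<longlonglongrightarrow>
      sqrt pi * (rieszK \<alpha> u * Gamma ((1 - \<alpha>) / 2) / sqrt pi) / Gamma ((1 - \<alpha>) / 2)"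
    unfolding Kcut_def
    by (rule tendsto_divide[OF tendsto_mult[OF tendsto_const cut_integral_tendsto[OF Kcut_base[OF assms]]] tendsto_const])
       (use Gamma_half_pos in auto)
  then show ?thesis using Gamma_half_pos by simp
qed

text \<open>Needed for the odd kernel, a difference of two kernel values that \<open>Kcut_le\<close>
  cannot control. The integrands already differ by a nonnegative amount for each s, because a
  Gaussian decreases in the modulus of its argument; cutting off s therefore lowers the difference
  too.\<close>

lemma Kcut_diff_le:
  assumes "r > 0" "u \<noteq> 0" "\<bar>u\<bar> \<le> \<bar>v\<bar>"
  shows "Kcut \<alpha> r u - Kcut \<alpha> r v \<le> rieszK \<alpha> u - rieszK \<alpha> v"
proof -
  let ?f = "\<lambda>u s. s powr (- (\<alpha> / 2) - 1) * exp (- (u\<^sup>2 / 4 / s))"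
  let ?G = "Gamma ((1 - \<alpha>) / 2)"
  have v: "v \<noteq> 0" using assms by auto
  have uv: "u\<^sup>2 \<le> v\<^sup>2" using assms by (simp add: abs_le_square_iff)
  have hb: "has_bochner_integral lborel (\<lambda>s. indicator {0<..} s * (?f u s - ?f v s))
     (rieszK \<alpha> u * ?G / sqrt pi - rieszK \<alpha> v * ?G / sqrt pi)"
    using has_bochner_integral_diff[OF Kcut_base[OF assms(2)] Kcut_base[OF v]]
    by (simp add: right_diff_distrib)
  have "(\<integral>s. indicator {r<..} s * (?f u s - ?f v s) \<partial>lborel) \<le> rieszK \<alpha> u * ?G / sqrt pi - rieszK \<alpha> v * ?G / sqrt pi"
    by (rule cut_integral_le[OF hb])
       (use assms(1) uv in \<open>auto intro!: mult_left_mono divide_right_mono\<close>)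
  also have "(\<integral>s. indicator {r<..} s * (?f u s - ?f v s) \<partial>lborel) =
     (\<integral>s. indicator {r<..} s * ?f u s \<partial>lborel) - (\<integral>s. indicator {r<..} s * ?f v s \<partial>lborel)"
    unfolding right_diff_distrib
    by (rule Bochner_Integration.integral_diff) (intro Kcut_integrable assms)+
  finally have "sqrt pi / ?G * ((\<integral>s. indicator {r<..} s * ?f u s \<partial>lborel) - (\<integral>s. indicator {r<..} s * ?f v s \<partial>lborel))
     \<le> sqrt pi / ?G * (rieszK \<alpha> u * ?G / sqrt pi - rieszK \<alpha> v * ?G / sqrt pi)"
    using Gamma_half_pos by (intro mult_left_mono) auto
  also have "\<dots> = rieszK \<alpha> u - rieszK \<alpha> v"
    using Gamma_half_pos by (simp add: field_simps)
  finally show ?thesis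
    by (simp add: Kcut_def right_diff_distrib)
qed

text \<open>Fubini in s and x. The cutoff makes the double integral absolutely convergent:
  integrating the Gaussians over x leaves a multiple of
  \<open>s powr (- (\<alpha> / 2) - 1)\<close>, which is integrable above r.\<close>

lemma wcut_cos:
  assumes r: "r > 0"
  shows "has_bochner_integral lborel (\<lambda>x. wcut \<alpha> r x * cos (u * x)) (Kcut \<alpha> r u)"
proof -
  let ?b = "(1 - \<alpha>) / 2 - 1"
  let ?E = "\<lambda>s x. indicator {r<..} s * (s powr ?b * exp (- (x\<^sup>2 * s)))"
  let ?F = "\<lambda>s x. ?E s x * cos (u * x)"
  have sq: "s powr ?b * sqrt (pi / s) = sqrt pi * s powr (- (\<alpha> / 2) - 1)" if "s > 0" for s
  proof -
    have "- (\<alpha> / 2) - 1 = ?b - 1 / 2" by (simp add: field_simps)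
    then have "s powr (- (\<alpha> / 2) - 1) = s powr ?b / sqrt s"
      using that by (simp only: powr_diff powr_half_sqrt)
    then show ?thesis using that by (simp add: real_sqrt_divide)
  qed
  have gc: "has_bochner_integral lborel (\<lambda>x. ?E s x * cos (v * x))
     (sqrt pi * (indicator {r<..} s * (s powr (- (\<alpha> / 2) - 1) * exp (- (v\<^sup>2 / 4 / s)))))" for s v
  proof (cases "s > r")
    case True
    then have s: "s > 0" using r by simp
    have "has_bochner_integral lborel (\<lambda>x. s powr ?b * (exp (- (s * x\<^sup>2)) * cos (v * x)))
       (s powr ?b * (sqrt (pi / s) * exp (- (v\<^sup>2 / (4 * s)))))"
      by (rule has_bochner_integral_mult_right) (use has_bochner_integral_gaussian_cos[OF s] in auto)
    also have "s powr ?b * (sqrt (pi / s) * exp (- (v\<^sup>2 / (4 * s)))) =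
        sqrt pi * (s powr (- (\<alpha> / 2) - 1) * exp (- (v\<^sup>2 / (4 * s))))"
      using sq[OF s] by (simp only: mult.assoc[symmetric])
    finally show ?thesis
      using True by (simp add: mult_ac)
  next
    case False
    then have "indicator {r<..} s = (0::real)" by simp
    then show ?thesis by (simp only: mult_zero_left mult_zero_right has_bochner_integral_zero)
  qed
  have gc0: "has_bochner_integral lborel (\<lambda>x. ?E s x)
     (sqrt pi * (indicator {r<..} s * s powr (- (\<alpha> / 2) - 1)))" for s
    using gc[of s 0]
    by (simp only: mult_zero_left cos_zero mult_1_right zero_power2 div_0 minus_zero exp_zero)
  have int0: "integrable (lborel \<Otimes>\<^sub>M lborel) (\<lambda>(s, x). ?E s x)"
  proof (rule lborel_pair.Fubini_integrable)
    have "(\<lambda>s. \<integral>x. norm (case (s, x) of (s, x) \<Rightarrow> ?E s x) \<partial>lborel) =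
        (\<lambda>s. sqrt pi * (indicator {r<..} s * s powr (- (\<alpha> / 2) - 1)))"
    proof
      fix s
      have "(\<integral>x. norm (?E s x) \<partial>lborel) = (\<integral>x. ?E s x \<partial>lborel)"
        by (rule Bochner_Integration.integral_cong) (auto simp: indicator_def)
      then show "(\<integral>x. norm (case (s, x) of (s, x) \<Rightarrow> ?E s x) \<partial>lborel) =
        sqrt pi * (indicator {r<..} s * s powr (- (\<alpha> / 2) - 1))"
        by (simp only: prod.case has_bochner_integral_integral_eq[OF gc0])
    qed
    then show "integrable lborel (\<lambda>s. \<integral>x. norm (case (s, x) of (s, x) \<Rightarrow> ?E s x) \<partial>lborel)"
      using Kcut_0_integrable[OF r] by simp
    have "integrable lborel (\<lambda>x. ?E s x)" for s
      using gc0[of s] unfolding has_bochner_integral_iff by (rule conjunct1)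
    then show "AE s in lborel. integrable lborel (\<lambda>x. case (s, x) of (s, x) \<Rightarrow> ?E s x)"
      by (simp only: prod.case AE_I2)
  qed measurable
  have int: "integrable (lborel \<Otimes>\<^sub>M lborel) (\<lambda>(s, x). ?F s x)"
  proof (rule Bochner_Integration.integrable_bound[OF int0])
    have "\<bar>?F s x\<bar> \<le> \<bar>?E s x\<bar>" for s x
      unfolding abs_mult[of _ "cos (u * x)"] by (rule mult_left_le) auto
    then show "AE p in lborel \<Otimes>\<^sub>M lborel. norm (case p of (s, x) \<Rightarrow> ?F s x) \<le> norm (case p of (s, x) \<Rightarrow> ?E s x)"
      by (intro AE_I2) (simp only: split_beta real_norm_def)
  qed measurable
  let ?G = "Gamma ((1 - \<alpha>) / 2)"
  have w: "wcut \<alpha> r x * cos (u * x) = (\<integral>s. ?F s x \<partial>lborel) / ?G" for x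
    by (simp add: wcut_def)
  have 1: "integrable lborel (\<lambda>x. (\<integral>s. ?F s x \<partial>lborel) / ?G)"
    by (rule integrable_divide) (rule lborel_pair.integrable_snd[OF int])
  have "(\<integral>x. (\<integral>s. ?F s x \<partial>lborel) \<partial>lborel) = (\<integral>s. (\<integral>x. ?F s x \<partial>lborel) \<partial>lborel)"
    by (rule lborel_pair.Fubini_integral[OF int])
  also have "\<dots> = Kcut \<alpha> r u * ?G"
    unfolding has_bochner_integral_integral_eq[OF gc] Kcut_def using Gamma_half_pos by simp
  finally have "(\<integral>x. (\<integral>s. ?F s x \<partial>lborel) / ?G \<partial>lborel) = Kcut \<alpha> r u"
    using Gamma_half_pos by simp
  with 1 show ?thesis
    unfolding w by (simp only: has_bochner_integral_iff)
qed

lemma wcut_integrable: "r > 0 \<Longrightarrow> integrable lborel (wcut \<alpha> r)"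
  using wcut_cos[of r 0] unfolding has_bochner_integral_iff mult_zero_left cos_zero mult_1_right by blast

end

section \<open>Domination of rank-one kernels\<close>

lemma Cauchy_Schwarz_integral:
  fixes f g :: "'a \<Rightarrow> real"
  assumes [measurable]: "f \<in> borel_measurable M" "g \<in> borel_measurable M"
    and f2: "integrable M (\<lambda>x. (f x)\<^sup>2)" and g2: "integrable M (\<lambda>x. (g x)\<^sup>2)"
  shows integrable_mult_L2: "integrable M (\<lambda>x. f x * g x)"
    and Cauchy_Schwarz_integral_le: "(\<integral>x. f x * g x \<partial>M)\<^sup>2 \<le> (\<integral>x. (f x)\<^sup>2 \<partial>M) * (\<integral>x. (g x)\<^sup>2 \<partial>M)"
proof -
  have "integrable M (\<lambda>x. (f x)\<^sup>2 + (g x)\<^sup>2)" using f2 g2 by simp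
  then show fg: "integrable M (\<lambda>x. f x * g x)"
  proof (rule Bochner_Integration.integrable_bound)
    have "\<bar>a * b\<bar> \<le> a\<^sup>2 + b\<^sup>2" for a b :: real
    proof -
      have "2 * \<bar>a * b\<bar> \<le> a\<^sup>2 + b\<^sup>2"
        using sum_squares_bound[of "\<bar>a\<bar>" "\<bar>b\<bar>"] by (simp add: abs_mult)
      then show ?thesis using abs_ge_zero[of "a * b"] by linarith
    qed
    then show "AE x in M. norm (f x * g x) \<le> norm ((f x)\<^sup>2 + (g x)\<^sup>2)" by simp
  qed measurable
  define F where "F = (\<integral>x. (f x)\<^sup>2 \<partial>M)"
  define G where "G = (\<integral>x. (g x)\<^sup>2 \<partial>M)"
  define P where "P = (\<integral>x. f x * g x \<partial>M)"
  have quad: "0 \<le> F - 2 * t * P + t\<^sup>2 * G" for t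
  proof -
    have "0 \<le> (\<integral>x. (f x - t * g x)\<^sup>2 \<partial>M)" by simp
    also have "(\<lambda>x. (f x - t * g x)\<^sup>2) = (\<lambda>x. (f x)\<^sup>2 - 2 * t * (f x * g x) + t\<^sup>2 * (g x)\<^sup>2)"
      by (auto simp: power2_eq_square algebra_simps)
    also have "(\<integral>x. (f x)\<^sup>2 - 2 * t * (f x * g x) + t\<^sup>2 * (g x)\<^sup>2 \<partial>M) = F - 2 * t * P + t\<^sup>2 * G"
      using f2 g2 fg by (simp add: F_def G_def P_def)
    finally show ?thesis .
  qed
  have "G \<ge> 0" by (simp add: G_def)
  have "P\<^sup>2 \<le> F * G"
  proof (cases "G = 0")
    case True
    have "P = 0"
    proof (rule ccontr)
      assume "P \<noteq> 0"
      \<comment> \<open>With G = 0 the quadratic is affine in t, and this t makes it equal to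
        -1.\<close>
      with quad[of "(F + 1) / (2 * P)"] True show False by simp
    qed
    with True show ?thesis by simp
  next
    case False
    with \<open>G \<ge> 0\<close> have "G > 0" by simp
    with quad[of "P / G"] show ?thesis
      by (simp add: power2_eq_square field_simps)
  qed
  then show "(\<integral>x. f x * g x \<partial>M)\<^sup>2 \<le> (\<integral>x. (f x)\<^sup>2 \<partial>M) * (\<integral>x. (g x)\<^sup>2 \<partial>M)"
    by (simp add: F_def G_def P_def)
qed

definition bounded_fun :: "('a \<Rightarrow> real) \<Rightarrow> bool" where
  "bounded_fun f \<longleftrightarrow> (\<exists>B. \<forall>x. \<bar>f x\<bar> \<le> B)"

lemma bounded_fun_const [simp, intro]: "bounded_fun (\<lambda>_. c)"
  by (auto simp: bounded_fun_def)

lemma bounded_fun_mult: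
  assumes "bounded_fun f" "bounded_fun g"
  shows "bounded_fun (\<lambda>x. f x * g x)"
proof -
  obtain A B where "\<And>x. \<bar>f x\<bar> \<le> A" "\<And>x. \<bar>g x\<bar> \<le> B"
    using assms unfolding bounded_fun_def by blast
  then have "\<bar>f x * g x\<bar> \<le> A * B" for x
    unfolding abs_mult by (intro mult_mono) (auto intro: order_trans[OF abs_ge_zero])
  then show ?thesis unfolding bounded_fun_def by blast
qed

lemma bounded_fun_compose: "bounded_fun f \<Longrightarrow> bounded_fun (\<lambda>x. f (g x))"
  by (auto simp: bounded_fun_def)

lemma (in finite_measure) integrable_bounded_fun:
  "f \<in> borel_measurable M \<Longrightarrow> bounded_fun f \<Longrightarrow> integrable M f"
  unfolding bounded_fun_def by (metis AE_I2 integrable_const_bound real_norm_def)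

text \<open>
  The kernel \<open>K - f \<otimes> f\<close> is positive semidefinite on bounded functions.
\<close>

definition kernel_dom :: "'a measure \<Rightarrow> ('a \<Rightarrow> real) \<Rightarrow> ('a \<times> 'a \<Rightarrow> real) \<Rightarrow> bool" where
  "kernel_dom M f K \<longleftrightarrow>
     f \<in> borel_measurable M \<and> bounded_fun f \<and> K \<in> borel_measurable (M \<Otimes>\<^sub>M M) \<and> bounded_fun K \<and>
     (\<forall>h. h \<in> borel_measurable M \<longrightarrow> bounded_fun h \<longrightarrow>
        (\<integral>y. h y * f y \<partial>M)\<^sup>2 \<le> (\<integral>p. h (fst p) * h (snd p) * K p \<partial>(M \<Otimes>\<^sub>M M)))"

lemma kernel_dom_one:
  assumes "finite_measure M"
  shows "kernel_dom M (\<lambda>_. 1) (\<lambda>_. 1)"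
  unfolding kernel_dom_def
proof (intro conjI allI impI)
  fix h :: "'a \<Rightarrow> real"
  assume h[measurable]: "h \<in> borel_measurable M" and hb: "bounded_fun h"
  interpret M: finite_measure M by fact
  interpret MM: pair_sigma_finite M M ..
  interpret P: finite_measure "M \<Otimes>\<^sub>M M" by (rule finite_measure_pair_measure) fact+
  have "integrable (M \<Otimes>\<^sub>M M) (\<lambda>p. h (fst p) * h (snd p))"
    by (intro P.integrable_bounded_fun bounded_fun_mult bounded_fun_compose[OF hb]) measurable
  from MM.integral_fst'[OF this] M.integrable_bounded_fun[OF h hb]
  show "(\<integral>y. h y * 1 \<partial>M)\<^sup>2 \<le> (\<integral>p. h (fst p) * h (snd p) * 1 \<partial>(M \<Otimes>\<^sub>M M))"
    by (simp add: power2_eq_square)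
qed auto

text \<open>The Schur product theorem in the form needed here. For fixed x, the assumed domination
  is applied to the test function \<open>h y * \<phi> y x\<close>; integrating over x multiplies the
  kernel by the Gram kernel of \<phi>. Cauchy-Schwarz in x then pairs the result with \<xi>, at the
  price of its squared norm.\<close>

lemma kernel_dom_feature_mult:
  fixes \<phi> :: "'a \<Rightarrow> 'b \<Rightarrow> real" and \<xi> W :: "'b \<Rightarrow> real"
  assumes fin: "finite_measure M" and sf: "sigma_finite_measure X"
    and dom: "kernel_dom M f K"
    and \<phi>[measurable]: "(\<lambda>p. \<phi> (fst p) (snd p)) \<in> borel_measurable (M \<Otimes>\<^sub>M X)"
    and W[measurable]: "W \<in> borel_measurable X" and le: "\<And>y x. \<bar>\<phi> y x\<bar> \<le> W x"
    and W2: "integrable X (\<lambda>x. (W x)\<^sup>2)"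
    and \<xi>[measurable]: "\<xi> \<in> borel_measurable X" and \<xi>2: "integrable X (\<lambda>x. (\<xi> x)\<^sup>2)"
  shows "kernel_dom M (\<lambda>y. (\<integral>x. \<phi> y x * \<xi> x \<partial>X) * f y)
    (\<lambda>p. (\<integral>x. (\<xi> x)\<^sup>2 \<partial>X) * (\<integral>x. \<phi> (fst p) x * \<phi> (snd p) x \<partial>X) * K p)"
proof -
  interpret M: finite_measure M by fact
  interpret X: sigma_finite_measure X by fact
  interpret MM: pair_sigma_finite M M ..
  interpret MX: pair_sigma_finite M X ..
  interpret P: finite_measure "M \<Otimes>\<^sub>M M" by (rule finite_measure_pair_measure) fact+
  interpret PX: pair_sigma_finite "M \<Otimes>\<^sub>M M" X ..
  have f[measurable]: "f \<in> borel_measurable M" and K[measurable]: "K \<in> borel_measurable (M \<Otimes>\<^sub>M M)"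
    and fb: "bounded_fun f" and Kb: "bounded_fun K"
    and *: "\<And>h. h \<in> borel_measurable M \<Longrightarrow> bounded_fun h \<Longrightarrow>
        (\<integral>y. h y * f y \<partial>M)\<^sup>2 \<le> (\<integral>p. h (fst p) * h (snd p) * K p \<partial>(M \<Otimes>\<^sub>M M))"
    using dom unfolding kernel_dom_def by auto
  have \<phi>x[measurable]: "(\<lambda>y. \<phi> y x) \<in> borel_measurable M" if "x \<in> space X" for x
    using measurable_compose[OF measurable_Pair2'[OF that] \<phi>] by simp
  have \<phi>'[measurable]: "case_prod \<phi> \<in> borel_measurable (M \<Otimes>\<^sub>M X)"
    using \<phi> by (simp add: split_beta')
  have \<phi>1[measurable]: "(\<lambda>q. \<phi> (fst (fst q)) (snd q)) \<in> borel_measurable ((M \<Otimes>\<^sub>M M) \<Otimes>\<^sub>M X)"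
    using measurable_compose[of "\<lambda>q. (fst (fst q), snd q)" "(M \<Otimes>\<^sub>M M) \<Otimes>\<^sub>M X" "M \<Otimes>\<^sub>M X", OF _ \<phi>] by simp
  have \<phi>2[measurable]: "(\<lambda>q. \<phi> (snd (fst q)) (snd q)) \<in> borel_measurable ((M \<Otimes>\<^sub>M M) \<Otimes>\<^sub>M X)"
    using measurable_compose[of "\<lambda>q. (snd (fst q), snd q)" "(M \<Otimes>\<^sub>M M) \<Otimes>\<^sub>M X" "M \<Otimes>\<^sub>M X", OF _ \<phi>] by simp
  have W0: "0 \<le> W x" for x using le[of undefined x] by linarith
  have W\<xi>: "integrable X (\<lambda>x. W x * \<bar>\<xi> x\<bar>)"
    by (rule integrable_mult_L2) (use W2 \<xi>2 in auto)
  define a where "a = (\<lambda>y. \<integral>x. \<phi> y x * \<xi> x \<partial>X)"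
  define L where "L = (\<lambda>p. \<integral>x. \<phi> (fst p) x * \<phi> (snd p) x \<partial>X)"
  define A where "A = (\<integral>x. (\<xi> x)\<^sup>2 \<partial>X)"
  have a_meas[measurable]: "a \<in> borel_measurable M"
    unfolding a_def by measurable
  have L_meas[measurable]: "L \<in> borel_measurable (M \<Otimes>\<^sub>M M)"
    unfolding L_def by measurable
  have ab: "bounded_fun a"
    unfolding bounded_fun_def
  proof (intro exI allI)
    fix y show "\<bar>a y\<bar> \<le> (\<integral>x. W x * \<bar>\<xi> x\<bar> \<partial>X)"
      unfolding a_def
      by (rule order_trans[OF integral_abs_bound integral_mono'[OF W\<xi>]])
         (auto simp: abs_mult W0 intro!: mult_right_mono le mult_nonneg_nonneg)
  qed
  have phi_le: "\<bar>\<phi> y x * \<phi> z x\<bar> \<le> (W x)\<^sup>2" for y z x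
    unfolding abs_mult power2_eq_square by (intro mult_mono le) (auto simp: W0)
  have Lb: "bounded_fun L"
    unfolding bounded_fun_def
  proof (intro exI allI)
    fix p show "\<bar>L p\<bar> \<le> (\<integral>x. (W x)\<^sup>2 \<partial>X)"
      unfolding L_def
      by (rule order_trans[OF integral_abs_bound integral_mono'[OF W2]]) (auto intro: phi_le)
  qed
  have "(\<integral>y. h y * (a y * f y) \<partial>M)\<^sup>2 \<le> (\<integral>p. h (fst p) * h (snd p) * (A * L p * K p) \<partial>(M \<Otimes>\<^sub>M M))"
    if h[measurable]: "h \<in> borel_measurable M" and hb: "bounded_fun h" for h
  proof -
    define g where "g = (\<lambda>y. h y * f y)"
    have [measurable]: "g \<in> borel_measurable M" unfolding g_def by measurable
    obtain B where B: "\<And>y. \<bar>g y\<bar> \<le> B"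
      using bounded_fun_mult[OF hb fb] unfolding bounded_fun_def g_def by blast
    have B0: "B \<ge> 0" using B[of undefined] by linarith
    define \<psi> where "\<psi> = (\<lambda>x. \<integral>y. g y * \<phi> y x \<partial>M)"
    have int1: "integrable (M \<Otimes>\<^sub>M X) (\<lambda>(y, x). g y * \<phi> y x * \<xi> x)"
    proof (rule Bochner_Integration.integrable_bound)
      show "integrable (M \<Otimes>\<^sub>M X) (\<lambda>(y, x). B * (W x * \<bar>\<xi> x\<bar>))"
        by (rule MX.Fubini_integrable) (use W\<xi> in auto)
      show "AE p in M \<Otimes>\<^sub>M X. norm (case p of (y, x) \<Rightarrow> g y * \<phi> y x * \<xi> x)
         \<le> norm (case p of (y, x) \<Rightarrow> B * (W x * \<bar>\<xi> x\<bar>))"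
      proof (intro AE_I2, clarify)
        fix y x
        have "\<bar>g y\<bar> * \<bar>\<phi> y x\<bar> * \<bar>\<xi> x\<bar> \<le> B * W x * \<bar>\<xi> x\<bar>"
          by (intro mult_mono B le) (auto simp: W0 B0)
        then show "norm (g y * \<phi> y x * \<xi> x) \<le> norm (B * (W x * \<bar>\<xi> x\<bar>))"
          using B0 W0[of x] by (simp add: abs_mult mult_ac)
      qed
    qed measurable
    have "h y * (a y * f y) = (\<integral>x. g y * \<phi> y x * \<xi> x \<partial>X)" for y
    proof -
      have "h y * (a y * f y) = g y * a y" by (simp add: g_def)
      then show ?thesis by (simp add: a_def mult.assoc)
    qed
    then have "(\<integral>y. h y * (a y * f y) \<partial>M) = (\<integral>y. (\<integral>x. g y * \<phi> y x * \<xi> x \<partial>X) \<partial>M)"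
      by simp
    also have "\<dots> = (\<integral>x. (\<integral>y. g y * \<phi> y x * \<xi> x \<partial>M) \<partial>X)"
      by (rule MX.Fubini_integral[OF int1, symmetric])
    also have "\<dots> = (\<integral>x. \<psi> x * \<xi> x \<partial>X)"
      by (simp add: \<psi>_def)
    finally have eq: "(\<integral>y. h y * (a y * f y) \<partial>M) = (\<integral>x. \<psi> x * \<xi> x \<partial>X)" .
    have \<psi>_meas[measurable]: "\<psi> \<in> borel_measurable X"
      unfolding \<psi>_def by measurable
    define C where "C = B * measure M (space M)"
    have \<psi>_le: "\<bar>\<psi> x\<bar> \<le> C * W x" for x
    proof -
      have "\<bar>\<psi> x\<bar> \<le> (\<integral>y. B * W x \<partial>M)"
        unfolding \<psi>_def
        by (rule order_trans[OF integral_abs_bound integral_mono'])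
           \<comment> \<open>The bound is uniform in y, so the finite mass of M turns it into a
             multiple of W x; this makes \<psi> square-integrable.\<close>
           (auto simp: abs_mult intro!: mult_mono B le W0 B0 mult_nonneg_nonneg)
      then show ?thesis by (simp add: C_def mult_ac)
    qed
    have \<psi>2: "integrable X (\<lambda>x. (\<psi> x)\<^sup>2)"
    proof (rule Bochner_Integration.integrable_bound)
      show "integrable X (\<lambda>x. C\<^sup>2 * (W x)\<^sup>2)" using W2 by simp
      show "AE x in X. norm ((\<psi> x)\<^sup>2) \<le> norm (C\<^sup>2 * (W x)\<^sup>2)"
        using power_mono[OF \<psi>_le abs_ge_zero, of _ 2] by (simp add: power_mult_distrib)
    qed measurable
    have int2: "integrable ((M \<Otimes>\<^sub>M M) \<Otimes>\<^sub>M X)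
       (\<lambda>(p, x). h (fst p) * h (snd p) * K p * (\<phi> (fst p) x * \<phi> (snd p) x))"
    proof -
      obtain D where D: "\<And>p. \<bar>h (fst p) * h (snd p) * K p\<bar> \<le> D"
        using bounded_fun_mult[OF bounded_fun_mult[OF bounded_fun_compose[OF hb] bounded_fun_compose[OF hb]] Kb]
        unfolding bounded_fun_def by blast
      show ?thesis
      proof (rule Bochner_Integration.integrable_bound)
        show "integrable ((M \<Otimes>\<^sub>M M) \<Otimes>\<^sub>M X) (\<lambda>(p, x). D * (W x)\<^sup>2)"
          by (rule PX.Fubini_integrable) (use W2 in auto)
        show "AE q in (M \<Otimes>\<^sub>M M) \<Otimes>\<^sub>M X.
            norm (case q of (p, x) \<Rightarrow> h (fst p) * h (snd p) * K p * (\<phi> (fst p) x * \<phi> (snd p) x))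
            \<le> norm (case q of (p, x) \<Rightarrow> D * (W x)\<^sup>2)"
        proof (intro AE_I2, clarify)
          fix y z x
          have "\<bar>h (fst (y, z)) * h (snd (y, z)) * K (y, z)\<bar> * \<bar>\<phi> y x * \<phi> z x\<bar> \<le> D * (W x)\<^sup>2"
            by (intro mult_mono D phi_le order_trans[OF abs_ge_zero D]) auto
          also have "\<dots> \<le> \<bar>D * (W x)\<^sup>2\<bar>" by simp
          finally show "norm (h (fst (y, z)) * h (snd (y, z)) * K (y, z) * (\<phi> (fst (y, z)) x * \<phi> (snd (y, z)) x))
              \<le> norm (D * (W x)\<^sup>2)"
            by (simp only: real_norm_def abs_mult fst_conv snd_conv)
        qed
      qed measurable
    qed
    have "(\<integral>x. (\<psi> x)\<^sup>2 \<partial>X) \<le>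
       (\<integral>x. (\<integral>p. h (fst p) * h (snd p) * K p * (\<phi> (fst p) x * \<phi> (snd p) x) \<partial>(M \<Otimes>\<^sub>M M)) \<partial>X)"
    proof (rule integral_mono[OF \<psi>2 PX.integrable_snd[OF int2]])
      fix x assume x: "x \<in> space X"
      \<comment> \<open>Domination at a frozen x; the test function is bounded because
        \<open>\<phi> y x\<close> is at most \<open>W x\<close> in modulus for every y.\<close>
      have "(\<integral>y. (h y * \<phi> y x) * f y \<partial>M)\<^sup>2 \<le>
         (\<integral>p. (h (fst p) * \<phi> (fst p) x) * (h (snd p) * \<phi> (snd p) x) * K p \<partial>(M \<Otimes>\<^sub>M M))"
      proof (rule *)
        have "bounded_fun (\<lambda>y. \<phi> y x)" using le unfolding bounded_fun_def by blast
        then show "bounded_fun (\<lambda>y. h y * \<phi> y x)" by (rule bounded_fun_mult[OF hb])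
      qed (use x in measurable)
      then show "(\<psi> x)\<^sup>2 \<le> (\<integral>p. h (fst p) * h (snd p) * K p * (\<phi> (fst p) x * \<phi> (snd p) x) \<partial>(M \<Otimes>\<^sub>M M))"
        by (simp add: \<psi>_def g_def mult_ac)
    qed
    also have "\<dots> = (\<integral>p. (\<integral>x. h (fst p) * h (snd p) * K p * (\<phi> (fst p) x * \<phi> (snd p) x) \<partial>X) \<partial>(M \<Otimes>\<^sub>M M))"
      by (rule PX.Fubini_integral[OF int2])
    also have "\<dots> = (\<integral>p. h (fst p) * h (snd p) * (L p * K p) \<partial>(M \<Otimes>\<^sub>M M))"
      by (simp add: L_def mult_ac)
    finally have "A * (\<integral>x. (\<psi> x)\<^sup>2 \<partial>X) \<le> A * (\<integral>p. h (fst p) * h (snd p) * (L p * K p) \<partial>(M \<Otimes>\<^sub>M M))"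
      by (rule mult_left_mono) (simp add: A_def)
    moreover have "(\<integral>x. \<psi> x * \<xi> x \<partial>X)\<^sup>2 \<le> (\<integral>x. (\<psi> x)\<^sup>2 \<partial>X) * A"
      unfolding A_def by (rule Cauchy_Schwarz_integral_le) (use \<psi>2 \<xi>2 in auto)
    ultimately have "(\<integral>x. \<psi> x * \<xi> x \<partial>X)\<^sup>2 \<le> A * (\<integral>p. h (fst p) * h (snd p) * (L p * K p) \<partial>(M \<Otimes>\<^sub>M M))"
      by (simp add: mult.commute)
    also have "\<dots> = (\<integral>p. h (fst p) * h (snd p) * (A * L p * K p) \<partial>(M \<Otimes>\<^sub>M M))"
      by (subst Bochner_Integration.integral_mult_right_zero[symmetric]) (simp add: mult_ac)
    finally show ?thesis unfolding eq .
  qed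
  then have "kernel_dom M (\<lambda>y. a y * f y) (\<lambda>p. A * L p * K p)"
    unfolding kernel_dom_def using fb Kb ab Lb by (auto intro!: bounded_fun_mult)
  then show ?thesis by (simp only: a_def L_def A_def)
qed

section \<open>A strict Cauchy-Schwarz inequality, uniform on the quarter disc\<close>

text \<open>With binomial weights, Cauchy-Schwarz bounds the sum by the root of B times a power of
  the sum of squares of p and q. Equality would force the excluded geometric form of N. Compactness
  supplies a maximiser, so that strictness at this one point is a gap for all p and q at
  once.\<close>

lemma binomial_sqrt_sum_less:
  fixes N :: "nat \<Rightarrow> real"
  assumes N: "\<And>k. k \<le> m \<Longrightarrow> N k \<ge> 0"
    and B: "B = (\<Sum>k\<le>m. real (m choose k) * N k)" "B > 0"
    and not_geometric: "\<And>p q. \<not> (\<forall>k\<le>m. N k = B * (p ^ k * q ^ (m - k))\<^sup>2)"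
  shows "\<exists>S < sqrt B. \<forall>p q. 0 \<le> p \<longrightarrow> 0 \<le> q \<longrightarrow> p\<^sup>2 + q\<^sup>2 \<le> 1 \<longrightarrow>
    (\<Sum>k\<le>m. real (m choose k) * (p ^ k * q ^ (m - k) * sqrt (N k))) \<le> S"
proof -
  define F where "F = (\<lambda>(p, q). \<Sum>k\<le>m. real (m choose k) * (p ^ k * q ^ (m - k) * sqrt (N k)))"
  define D where "D = {(p::real, q::real). 0 \<le> p \<and> 0 \<le> q \<and> p\<^sup>2 + q\<^sup>2 \<le> 1}"
  have D_alt: "D = {x. 0 \<le> fst x} \<inter> {x. 0 \<le> snd x} \<inter> {x. (fst x)\<^sup>2 + (snd x)\<^sup>2 \<le> 1}"
    by (auto simp: D_def)
  have "closed D"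
    unfolding D_alt by (intro closed_Int closed_Collect_le continuous_intros)
  moreover have "bounded D"
    unfolding bounded_iff by (rule exI[of _ 1]) (auto simp: D_def norm_Pair)
  ultimately have comp: "compact D" by (simp add: compact_eq_bounded_closed)
  have ne: "D \<noteq> {}" by (auto simp: D_def intro!: exI[of _ 0])
  have cont: "continuous_on D F"
    unfolding F_def split_beta by (intro continuous_intros)
  obtain z where "z \<in> D" and z_max: "\<And>x. x \<in> D \<Longrightarrow> F x \<le> F z"
    using continuous_attains_sup[OF comp ne cont] by blast
  obtain p q where z: "z = (p, q)" by (cases z)
  have pq: "p\<^sup>2 + q\<^sup>2 \<le> 1" using \<open>z \<in> D\<close> by (simp add: z D_def)
  \<comment> \<open>The defect in Cauchy-Schwarz, as a weighted squared distance. Expanding it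
    bounds it by twice \<open>B - sqrt B * F z\<close>, so a maximum of at least
    \<open>sqrt B\<close> would make every term vanish.\<close>
  define s where "s = (\<Sum>k\<le>m. real (m choose k) * (sqrt (N k) - sqrt B * (p ^ k * q ^ (m - k)))\<^sup>2)"
  have "(p\<^sup>2 + q\<^sup>2) ^ m = (\<Sum>k\<le>m. real (m choose k) * (p ^ k * q ^ (m - k))\<^sup>2)"
    unfolding binomial_ring by (intro sum.cong) (simp_all add: power_mult_distrib power_mult[symmetric] mult.commute)
  moreover have "(p\<^sup>2 + q\<^sup>2) ^ m \<le> 1" using pq by (intro power_le_one) auto
  ultimately have sum_le: "(\<Sum>k\<le>m. real (m choose k) * (p ^ k * q ^ (m - k))\<^sup>2) \<le> 1" by simp
  have "s = (\<Sum>k\<le>m. real (m choose k) * N k - 2 * sqrt B * (real (m choose k) * (p ^ k * q ^ (m - k) * sqrt (N k)))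
      + B * (real (m choose k) * (p ^ k * q ^ (m - k))\<^sup>2))"
    unfolding s_def
  proof (intro sum.cong refl)
    fix k assume "k \<in> {..m}"
    then have "(sqrt (N k))\<^sup>2 = N k" "(sqrt B)\<^sup>2 = B" using N \<open>B > 0\<close> by auto
    then show "real (m choose k) * (sqrt (N k) - sqrt B * (p ^ k * q ^ (m - k)))\<^sup>2 =
      real (m choose k) * N k - 2 * sqrt B * (real (m choose k) * (p ^ k * q ^ (m - k) * sqrt (N k)))
      + B * (real (m choose k) * (p ^ k * q ^ (m - k))\<^sup>2)"
      unfolding power2_diff power_mult_distrib[of "sqrt B"] by (simp add: algebra_simps)
  qed
  also have "\<dots> = B - 2 * sqrt B * F z + B * (\<Sum>k\<le>m. real (m choose k) * (p ^ k * q ^ (m - k))\<^sup>2)"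
    by (simp add: sum.distrib sum_subtractf B(1) F_def z sum_distrib_left)
  also have "\<dots> \<le> B - 2 * sqrt B * F z + B * 1"
    using sum_le \<open>B > 0\<close> by (intro add_left_mono mult_left_mono) auto
  finally have s_le: "s \<le> 2 * (B - sqrt B * F z)" by simp
  have "F z < sqrt B"
  proof (rule ccontr)
    assume "\<not> F z < sqrt B"
    then have "sqrt B * sqrt B \<le> sqrt B * F z" using \<open>B > 0\<close> by (intro mult_left_mono) auto
    with s_le \<open>B > 0\<close> have "s \<le> 0" by simp
    have "N k = B * (p ^ k * q ^ (m - k))\<^sup>2" if "k \<le> m" for k
    proof -
      have "real (m choose k) * (sqrt (N k) - sqrt B * (p ^ k * q ^ (m - k)))\<^sup>2 \<le> s"
        unfolding s_def by (rule member_le_sum) (use that in auto)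
      with \<open>s \<le> 0\<close> have "real (m choose k) * (sqrt (N k) - sqrt B * (p ^ k * q ^ (m - k)))\<^sup>2 \<le> 0" by simp
      moreover have "real (m choose k) > 0" using that by (simp add: zero_less_binomial)
      ultimately have "sqrt (N k) = sqrt B * (p ^ k * q ^ (m - k))"
        by (simp add: mult_le_0_iff)
      then have "(sqrt (N k))\<^sup>2 = (sqrt B)\<^sup>2 * (p ^ k * q ^ (m - k))\<^sup>2" by (simp add: power_mult_distrib)
      then show ?thesis using N[OF that] \<open>B > 0\<close> by simp
    qed
    with not_geometric show False by blast
  qed
  moreover have "\<forall>p q. 0 \<le> p \<longrightarrow> 0 \<le> q \<longrightarrow> p\<^sup>2 + q\<^sup>2 \<le> 1 \<longrightarrow>
    (\<Sum>k\<le>m. real (m choose k) * (p ^ k * q ^ (m - k) * sqrt (N k))) \<le> F z"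
  proof (intro allI impI)
    fix p q :: real assume "0 \<le> p" "0 \<le> q" "p\<^sup>2 + q\<^sup>2 \<le> 1"
    then show "(\<Sum>k\<le>m. real (m choose k) * (p ^ k * q ^ (m - k) * sqrt (N k))) \<le> F z"
      using z_max[of "(p, q)"] by (simp add: D_def F_def)
  qed
  ultimately show ?thesis by blast
qed

section \<open>The measure with density \<open>y powr (- d)\<close> on the unit interval\<close>

text \<open>Absorbs the factor \<open>y powr (- d)\<close> of \<open>Q1\<close>, so that the pairing
  becomes an m-th moment. The case d = 0 is Lebesgue measure on the interval up to a null set; it
  carries the test function of the lower bound.\<close>

definition mu :: "real \<Rightarrow> real measure" where
  "mu d = density lborel (\<lambda>y. ennreal (indicator {0..1} y * y powr (- d)))"

lemma sets_mu [measurable_cong, simp]: "sets (mu d) = sets borel"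
  by (simp add: mu_def)

lemma space_mu [simp]: "space (mu d) = UNIV"
  by (simp add: mu_def)

lemma nn_integral_mu:
  "f \<in> borel_measurable borel \<Longrightarrow>
     (\<integral>\<^sup>+y. f y \<partial>mu d) = (\<integral>\<^sup>+y. ennreal (indicator {0..1} y * y powr (- d)) * f y \<partial>lborel)"
  unfolding mu_def by (subst nn_integral_density) auto

lemma integral_mu:
  fixes f :: "real \<Rightarrow> 'a::{banach, second_countable_topology}"
  assumes "f \<in> borel_measurable borel"
  shows "(\<integral>y. f y \<partial>mu d) = (LINT y:{0..1}|lborel. y powr (- d) *\<^sub>R f y)"
  unfolding mu_def set_lebesgue_integral_def using assms
  by (subst integral_density) auto

lemma has_bochner_integral_powr_unit:
  assumes "a > (-1::real)"
  shows "has_bochner_integral lborel (\<lambda>y. indicator {0..1} y * y powr a) (1 / (a + 1))"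
  using has_bochner_integral_nonneg_has_integral[OF _ _ _ has_integral_powr_from_0[OF assms, of 1]] by simp

lemma nn_integral_powr_unit:
  assumes "a > (-1::real)"
  shows "(\<integral>\<^sup>+y. ennreal (indicator {0..1} y * y powr a) \<partial>lborel) = ennreal (1 / (a + 1))"
  using has_bochner_integral_powr_unit[OF assms]
  by (subst nn_integral_eq_integral) (auto simp: has_bochner_integral_iff)

lemma finite_measure_mu:
  assumes "d < 1"
  shows "finite_measure (mu d)"
proof (rule finite_measureI)
  have "emeasure (mu d) (space (mu d)) = (\<integral>\<^sup>+y. 1 \<partial>mu d)" by simp
  also have "\<dots> = ennreal (1 / (- d + 1))"
    using nn_integral_powr_unit[of "- d"] assms by (subst nn_integral_mu) auto
  finally show "emeasure (mu d) (space (mu d)) \<noteq> \<infinity>" by simp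
qed

lemma AE_mu_iff: "(AE y in mu d. P y) \<longleftrightarrow> (AE y in lborel. 0 < y \<and> y \<le> 1 \<longrightarrow> P y)"
proof -
  have "(AE y in mu d. P y) \<longleftrightarrow> (AE y in lborel. 0 < indicator {0..1} y * y powr (- d) \<longrightarrow> P y)"
    unfolding mu_def by (subst AE_density) auto
  also have "\<dots> \<longleftrightarrow> (AE y in lborel. 0 < y \<and> y \<le> 1 \<longrightarrow> P y)"
    by (intro AE_cong) (auto simp: indicator_def)
  finally show ?thesis .
qed

lemma AE_mu_unit: "AE y in mu d. 0 < y \<and> y < 1"
  unfolding AE_mu_iff using AE_lborel_singleton[of 1] by eventually_elim auto

lemma AE_mu_neq: "AE y in mu d. y \<noteq> a"
  unfolding AE_mu_iff using AE_lborel_singleton[of a] by eventually_elim auto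

lemma emeasure_mu_pos:
  assumes "0 < a" "a < b" "b \<le> 1"
  shows "emeasure (mu d) {a<..<b} \<noteq> 0"
proof
  assume "emeasure (mu d) {a<..<b} = 0"
  then have "AE y in mu d. y \<notin> {a<..<b}"
    by (intro AE_not_in) (auto simp: null_sets_def)
  then have "AE y in lborel. y \<notin> {a<..<b}"
    unfolding AE_mu_iff by eventually_elim (use assms in auto)
  then have "{a<..<b} \<in> null_sets lborel"
    by (subst (asm) AE_iff_null_sets[symmetric]) auto
  with assms show False by (simp add: null_sets_def)
qed

text \<open>Removes the diagonal, where the Riesz kernel is singular, and the axes, where its odd
  part vanishes.\<close>

lemma AE_mu_pair:
  assumes "d < 1"
  shows "AE p in mu d \<Otimes>\<^sub>M mu d. 0 < fst p \<and> fst p < 1 \<and> 0 < snd p \<and> snd p < 1 \<and> fst p \<noteq> snd p"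
proof -
  interpret M: finite_measure "mu d" by (rule finite_measure_mu[OF assms])
  interpret MM: pair_sigma_finite "mu d" "mu d" ..
  have "{p \<in> space (mu d \<Otimes>\<^sub>M mu d). 0 < fst p \<and> fst p < 1 \<and> 0 < snd p \<and> snd p < 1 \<and> fst p \<noteq> snd p}
      \<in> sets (mu d \<Otimes>\<^sub>M mu d)"
    by measurable
  moreover have "AE y in mu d. AE z in mu d. 0 < y \<and> y < 1 \<and> 0 < z \<and> z < 1 \<and> y \<noteq> z"
    using AE_mu_unit
  proof eventually_elim
    case (elim y)
    show ?case using AE_mu_unit[of d] AE_mu_neq[of y d] by eventually_elim (use elim in auto)
  qed
  then have "AE y in mu d. AE z in mu d. 0 < fst (y, z) \<and> fst (y, z) < 1 \<and>
      0 < snd (y, z) \<and> snd (y, z) < 1 \<and> fst (y, z) \<noteq> snd (y, z)"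
    by (simp only: fst_conv snd_conv)
  ultimately show ?thesis
    by (rule MM.AE_pair_measure)
qed

section \<open>Beta integrals and the Riesz energy of the measure\<close>

lemma nn_integral_Beta_scaled:
  fixes a b y :: real
  assumes "a > 0" "b > 0" "y > 0"
  shows "(\<integral>\<^sup>+z. ennreal (indicator {0..y} z * (z powr (a - 1) * (y - z) powr (b - 1))) \<partial>lborel)
     = ennreal (y powr (a + b - 1) * Beta a b)"
proof -
  have hb: "has_bochner_integral lborel (\<lambda>t. indicator {0..1} t * (t powr (a - 1) * (1 - t) powr (b - 1))) (Beta a b)"
    using has_integral_Beta_real[OF assms(1,2)]
    by (intro has_bochner_integral_nonneg_has_integral) auto
  have "(\<integral>\<^sup>+z. ennreal (indicator {0..y} z * (z powr (a - 1) * (y - z) powr (b - 1))) \<partial>lborel)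
      = ennreal y * (\<integral>\<^sup>+t. ennreal (indicator {0..y} (0 + y * t) * ((0 + y * t) powr (a - 1) * (y - (0 + y * t)) powr (b - 1))) \<partial>lborel)"
    using assms(3) by (subst nn_integral_real_affine[where c = y and t = 0]) auto
  also have "(\<lambda>t. ennreal (indicator {0..y} (0 + y * t) * ((0 + y * t) powr (a - 1) * (y - (0 + y * t)) powr (b - 1))))
      = (\<lambda>t. ennreal (y powr (a + b - 2)) * ennreal (indicator {0..1} t * (t powr (a - 1) * (1 - t) powr (b - 1))))"
  proof
    fix t
    have ind: "indicator {0..y} (0 + y * t) = (indicator {0..1} t :: real)"
      using assms(3) by (auto simp: indicator_def zero_le_mult_iff)
    show "ennreal (indicator {0..y} (0 + y * t) * ((0 + y * t) powr (a - 1) * (y - (0 + y * t)) powr (b - 1)))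
      = ennreal (y powr (a + b - 2)) * ennreal (indicator {0..1} t * (t powr (a - 1) * (1 - t) powr (b - 1)))"
    proof (cases "t \<in> {0..1}")
      case True
      have "y - (0 + y * t) = y * (1 - t)" by (simp add: algebra_simps)
      then have "(0 + y * t) powr (a - 1) * (y - (0 + y * t)) powr (b - 1) =
          (y powr (a - 1) * y powr (b - 1)) * (t powr (a - 1) * (1 - t) powr (b - 1))"
        using True assms(3) by (simp add: powr_mult)
      also have "y powr (a - 1) * y powr (b - 1) = y powr (a + b - 2)"
        by (simp add: powr_add[symmetric])
      finally show ?thesis
        using True unfolding ind by (simp add: ennreal_mult[symmetric])
    next
      case False
      then show ?thesis unfolding ind by simp
    qed
  qed
  also have "(\<integral>\<^sup>+t. ennreal (y powr (a + b - 2)) * ennreal (indicator {0..1} t * (t powr (a - 1) * (1 - t) powr (b - 1))) \<partial>lborel)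
      = ennreal (y powr (a + b - 2)) * ennreal (Beta a b)"
    using hb by (subst nn_integral_cmult) (auto simp: has_bochner_integral_iff nn_integral_eq_integral)
  also have "ennreal y * (ennreal (y powr (a + b - 2)) * ennreal (Beta a b)) = ennreal (y powr (a + b - 1) * Beta a b)"
  proof -
    have "y * y powr (a + b - 2) = y powr (a + b - 1)"
      using assms(3) powr_mult_base[of y "a + b - 2"] by simp
    then show ?thesis
      using assms by (simp add: ennreal_mult[symmetric] mult.assoc[symmetric] ennreal_mult')
  qed
  finally show ?thesis .
qed

lemma Beta_real_pos: "a > 0 \<Longrightarrow> b > 0 \<Longrightarrow> Beta a b > (0::real)"
  unfolding Beta_def by (intro divide_pos_pos mult_pos_pos Gamma_real_pos) auto

text \<open>The square is cut along the diagonal. Below it the inner integral is a Beta value times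
  a power of y, and the outer integrand becomes \<open>y powr (1 - 2 * d - b)\<close>, integrable by
  the hypothesis \<open>db\<close>. The other half has the same value by exchanging the
  variables.\<close>

lemma has_bochner_integral_riesz_energy:
  fixes d b :: real
  assumes d: "d < 1" and b: "b < 1" and db: "2 * d + b < 2"
  shows "has_bochner_integral (mu d \<Otimes>\<^sub>M mu d) (\<lambda>p. \<bar>fst p - snd p\<bar> powr (- b))
    (2 * Beta (1 - d) (1 - b) / (2 - 2 * d - b))"
proof -
  interpret M: finite_measure "mu d" by (rule finite_measure_mu[OF d])
  interpret MM: pair_sigma_finite "mu d" "mu d" ..
  let ?G = "\<lambda>p::real \<times> real. ennreal (if snd p < fst p then (fst p - snd p) powr (- b) else 0)"
  let ?G' = "\<lambda>p::real \<times> real. ennreal (if fst p < snd p then (snd p - fst p) powr (- b) else 0)"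
  have Beta: "Beta (1 - d) (1 - b) > 0" using d b by (intro Beta_real_pos) auto
  have inner: "(\<integral>\<^sup>+z. ?G (y, z) \<partial>mu d) = ennreal (y powr (1 - d - b) * Beta (1 - d) (1 - b))"
    if y: "0 < y" "y < 1" for y
  proof -
    have "(\<integral>\<^sup>+z. ?G (y, z) \<partial>mu d) =
        (\<integral>\<^sup>+z. ennreal (indicator {0..1} z * z powr (- d)) * ?G (y, z) \<partial>lborel)"
      by (rule nn_integral_mu) measurable
    also have "\<dots> = (\<integral>\<^sup>+z. ennreal (indicator {0..y} z * (z powr ((1 - d) - 1) * (y - z) powr ((1 - b) - 1))) \<partial>lborel)"
      by (rule nn_integral_cong) (use y in \<open>auto simp: indicator_def ennreal_mult[symmetric] not_less\<close>)
    also have "\<dots> = ennreal (y powr ((1 - d) + (1 - b) - 1) * Beta (1 - d) (1 - b))"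
      using d b y by (intro nn_integral_Beta_scaled) auto
    finally show ?thesis by (simp add: algebra_simps)
  qed
  have "(\<integral>\<^sup>+p. ?G p \<partial>(mu d \<Otimes>\<^sub>M mu d)) = (\<integral>\<^sup>+y. (\<integral>\<^sup>+z. ?G (y, z) \<partial>mu d) \<partial>mu d)"
    by (rule M.nn_integral_fst[symmetric]) measurable
  also have "\<dots> = (\<integral>\<^sup>+y. ennreal (y powr (1 - d - b) * Beta (1 - d) (1 - b)) \<partial>mu d)"
  proof (rule nn_integral_cong_AE)
    show "AE y in mu d. (\<integral>\<^sup>+z. ?G (y, z) \<partial>mu d) = ennreal (y powr (1 - d - b) * Beta (1 - d) (1 - b))"
      using AE_mu_unit[of d] by (rule eventually_mono) (use inner in blast)
  qed
  also have "\<dots> = (\<integral>\<^sup>+y. ennreal (indicator {0..1} y * y powr (- d)) * ennreal (y powr (1 - d - b) * Beta (1 - d) (1 - b)) \<partial>lborel)"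
    by (rule nn_integral_mu) measurable
  also have "\<dots> = (\<integral>\<^sup>+y. ennreal (Beta (1 - d) (1 - b)) * ennreal (indicator {0..1} y * y powr (1 - 2 * d - b)) \<partial>lborel)"
  proof (rule nn_integral_cong)
    fix y :: real
    have "y powr (- d) * y powr (1 - d - b) = y powr (1 - 2 * d - b)"
    proof -
      have "1 - 2 * d - b = - d + (1 - d - b)" by simp
      then show ?thesis by (simp only: powr_add)
    qed
    then show "ennreal (indicator {0..1} y * y powr (- d)) * ennreal (y powr (1 - d - b) * Beta (1 - d) (1 - b))
        = ennreal (Beta (1 - d) (1 - b)) * ennreal (indicator {0..1} y * y powr (1 - 2 * d - b))"
      using Beta by (simp add: ennreal_mult[symmetric] mult_ac)
  qed
  also have "\<dots> = ennreal (Beta (1 - d) (1 - b)) * ennreal (1 / (1 - 2 * d - b + 1))"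
    using nn_integral_powr_unit[of "1 - 2 * d - b"] db by (subst nn_integral_cmult) auto
  also have "\<dots> = ennreal (Beta (1 - d) (1 - b) / (2 - 2 * d - b))"
    using Beta db by (simp add: ennreal_mult[symmetric])
  finally have G: "(\<integral>\<^sup>+p. ?G p \<partial>(mu d \<Otimes>\<^sub>M mu d)) = ennreal (Beta (1 - d) (1 - b) / (2 - 2 * d - b))" .
  have "(\<integral>\<^sup>+p. ?G' p \<partial>(mu d \<Otimes>\<^sub>M mu d)) = (\<integral>\<^sup>+y. (\<integral>\<^sup>+z. ?G' (y, z) \<partial>mu d) \<partial>mu d)"
    by (rule M.nn_integral_fst[symmetric]) measurable
  also have "\<dots> = (\<integral>\<^sup>+p. ?G p \<partial>(mu d \<Otimes>\<^sub>M mu d))"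
  proof -
    have "?G \<in> borel_measurable (mu d \<Otimes>\<^sub>M mu d)" by measurable
    from MM.nn_integral_snd[OF this] show ?thesis by (simp only: fst_conv snd_conv)
  qed
  finally have G': "(\<integral>\<^sup>+p. ?G' p \<partial>(mu d \<Otimes>\<^sub>M mu d)) = ennreal (Beta (1 - d) (1 - b) / (2 - 2 * d - b))"
    using G by simp
  have "(\<integral>\<^sup>+p. ennreal (\<bar>fst p - snd p\<bar> powr (- b)) \<partial>(mu d \<Otimes>\<^sub>M mu d)) =
      (\<integral>\<^sup>+p. ?G p + ?G' p \<partial>(mu d \<Otimes>\<^sub>M mu d))"
    by (rule nn_integral_cong) auto
  also have "\<dots> = (\<integral>\<^sup>+p. ?G p \<partial>(mu d \<Otimes>\<^sub>M mu d)) + (\<integral>\<^sup>+p. ?G' p \<partial>(mu d \<Otimes>\<^sub>M mu d))"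
    by (rule nn_integral_add) measurable
  also have "\<dots> = ennreal (Beta (1 - d) (1 - b) / (2 - 2 * d - b)) + ennreal (Beta (1 - d) (1 - b) / (2 - 2 * d - b))"
    unfolding G G' ..
  also have "\<dots> = ennreal (2 * Beta (1 - d) (1 - b) / (2 - 2 * d - b))"
    using Beta db by (simp add: ennreal_plus[symmetric] del: ennreal_plus)
  finally show ?thesis
    using Beta db by (intro has_bochner_integral_nn_integral) auto
qed

lemma I_const_eq_integral:
  assumes d: "d < 1" and b: "\<alpha> * real m < 1" and db: "2 * d + \<alpha> * real m < 2"
  shows "I_const m \<alpha> d = (\<integral>p. \<bar>fst p - snd p\<bar> powr (- (\<alpha> * real m)) \<partial>(mu d \<Otimes>\<^sub>M mu d))"
proof -
  interpret M: finite_measure "mu d" by (rule finite_measure_mu[OF d])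
  interpret MM: pair_sigma_finite "mu d" "mu d" ..
  let ?K = "\<lambda>y z::real. \<bar>y - z\<bar> powr (- (\<alpha> * real m))"
  have "integrable (mu d \<Otimes>\<^sub>M mu d) (\<lambda>p. ?K (fst p) (snd p))"
    using has_bochner_integral_riesz_energy[OF d b db] by (simp add: has_bochner_integral_iff)
  from MM.integral_fst'[OF this]
  have "(\<integral>p. ?K (fst p) (snd p) \<partial>(mu d \<Otimes>\<^sub>M mu d)) = (\<integral>y. (\<integral>z. ?K y z \<partial>mu d) \<partial>mu d)" by simp
  also have "\<dots> = (LINT y:{0..1}|lborel. y powr (- d) *\<^sub>R (\<integral>z. ?K y z \<partial>mu d))"
    by (rule integral_mu) measurable
  also have "\<dots> = (LINT y:{0..1}|lborel. y powr (- d) *\<^sub>R (LINT z:{0..1}|lborel. z powr (- d) *\<^sub>R ?K y z))"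
    by (subst integral_mu) auto
  also have "\<dots> = I_const m \<alpha> d"
    unfolding I_const_def by (simp add: mult.assoc)
  finally show ?thesis by simp
qed

lemma I_const_formula:
  assumes "d < 1" "\<alpha> * real m < 1" "2 * d + \<alpha> * real m < 2"
  shows "I_const m \<alpha> d = 2 * Beta (1 - d) (1 - \<alpha> * real m) / (2 - 2 * d - \<alpha> * real m)"
  unfolding I_const_eq_integral[OF assms]
  using has_bochner_integral_riesz_energy[OF assms] by (simp add: has_bochner_integral_iff)

lemma I_const_pos:
  assumes "d < 1" "\<alpha> * real m < 1" "2 * d + \<alpha> * real m < 2"
  shows "I_const m \<alpha> d > 0"
  unfolding I_const_formula[OF assms] using assms
  by (intro divide_pos_pos mult_pos_pos Beta_real_pos) auto

section \<open>Energies of the even and odd kernels\<close>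

text \<open>By the product-to-sum formulas these two kernels are the limits of the weighted
  integrals of cos(yx) cos(zx) and of sin(yx) sin(zx). Their sum is the Riesz kernel of the
  difference.\<close>

definition even_kernel :: "real \<Rightarrow> real \<times> real \<Rightarrow> real" where
  "even_kernel \<alpha> p = (rieszK \<alpha> (fst p - snd p) + rieszK \<alpha> (fst p + snd p)) / 2"

definition odd_kernel :: "real \<Rightarrow> real \<times> real \<Rightarrow> real" where
  "odd_kernel \<alpha> p = (rieszK \<alpha> (fst p - snd p) - rieszK \<alpha> (fst p + snd p)) / 2"

lemma even_kernel_measurable [measurable]: "even_kernel \<alpha> \<in> borel_measurable (borel \<Otimes>\<^sub>M borel)"
  unfolding even_kernel_def by measurable

lemma odd_kernel_measurable [measurable]: "odd_kernel \<alpha> \<in> borel_measurable (borel \<Otimes>\<^sub>M borel)"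
  unfolding odd_kernel_def by measurable

definition parity_energy :: "nat \<Rightarrow> real \<Rightarrow> real \<Rightarrow> nat \<Rightarrow> real" where
  "parity_energy m \<alpha> d k = (\<integral>p. even_kernel \<alpha> p ^ k * odd_kernel \<alpha> p ^ (m - k) \<partial>(mu d \<Otimes>\<^sub>M mu d))"

locale riesz_params =
  fixes m :: nat and \<alpha> d :: real
  assumes m: "m \<ge> 2" and \<alpha>: "0 < \<alpha>" "\<alpha> < 1" and \<alpha>m: "\<alpha> * real m < 1"
    and d\<alpha>: "2 * d + \<alpha> * real m < 1"
begin

lemma d_less: "d < 1"
proof -
  have "\<alpha> * real m \<ge> 0" using \<alpha> by simp
  with d\<alpha> show ?thesis by linarith
qed

sublocale M: finite_measure "mu d" by (rule finite_measure_mu[OF d_less])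

sublocale MM: pair_sigma_finite "mu d" "mu d" ..

text \<open>Here positivity of the points matters: it gives
  \<open>\<bar>y - z\<bar> < y + z\<close>, and the Riesz kernel decreases in the modulus. For
  points of opposite sign the odd kernel would be negative.\<close>

lemma kernel_bounds:
  assumes "0 < y" "0 < z" "y \<noteq> z"
  shows "0 < odd_kernel \<alpha> (y, z)" "odd_kernel \<alpha> (y, z) \<le> rieszK \<alpha> (y - z)"
    "0 \<le> even_kernel \<alpha> (y, z)" "even_kernel \<alpha> (y, z) \<le> rieszK \<alpha> (y - z)"
proof -
  have "\<bar>y + z\<bar> powr (- \<alpha>) < \<bar>y - z\<bar> powr (- \<alpha>)"
    using assms \<alpha> by (intro powr_less_mono2_neg) auto
  then have "rieszK \<alpha> (y + z) < rieszK \<alpha> (y - z)"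
    using c_alpha_pos[OF \<alpha>] by (simp add: rieszK_def)
  moreover have "0 \<le> rieszK \<alpha> (y + z)" by (rule rieszK_nonneg[OF \<alpha>])
  ultimately show "0 < odd_kernel \<alpha> (y, z)" "odd_kernel \<alpha> (y, z) \<le> rieszK \<alpha> (y - z)"
    "0 \<le> even_kernel \<alpha> (y, z)" "even_kernel \<alpha> (y, z) \<le> rieszK \<alpha> (y - z)"
    by (auto simp: odd_kernel_def even_kernel_def)
qed

lemma AE_kernel_bounds:
  "AE p in mu d \<Otimes>\<^sub>M mu d. 0 < odd_kernel \<alpha> p \<and> odd_kernel \<alpha> p \<le> rieszK \<alpha> (fst p - snd p) \<and>
     0 \<le> even_kernel \<alpha> p \<and> even_kernel \<alpha> p \<le> rieszK \<alpha> (fst p - snd p)"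
  using AE_mu_pair[OF d_less]
proof eventually_elim
  case (elim p)
  then show ?case using kernel_bounds[of "fst p" "snd p"] by simp
qed

lemma riesz_power_integral:
  "has_bochner_integral (mu d \<Otimes>\<^sub>M mu d) (\<lambda>p. rieszK \<alpha> (fst p - snd p) ^ m) (c_alpha \<alpha> ^ m * I_const m \<alpha> d)"
proof -
  have "has_bochner_integral (mu d \<Otimes>\<^sub>M mu d) (\<lambda>p. \<bar>fst p - snd p\<bar> powr (- (\<alpha> * real m))) (I_const m \<alpha> d)"
    using has_bochner_integral_riesz_energy[of d "\<alpha> * real m"] I_const_formula[of d \<alpha> m] d_less \<alpha>m d\<alpha> by simp
  then have "has_bochner_integral (mu d \<Otimes>\<^sub>M mu d)
      (\<lambda>p. c_alpha \<alpha> ^ m * \<bar>fst p - snd p\<bar> powr (- (\<alpha> * real m))) (c_alpha \<alpha> ^ m * I_const m \<alpha> d)"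
    by (intro has_bochner_integral_mult_right)
  \<comment> \<open>The identity holds at \<open>u = 0\<close> as well: there
    \<open>0 powr a = 0\<close> makes both sides vanish, since m is positive.\<close>
  moreover have "c_alpha \<alpha> ^ m * \<bar>u\<bar> powr (- (\<alpha> * real m)) = rieszK \<alpha> u ^ m" for u
  proof (cases "u = 0")
    case False
    then have "(\<bar>u\<bar> powr (- \<alpha>)) ^ m = \<bar>u\<bar> powr (- \<alpha> * real m)" by (simp add: powr_realpow[symmetric] powr_powr)
    then show ?thesis by (simp add: rieszK_def power_mult_distrib)
  qed (use m in \<open>auto simp: rieszK_def\<close>)
  ultimately show ?thesis by simp
qed

lemma energy_pos: "c_alpha \<alpha> ^ m * I_const m \<alpha> d > 0"
  using c_alpha_pos[OF \<alpha>] I_const_pos[of d \<alpha> m] d_less \<alpha>m d\<alpha> by simp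

lemma parity_energy_integrable:
  assumes "k \<le> m"
  shows "integrable (mu d \<Otimes>\<^sub>M mu d) (\<lambda>p. even_kernel \<alpha> p ^ k * odd_kernel \<alpha> p ^ (m - k))"
proof (rule Bochner_Integration.integrable_bound)
  show "integrable (mu d \<Otimes>\<^sub>M mu d) (\<lambda>p. rieszK \<alpha> (fst p - snd p) ^ m)"
    using riesz_power_integral by (simp add: has_bochner_integral_iff)
  show "AE p in mu d \<Otimes>\<^sub>M mu d. norm (even_kernel \<alpha> p ^ k * odd_kernel \<alpha> p ^ (m - k))
      \<le> norm (rieszK \<alpha> (fst p - snd p) ^ m)"
    using AE_kernel_bounds
  proof eventually_elim
    case (elim p)
    have "even_kernel \<alpha> p ^ k * odd_kernel \<alpha> p ^ (m - k)
        \<le> rieszK \<alpha> (fst p - snd p) ^ k * rieszK \<alpha> (fst p - snd p) ^ (m - k)"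
      using elim rieszK_nonneg[OF \<alpha>] by (intro mult_mono power_mono) auto
    also have "\<dots> = rieszK \<alpha> (fst p - snd p) ^ m"
      using assms by (simp add: power_add[symmetric])
    finally show ?case using elim by simp
  qed
qed measurable

lemma parity_energy_nonneg: "parity_energy m \<alpha> d k \<ge> 0"
  unfolding parity_energy_def
  by (rule integral_nonneg_AE) (use AE_kernel_bounds in \<open>eventually_elim, auto\<close>)

lemma parity_energy_sum:
  "(\<Sum>k\<le>m. real (m choose k) * parity_energy m \<alpha> d k) = c_alpha \<alpha> ^ m * I_const m \<alpha> d"
proof -
  have "(\<Sum>k\<le>m. real (m choose k) * parity_energy m \<alpha> d k) =
     (\<integral>p. (\<Sum>k\<le>m. real (m choose k) * (even_kernel \<alpha> p ^ k * odd_kernel \<alpha> p ^ (m - k))) \<partial>(mu d \<Otimes>\<^sub>M mu d))"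
    unfolding parity_energy_def
    by (subst Bochner_Integration.integral_sum) (auto intro: parity_energy_integrable)
  also have "(\<lambda>p. \<Sum>k\<le>m. real (m choose k) * (even_kernel \<alpha> p ^ k * odd_kernel \<alpha> p ^ (m - k))) =
      (\<lambda>p. rieszK \<alpha> (fst p - snd p) ^ m)"
  proof
    fix p
    have "rieszK \<alpha> (fst p - snd p) = even_kernel \<alpha> p + odd_kernel \<alpha> p"
      by (simp add: even_kernel_def odd_kernel_def field_simps)
    then show "(\<Sum>k\<le>m. real (m choose k) * (even_kernel \<alpha> p ^ k * odd_kernel \<alpha> p ^ (m - k))) =
        rieszK \<alpha> (fst p - snd p) ^ m"
      by (simp add: binomial_ring mult.assoc)
  qed
  also have "(\<integral>p. rieszK \<alpha> (fst p - snd p) ^ m \<partial>(mu d \<Otimes>\<^sub>M mu d)) = c_alpha \<alpha> ^ m * I_const m \<alpha> d"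
    using riesz_power_integral by (simp add: has_bochner_integral_iff)
  finally show ?thesis .
qed

section \<open>Why the energies cannot form a geometric sequence\<close>

text \<open>Open boxes in the unit square have positive measure, so an identity valid almost
  everywhere can be read off at a point whose position is prescribed roughly.\<close>

lemma AE_pair_box:
  assumes "AE p in mu d \<Otimes>\<^sub>M mu d. P p" "0 < a" "a < b" "b \<le> 1" "0 < a'" "a' < b'" "b' \<le> 1"
  shows "\<exists>y z. a < y \<and> y < b \<and> a' < z \<and> z < b' \<and> P (y, z)"
proof (rule ccontr)
  assume "\<not> ?thesis"
  with assms(1) have "AE p in mu d \<Otimes>\<^sub>M mu d. p \<notin> {a<..<b} \<times> {a'<..<b'}"
    by (auto elim!: eventually_mono)
  then have "{a<..<b} \<times> {a'<..<b'} \<in> null_sets (mu d \<Otimes>\<^sub>M mu d)"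
    by (subst AE_iff_null_sets) auto
  then have "emeasure (mu d \<Otimes>\<^sub>M mu d) ({a<..<b} \<times> {a'<..<b'}) = 0"
    by (simp add: null_sets_def)
  then have "emeasure (mu d) {a<..<b} * emeasure (mu d) {a'<..<b'} = 0"
    using M.emeasure_pair_measure_Times[of "{a<..<b}" "mu d" "{a'<..<b'}"] by simp
  then show False
    using emeasure_mu_pos[of a b d] emeasure_mu_pos[of a' b' d] assms by auto
qed

lemma power_m_split:
  fixes x :: real
  shows "x ^ m = x ^ (m - 2) * x\<^sup>2" "x ^ (m - 1) = x ^ (m - 2) * x"
proof -
  obtain n where n: "m = n + 2" using m by (metis add.commute le_Suc_ex)
  show "x ^ m = x ^ (m - 2) * x\<^sup>2" "x ^ (m - 1) = x ^ (m - 2) * x"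
    unfolding n by (simp_all add: power2_eq_square)
qed

text \<open>
  A geometric sequence of energies forces equality in Cauchy--Schwarz, hence proportional even and
  odd kernels; but their ratio depends on \<open>\<bar>y - z\<bar> / (y + z)\<close>.
\<close>

lemma parity_energy_not_geometric:
  assumes B: "B > 0" "(\<Sum>k\<le>m. real (m choose k) * parity_energy m \<alpha> d k) = B"
  shows "\<not> (\<forall>k\<le>m. parity_energy m \<alpha> d k = B * (p ^ k * q ^ (m - k))\<^sup>2)"
proof
  assume geo: "\<forall>k\<le>m. parity_energy m \<alpha> d k = B * (p ^ k * q ^ (m - k))\<^sup>2"
  have pq: "p \<noteq> 0 \<or> q \<noteq> 0"
  proof (rule ccontr)
    assume "\<not> ?thesis"
    then have "parity_energy m \<alpha> d k = 0" if "k \<le> m" for k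
      using geo that m by (cases "k = 0") auto
    with B show False by simp
  qed
  let ?E = "even_kernel \<alpha>" and ?O = "odd_kernel \<alpha>"
  let ?f = "\<lambda>k x. ?E x ^ k * ?O x ^ (m - k)"
  \<comment> \<open>A nonnegative function whose integral involves only the energies of index 0, 1
    and 2, which exist because m is at least 2. For geometric energies the three terms
    cancel.\<close>
  let ?g = "\<lambda>x. (p\<^sup>2 * ?O x - q\<^sup>2 * ?E x)\<^sup>2 * ?O x ^ (m - 2)"
  have g_eq: "?g x = p ^ 4 * ?f 0 x - 2 * p\<^sup>2 * q\<^sup>2 * ?f 1 x + q ^ 4 * ?f 2 x" for x
    using power_m_split[of "?O x"]
    by (simp add: power2_diff power_mult_distrib algebra_simps power2_eq_square power4_eq_xxxx)
  have int: "integrable (mu d \<Otimes>\<^sub>M mu d) (?f 0)" "integrable (mu d \<Otimes>\<^sub>M mu d) (?f 1)"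
     "integrable (mu d \<Otimes>\<^sub>M mu d) (?f 2)"
    using m by (auto intro!: parity_energy_integrable[of 0, simplified] parity_energy_integrable[of 1, simplified]
      parity_energy_integrable[of 2, simplified])
  have g_int: "integrable (mu d \<Otimes>\<^sub>M mu d) ?g"
    unfolding g_eq using int by (intro Bochner_Integration.integrable_add Bochner_Integration.integrable_diff integrable_mult_right)
  have "(\<integral>x. ?g x \<partial>(mu d \<Otimes>\<^sub>M mu d)) =
      p ^ 4 * parity_energy m \<alpha> d 0 - 2 * p\<^sup>2 * q\<^sup>2 * parity_energy m \<alpha> d 1 + q ^ 4 * parity_energy m \<alpha> d 2"
    unfolding g_eq parity_energy_def using int by simp
  also have "parity_energy m \<alpha> d 0 = B * (q ^ m)\<^sup>2" using geo by simp
  also have "parity_energy m \<alpha> d 1 = B * (p * q ^ (m - 1))\<^sup>2" using geo m by simp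
  also have "parity_energy m \<alpha> d 2 = B * (p\<^sup>2 * q ^ (m - 2))\<^sup>2" using geo m by simp
  also note power_m_split(1)[of q]
  also note power_m_split(2)[of q]
  finally have "(\<integral>x. ?g x \<partial>(mu d \<Otimes>\<^sub>M mu d)) = 0"
    by (simp add: power_mult_distrib power2_eq_square power4_eq_xxxx)
  moreover have "AE x in mu d \<Otimes>\<^sub>M mu d. 0 \<le> ?g x"
    using AE_kernel_bounds by eventually_elim simp
  ultimately have "AE x in mu d \<Otimes>\<^sub>M mu d. ?g x = 0"
    using integral_nonneg_eq_0_iff_AE[OF g_int] by simp
  then have ratio: "AE x in mu d \<Otimes>\<^sub>M mu d.
      (\<bar>fst x - snd x\<bar> / (fst x + snd x)) powr \<alpha> * (p\<^sup>2 + q\<^sup>2) = p\<^sup>2 - q\<^sup>2"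
    using AE_kernel_bounds AE_mu_pair[OF d_less]
  proof eventually_elim
    case (elim x)
    define s where "s = \<bar>fst x - snd x\<bar>"
    define t where "t = fst x + snd x"
    have st: "s > 0" "t > 0" using elim by (auto simp: s_def t_def)
    \<comment> \<open>The remaining power of the odd kernel is cancelled by its strict
      positivity.\<close>
    have "p\<^sup>2 * ?O x = q\<^sup>2 * ?E x" using elim by simp
    then have "p\<^sup>2 * (c_alpha \<alpha> * (s powr (- \<alpha>) - t powr (- \<alpha>))) = q\<^sup>2 * (c_alpha \<alpha> * (s powr (- \<alpha>) + t powr (- \<alpha>)))"
      using st by (simp add: even_kernel_def odd_kernel_def rieszK_def s_def t_def right_diff_distrib distrib_left)
    then have "p\<^sup>2 * (s powr (- \<alpha>) - t powr (- \<alpha>)) = q\<^sup>2 * (s powr (- \<alpha>) + t powr (- \<alpha>))"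
      using c_alpha_pos[OF \<alpha>] by (simp add: mult.left_commute[of _ "c_alpha \<alpha>"])
    then have "s powr \<alpha> * (p\<^sup>2 * (s powr (- \<alpha>) - t powr (- \<alpha>))) = s powr \<alpha> * (q\<^sup>2 * (s powr (- \<alpha>) + t powr (- \<alpha>)))"
      by simp
    moreover have "s powr \<alpha> * s powr (- \<alpha>) = 1" using st by (simp add: powr_add[symmetric])
    moreover have "s powr \<alpha> * t powr (- \<alpha>) = (s / t) powr \<alpha>"
      using st by (simp add: powr_divide powr_minus_divide)
    ultimately have "p\<^sup>2 * (1 - (s / t) powr \<alpha>) = q\<^sup>2 * (1 + (s / t) powr \<alpha>)"
      by algebra
    then show ?case by (simp add: s_def t_def algebra_simps)
  qed
  \<comment> \<open>Two boxes separated by the value 1/10 of the ratio: here the points are far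
    apart and the ratio exceeds it, while in the second box they are close together and the ratio
    stays below. Yet its power would have to be the same constant.\<close>
  obtain y z where 1: "1/10 < y" "y < 2/10" "8/10 < z" "z < 9/10"
    and eq1: "(\<bar>y - z\<bar> / (y + z)) powr \<alpha> * (p\<^sup>2 + q\<^sup>2) = p\<^sup>2 - q\<^sup>2"
    using AE_pair_box[OF ratio, of "1/10" "2/10" "8/10" "9/10"] by auto
  obtain y' z' where 2: "8/10 < y'" "y' < 9/10" "8/10 < z'" "z' < 9/10"
    and eq2: "(\<bar>y' - z'\<bar> / (y' + z')) powr \<alpha> * (p\<^sup>2 + q\<^sup>2) = p\<^sup>2 - q\<^sup>2"
    using AE_pair_box[OF ratio, of "8/10" "9/10" "8/10" "9/10"] by auto
  have "p\<^sup>2 + q\<^sup>2 \<noteq> 0" using pq by (simp add: sum_power2_eq_zero_iff)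
  with eq1 eq2 have "(\<bar>y - z\<bar> / (y + z)) powr \<alpha> = (\<bar>y' - z'\<bar> / (y' + z')) powr \<alpha>"
    by (metis mult_right_cancel)
  note powr_eq = this
  have "\<bar>y' - z'\<bar> / (y' + z') < 1/10" using 2 by (auto simp: divide_less_eq abs_if)
  moreover have "1/10 < \<bar>y - z\<bar> / (y + z)" using 1 by (simp add: less_divide_eq)
  ultimately have "\<bar>y' - z'\<bar> / (y' + z') < \<bar>y - z\<bar> / (y + z)" by (rule less_trans)
  then have "(\<bar>y' - z'\<bar> / (y' + z')) powr \<alpha> < (\<bar>y - z\<bar> / (y + z)) powr \<alpha>"
    using \<alpha> 2 by (intro powr_less_mono2) auto
  with powr_eq show False by simp
qed

lemma parity_energy_strict:
  "\<exists>S < sqrt (c_alpha \<alpha> ^ m * I_const m \<alpha> d). \<forall>p q. 0 \<le> p \<longrightarrow> 0 \<le> q \<longrightarrow> p\<^sup>2 + q\<^sup>2 \<le> 1 \<longrightarrow>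
    (\<Sum>k\<le>m. real (m choose k) * (p ^ k * q ^ (m - k) * sqrt (parity_energy m \<alpha> d k))) \<le> S"
  by (rule binomial_sqrt_sum_less)
     (use parity_energy_sum energy_pos parity_energy_nonneg parity_energy_not_geometric[OF energy_pos parity_energy_sum] in auto)

end

section \<open>The upper bound\<close>

text \<open>The starting pair f and K is arbitrary so that the lemma can be applied twice: powers of
  the cosine features are stacked on powers of the sine features.\<close>

lemma kernel_dom_feature_power:
  fixes \<phi> :: "'a \<Rightarrow> 'b \<Rightarrow> real" and \<xi> W :: "'b \<Rightarrow> real"
  assumes fin: "finite_measure M" and sf: "sigma_finite_measure X"
    and dom: "kernel_dom M f K"
    and \<phi>: "(\<lambda>p. \<phi> (fst p) (snd p)) \<in> borel_measurable (M \<Otimes>\<^sub>M X)"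
    and W: "W \<in> borel_measurable X" and le: "\<And>y x. \<bar>\<phi> y x\<bar> \<le> W x"
    and W2: "integrable X (\<lambda>x. (W x)\<^sup>2)"
    and \<xi>: "\<xi> \<in> borel_measurable X" and \<xi>2: "integrable X (\<lambda>x. (\<xi> x)\<^sup>2)"
  shows "kernel_dom M (\<lambda>y. (\<integral>x. \<phi> y x * \<xi> x \<partial>X) ^ n * f y)
    (\<lambda>p. ((\<integral>x. (\<xi> x)\<^sup>2 \<partial>X) * (\<integral>x. \<phi> (fst p) x * \<phi> (snd p) x \<partial>X)) ^ n * K p)"
proof (induction n)
  case 0
  then show ?case using dom by simp
next
  case (Suc n)
  from kernel_dom_feature_mult[OF fin sf Suc \<phi> W le W2 \<xi> \<xi>2]
  show ?case by (simp only: power_Suc mult.assoc)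
qed

text \<open>
  At \<open>0\<close> the integral in \<open>wcut_def\<close> diverges; the value \<open>0\<close> matches \<open>0 powr ((\<alpha> - 1) / 2) = 0\<close>, so that
  the limit holds at every point of the product space.
\<close>

definition wcut_sqrt :: "real \<Rightarrow> real \<Rightarrow> real \<Rightarrow> real" where
  "wcut_sqrt \<alpha> r x = (if x = 0 then 0 else sqrt (wcut \<alpha> r x))"

lemma wcut_sqrt_measurable [measurable]: "wcut_sqrt \<alpha> r \<in> borel_measurable borel"
  unfolding wcut_sqrt_def by measurable

section \<open>Moment bounds for the truncated weight\<close>

definition even_cut :: "real \<Rightarrow> real \<Rightarrow> real \<times> real \<Rightarrow> real" where
  "even_cut \<alpha> r p = (Kcut \<alpha> r (fst p - snd p) + Kcut \<alpha> r (fst p + snd p)) / 2"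

definition odd_cut :: "real \<Rightarrow> real \<Rightarrow> real \<times> real \<Rightarrow> real" where
  "odd_cut \<alpha> r p = (Kcut \<alpha> r (fst p - snd p) - Kcut \<alpha> r (fst p + snd p)) / 2"

context riesz_params
begin

lemma wcut_sqrt_nonneg: "0 \<le> wcut_sqrt \<alpha> r x"
  using wcut_nonneg[OF \<alpha>] by (simp add: wcut_sqrt_def)

lemma wcut_sqrt_sq: "x \<noteq> 0 \<Longrightarrow> (wcut_sqrt \<alpha> r x)\<^sup>2 = wcut \<alpha> r x"
  using wcut_nonneg[OF \<alpha>] by (simp add: wcut_sqrt_def)

lemma powr_half_eq_sqrt: "\<bar>x\<bar> powr ((\<alpha> - 1) / 2) = sqrt (\<bar>x\<bar> powr (\<alpha> - 1))"
  by (cases "x = 0") (simp_all add: powr_half_sqrt[symmetric] powr_powr)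

lemma wcut_sqrt_le: "r > 0 \<Longrightarrow> wcut_sqrt \<alpha> r x \<le> \<bar>x\<bar> powr ((\<alpha> - 1) / 2)"
  unfolding powr_half_eq_sqrt using wcut_le[OF \<alpha>, of r x] by (simp add: wcut_sqrt_def)

lemma wcut_sqrt_tendsto:
  "(\<lambda>n. wcut_sqrt \<alpha> (inverse (real (Suc n))) x) \<longlonglongrightarrow> \<bar>x\<bar> powr ((\<alpha> - 1) / 2)"
proof (cases "x = 0")
  case False
  then show ?thesis
    unfolding powr_half_eq_sqrt using tendsto_real_sqrt[OF wcut_tendsto[OF \<alpha>]] by (simp add: wcut_sqrt_def)
qed (simp add: wcut_sqrt_def)

lemma wcut_sqrt_sq_integrable:
  assumes "r > 0"
  shows "integrable lborel (\<lambda>x. (wcut_sqrt \<alpha> r x)\<^sup>2)"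
proof (rule integrable_cong_AE_imp[OF wcut_integrable[OF \<alpha> assms]])
  show "AE x in lborel. wcut \<alpha> r x = (wcut_sqrt \<alpha> r x)\<^sup>2"
    using AE_lborel_singleton[of "0::real"] by eventually_elim (simp add: wcut_sqrt_sq)
qed measurable

text \<open>The Gram kernels of the cosine and sine features, by the product-to-sum formulas. The
  square of \<open>wcut_sqrt\<close> is \<open>wcut\<close> only away from 0, hence the identities
  under the integral are almost everywhere.\<close>

lemma cut_kernels:
  assumes r: "r > 0"
  shows "(\<integral>x. (wcut_sqrt \<alpha> r x * cos (y * x)) * (wcut_sqrt \<alpha> r x * cos (z * x)) \<partial>lborel) = even_cut \<alpha> r (y, z)"
    and "(\<integral>x. (wcut_sqrt \<alpha> r x * sin (y * x)) * (wcut_sqrt \<alpha> r x * sin (z * x)) \<partial>lborel) = odd_cut \<alpha> r (y, z)"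
proof -
  have hb: "has_bochner_integral lborel (\<lambda>x. wcut \<alpha> r x * cos (u * x)) (Kcut \<alpha> r u)" for u
    by (rule wcut_cos[OF \<alpha> r])
  have "has_bochner_integral lborel
      (\<lambda>x. (wcut \<alpha> r x * cos ((y - z) * x) + wcut \<alpha> r x * cos ((y + z) * x)) / 2) (even_cut \<alpha> r (y, z))"
    unfolding even_cut_def fst_conv snd_conv
    by (intro has_bochner_integral_divide_zero has_bochner_integral_add hb)
  then have "(\<integral>x. (wcut \<alpha> r x * cos ((y - z) * x) + wcut \<alpha> r x * cos ((y + z) * x)) / 2 \<partial>lborel) = even_cut \<alpha> r (y, z)"
    by (rule has_bochner_integral_integral_eq)
  moreover have "(\<integral>x. (wcut_sqrt \<alpha> r x * cos (y * x)) * (wcut_sqrt \<alpha> r x * cos (z * x)) \<partial>lborel) =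
      (\<integral>x. (wcut \<alpha> r x * cos ((y - z) * x) + wcut \<alpha> r x * cos ((y + z) * x)) / 2 \<partial>lborel)"
  proof (rule integral_cong_AE)
    show "AE x in lborel. (wcut_sqrt \<alpha> r x * cos (y * x)) * (wcut_sqrt \<alpha> r x * cos (z * x)) =
        (wcut \<alpha> r x * cos ((y - z) * x) + wcut \<alpha> r x * cos ((y + z) * x)) / 2"
      using AE_lborel_singleton[of "0::real"]
    proof eventually_elim
      case (elim x)
      then show ?case
        unfolding wcut_sqrt_sq[OF elim, symmetric]
        by (simp add: left_diff_distrib distrib_right cos_diff cos_add power2_eq_square algebra_simps)
    qed
  qed measurable
  ultimately show "(\<integral>x. (wcut_sqrt \<alpha> r x * cos (y * x)) * (wcut_sqrt \<alpha> r x * cos (z * x)) \<partial>lborel) = even_cut \<alpha> r (y, z)"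
    by simp
  have "has_bochner_integral lborel
      (\<lambda>x. (wcut \<alpha> r x * cos ((y - z) * x) - wcut \<alpha> r x * cos ((y + z) * x)) / 2) (odd_cut \<alpha> r (y, z))"
    unfolding odd_cut_def fst_conv snd_conv
    by (intro has_bochner_integral_divide_zero has_bochner_integral_diff hb)
  then have "(\<integral>x. (wcut \<alpha> r x * cos ((y - z) * x) - wcut \<alpha> r x * cos ((y + z) * x)) / 2 \<partial>lborel) = odd_cut \<alpha> r (y, z)"
    by (rule has_bochner_integral_integral_eq)
  moreover have "(\<integral>x. (wcut_sqrt \<alpha> r x * sin (y * x)) * (wcut_sqrt \<alpha> r x * sin (z * x)) \<partial>lborel) =
      (\<integral>x. (wcut \<alpha> r x * cos ((y - z) * x) - wcut \<alpha> r x * cos ((y + z) * x)) / 2 \<partial>lborel)"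
  proof (rule integral_cong_AE)
    show "AE x in lborel. (wcut_sqrt \<alpha> r x * sin (y * x)) * (wcut_sqrt \<alpha> r x * sin (z * x)) =
        (wcut \<alpha> r x * cos ((y - z) * x) - wcut \<alpha> r x * cos ((y + z) * x)) / 2"
      using AE_lborel_singleton[of "0::real"]
    proof eventually_elim
      case (elim x)
      then show ?case
        unfolding wcut_sqrt_sq[OF elim, symmetric]
        by (simp add: left_diff_distrib distrib_right cos_diff cos_add power2_eq_square algebra_simps)
    qed
  qed measurable
  ultimately show "(\<integral>x. (wcut_sqrt \<alpha> r x * sin (y * x)) * (wcut_sqrt \<alpha> r x * sin (z * x)) \<partial>lborel) = odd_cut \<alpha> r (y, z)"
    by simp
qed

lemma cut_kernel_bounds:
  assumes r: "r > 0" and yz: "0 < y" "0 < z" "y \<noteq> z"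
  shows "0 \<le> even_cut \<alpha> r (y, z)" "even_cut \<alpha> r (y, z) \<le> even_kernel \<alpha> (y, z)"
    "0 \<le> odd_cut \<alpha> r (y, z)" "odd_cut \<alpha> r (y, z) \<le> odd_kernel \<alpha> (y, z)"
proof -
  have abs: "\<bar>y - z\<bar> \<le> \<bar>y + z\<bar>" using yz by auto
  show "0 \<le> even_cut \<alpha> r (y, z)"
    using Kcut_nonneg[OF \<alpha>] by (simp add: even_cut_def)
  show "even_cut \<alpha> r (y, z) \<le> even_kernel \<alpha> (y, z)"
    using Kcut_le[OF \<alpha> r, of "y - z"] Kcut_le[OF \<alpha> r, of "y + z"] yz
    by (simp add: even_cut_def even_kernel_def)
  show "0 \<le> odd_cut \<alpha> r (y, z)"
    using Kcut_antimono[OF \<alpha> r abs] by (simp add: odd_cut_def)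
  show "odd_cut \<alpha> r (y, z) \<le> odd_kernel \<alpha> (y, z)"
    using Kcut_diff_le[OF \<alpha> r _ abs] yz by (simp add: odd_cut_def odd_kernel_def)
qed

text \<open>Domination of the product of powers, tested on the constant function 1. The truncated
  kernels give the boundedness that \<open>kernel_dom\<close> demands; afterwards they may be
  replaced by the full ones, because they are nonnegative on the square and lie below them.\<close>

lemma parity_moment_bound:
  fixes u v :: "real \<Rightarrow> real"
  assumes r: "r > 0" and k: "k \<le> m"
    and u[measurable]: "u \<in> borel_measurable borel" and u2: "integrable lborel (\<lambda>x. (u x)\<^sup>2)"
    and v[measurable]: "v \<in> borel_measurable borel" and v2: "integrable lborel (\<lambda>x. (v x)\<^sup>2)"
  defines "a \<equiv> \<lambda>y. \<integral>x. wcut_sqrt \<alpha> r x * cos (y * x) * u x \<partial>lborel"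
    and "b \<equiv> \<lambda>y. \<integral>x. wcut_sqrt \<alpha> r x * sin (y * x) * v x \<partial>lborel"
    and "p \<equiv> sqrt (\<integral>x. (u x)\<^sup>2 \<partial>lborel)" and "q \<equiv> sqrt (\<integral>x. (v x)\<^sup>2 \<partial>lborel)"
  shows "integrable (mu d) (\<lambda>y. a y ^ k * b y ^ (m - k))"
    and "\<bar>\<integral>y. a y ^ k * b y ^ (m - k) \<partial>mu d\<bar> \<le> p ^ k * q ^ (m - k) * sqrt (parity_energy m \<alpha> d k)"
proof -
  have fin: "finite_measure (mu d)" by (rule finite_measure_mu[OF d_less])
  have sf: "sigma_finite_measure (lborel :: real measure)" ..
  have W2: "integrable lborel (\<lambda>x. (wcut_sqrt \<alpha> r x)\<^sup>2)" by (rule wcut_sqrt_sq_integrable[OF r])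
  have le: "\<bar>wcut_sqrt \<alpha> r x * cos (y * x)\<bar> \<le> wcut_sqrt \<alpha> r x"
    "\<bar>wcut_sqrt \<alpha> r x * sin (y * x)\<bar> \<le> wcut_sqrt \<alpha> r x" for x y
    using wcut_sqrt_nonneg by (simp_all add: abs_mult mult_left_le)
  let ?K = "\<lambda>x. (p\<^sup>2 * even_cut \<alpha> r x) ^ k * ((q\<^sup>2 * odd_cut \<alpha> r x) ^ (m - k) * 1)"
  have pq: "p \<ge> 0" "q \<ge> 0" "(\<integral>x. (u x)\<^sup>2 \<partial>lborel) = p\<^sup>2" "(\<integral>x. (v x)\<^sup>2 \<partial>lborel) = q\<^sup>2"
    by (simp_all add: p_def q_def)
  have m1: "(\<lambda>z. wcut_sqrt \<alpha> r (snd z) * cos (fst z * snd z)) \<in> borel_measurable (mu d \<Otimes>\<^sub>M lborel)"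
    by measurable
  have m2: "(\<lambda>z. wcut_sqrt \<alpha> r (snd z) * sin (fst z * snd z)) \<in> borel_measurable (mu d \<Otimes>\<^sub>M lborel)"
    by measurable
  have "kernel_dom (mu d) (\<lambda>y. a y ^ k * (b y ^ (m - k) * 1))
    (\<lambda>z. ((\<integral>x. (u x)\<^sup>2 \<partial>lborel) * (\<integral>x. (wcut_sqrt \<alpha> r x * cos (fst z * x)) * (wcut_sqrt \<alpha> r x * cos (snd z * x)) \<partial>lborel)) ^ k *
      (((\<integral>x. (v x)\<^sup>2 \<partial>lborel) * (\<integral>x. (wcut_sqrt \<alpha> r x * sin (fst z * x)) * (wcut_sqrt \<alpha> r x * sin (snd z * x)) \<partial>lborel)) ^ (m - k) * 1))"
    unfolding a_def b_def
    by (rule kernel_dom_feature_power[OF fin sf kernel_dom_feature_power[OF fin sf kernel_dom_one[OF fin]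
            m2 _ le(2) W2 _ v2] m1 _ le(1) W2 _ u2]) auto
  then have dom: "kernel_dom (mu d) (\<lambda>y. a y ^ k * (b y ^ (m - k) * 1)) ?K"
    unfolding cut_kernels[OF r] pq by (simp only: prod.collapse)
  then show "integrable (mu d) (\<lambda>y. a y ^ k * b y ^ (m - k))"
    unfolding kernel_dom_def mult_1_right using M.integrable_bounded_fun by blast
  have K_int: "integrable (mu d \<Otimes>\<^sub>M mu d) ?K"
  proof -
    interpret P: finite_measure "mu d \<Otimes>\<^sub>M mu d" by (rule finite_measure_pair_measure) fact+
    show ?thesis using dom unfolding kernel_dom_def using P.integrable_bounded_fun by blast
  qed
  \<comment> \<open>The test function is \<open>h = 1\<close>.\<close>
  have "(\<integral>y. a y ^ k * b y ^ (m - k) \<partial>mu d)\<^sup>2 \<le> (\<integral>x. ?K x \<partial>(mu d \<Otimes>\<^sub>M mu d))"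
    using dom unfolding kernel_dom_def
    by (auto dest!: spec[where x = "\<lambda>_. 1"])
  also have "\<dots> \<le> (\<integral>x. (p\<^sup>2) ^ k * (q\<^sup>2) ^ (m - k) * (even_kernel \<alpha> x ^ k * odd_kernel \<alpha> x ^ (m - k)) \<partial>(mu d \<Otimes>\<^sub>M mu d))"
  proof (rule integral_mono_AE[OF K_int integrable_mult_right[OF parity_energy_integrable[OF k]]])
    show "AE x in mu d \<Otimes>\<^sub>M mu d. ?K x \<le> (p\<^sup>2) ^ k * (q\<^sup>2) ^ (m - k) * (even_kernel \<alpha> x ^ k * odd_kernel \<alpha> x ^ (m - k))"
      using AE_mu_pair[OF d_less]
    proof eventually_elim
      case (elim x)
      then have "even_cut \<alpha> r x ^ k * odd_cut \<alpha> r x ^ (m - k) \<le> even_kernel \<alpha> x ^ k * odd_kernel \<alpha> x ^ (m - k)"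
        using cut_kernel_bounds[OF r, of "fst x" "snd x"]
        by (intro mult_mono power_mono) (auto intro: order_trans)
      then have "(p\<^sup>2) ^ k * (q\<^sup>2) ^ (m - k) * (even_cut \<alpha> r x ^ k * odd_cut \<alpha> r x ^ (m - k))
          \<le> (p\<^sup>2) ^ k * (q\<^sup>2) ^ (m - k) * (even_kernel \<alpha> x ^ k * odd_kernel \<alpha> x ^ (m - k))"
        by (rule mult_left_mono) simp
      then show ?case by (simp add: power_mult_distrib mult_ac)
    qed
  qed
  also have "\<dots> = (p ^ k * q ^ (m - k) * sqrt (parity_energy m \<alpha> d k))\<^sup>2"
    using parity_energy_nonneg[of k]
    by (simp add: power_mult_distrib parity_energy_def[symmetric] power_mult[symmetric] mult.commute[of 2])
  finally show "\<bar>\<integral>y. a y ^ k * b y ^ (m - k) \<partial>mu d\<bar> \<le> p ^ k * q ^ (m - k) * sqrt (parity_energy m \<alpha> d k)"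
    by (rule abs_le_square_iff[THEN iffD2, THEN order_trans]) (use pq parity_energy_nonneg[of k] in simp)
qed

lemma cut_moment_bound:
  fixes u v :: "real \<Rightarrow> real"
  assumes r: "r > 0"
    and u: "u \<in> borel_measurable borel" and u2: "integrable lborel (\<lambda>x. (u x)\<^sup>2)"
    and v: "v \<in> borel_measurable borel" and v2: "integrable lborel (\<lambda>x. (v x)\<^sup>2)"
  shows "\<bar>\<integral>y. ((\<integral>x. wcut_sqrt \<alpha> r x * cos (y * x) * u x \<partial>lborel)
      + (\<integral>x. wcut_sqrt \<alpha> r x * sin (y * x) * v x \<partial>lborel)) ^ m \<partial>mu d\<bar>
    \<le> (\<Sum>k\<le>m. real (m choose k) * (sqrt (\<integral>x. (u x)\<^sup>2 \<partial>lborel) ^ k * sqrt (\<integral>x. (v x)\<^sup>2 \<partial>lborel) ^ (m - k)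
        * sqrt (parity_energy m \<alpha> d k)))"
proof -
  define a where "a = (\<lambda>y. \<integral>x. wcut_sqrt \<alpha> r x * cos (y * x) * u x \<partial>lborel)"
  define b where "b = (\<lambda>y. \<integral>x. wcut_sqrt \<alpha> r x * sin (y * x) * v x \<partial>lborel)"
  have int: "integrable (mu d) (\<lambda>y. a y ^ k * b y ^ (m - k))" if "k \<le> m" for k
    unfolding a_def b_def by (rule parity_moment_bound(1)[OF r that u u2 v v2])
  have bound: "\<bar>\<integral>y. a y ^ k * b y ^ (m - k) \<partial>mu d\<bar> \<le>
      sqrt (\<integral>x. (u x)\<^sup>2 \<partial>lborel) ^ k * sqrt (\<integral>x. (v x)\<^sup>2 \<partial>lborel) ^ (m - k) * sqrt (parity_energy m \<alpha> d k)"
    if "k \<le> m" for k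
    unfolding a_def b_def by (rule parity_moment_bound(2)[OF r that u u2 v v2])
  have "(\<integral>y. (a y + b y) ^ m \<partial>mu d) = (\<integral>y. (\<Sum>k\<le>m. real (m choose k) * (a y ^ k * b y ^ (m - k))) \<partial>mu d)"
    by (simp add: binomial_ring mult.assoc)
  also have "\<dots> = (\<Sum>k\<le>m. real (m choose k) * (\<integral>y. a y ^ k * b y ^ (m - k) \<partial>mu d))"
    using int by (subst Bochner_Integration.integral_sum) auto
  finally have "\<bar>\<integral>y. (a y + b y) ^ m \<partial>mu d\<bar> \<le> (\<Sum>k\<le>m. \<bar>real (m choose k) * (\<integral>y. a y ^ k * b y ^ (m - k) \<partial>mu d)\<bar>)"
    by (simp only: sum_abs)
  also have "\<dots> \<le> (\<Sum>k\<le>m. real (m choose k) * (sqrt (\<integral>x. (u x)\<^sup>2 \<partial>lborel) ^ k * sqrt (\<integral>x. (v x)\<^sup>2 \<partial>lborel) ^ (m - k)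
        * sqrt (parity_energy m \<alpha> d k)))"
    by (intro sum_mono) (simp add: abs_mult mult_left_mono bound)
  finally show ?thesis by (simp only: a_def b_def)
qed

end

section \<open>The tensor pairing as a moment of a Fourier transform\<close>

definition fourier_at :: "(real \<Rightarrow> complex) \<Rightarrow> real \<Rightarrow> complex" where
  "fourier_at \<eta> y = (\<integral>x. \<eta> x * exp (\<i> * complex_of_real (y * x)) \<partial>lborel)"

lemma cnj_borel_measurable [measurable]: "cnj \<in> borel_measurable borel"
  by (intro borel_measurable_continuous_onI continuous_intros)

lemma norm_exp_i_times_real: "norm (exp (\<i> * complex_of_real t)) = 1"
  by simp

text \<open>For fixed y the exponential of the sum factors over the coordinates, so the integral
  over the product space is an m-th power. Exchanging the integrals needs an integrable \<eta>,
  which the full weight does not guarantee for a general square-integrable \<xi>.\<close>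

lemma pairing_fubini:
  fixes \<eta> :: "real \<Rightarrow> complex"
  assumes \<mu>: "finite_measure M" and sets: "sets M = sets borel" and \<eta>: "integrable lborel \<eta>"
  shows "(\<integral>x. (\<integral>y. exp (\<i> * complex_of_real (y * (\<Sum>j<m. x j))) \<partial>M) * (\<Prod>j<m. \<eta> (x j)) \<partial>(\<Pi>\<^sub>M j\<in>{..<m}. lborel))
    = (\<integral>y. fourier_at \<eta> y ^ m \<partial>M)"
proof -
  let ?P = "\<Pi>\<^sub>M j\<in>{..<m}. (lborel :: real measure)"
  interpret M: finite_measure M by fact
  interpret ps: product_sigma_finite "\<lambda>_::nat. lborel :: real measure" ..
  interpret P: sigma_finite_measure ?P by (rule ps.sigma_finite) simp
  interpret MP: pair_sigma_finite M ?P ..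
  note [measurable_cong] = sets
  have [measurable]: "\<eta> \<in> borel_measurable borel" using \<eta> by auto
  let ?e = "\<lambda>y s. exp (\<i> * complex_of_real (y * s))"
  have int: "integrable (M \<Otimes>\<^sub>M ?P) (\<lambda>(y, x). ?e y (\<Sum>j<m. x j) * (\<Prod>j<m. \<eta> (x j)))"
  proof (rule MP.Fubini_integrable)
    have P_int: "integrable ?P (\<lambda>x. \<Prod>j<m. \<eta> (x j))"
      by (rule ps.product_integrable_prod) (use \<eta> in auto)
    show "AE y in M. integrable ?P (\<lambda>x. case (y, x) of (y, x) \<Rightarrow> ?e y (\<Sum>j<m. x j) * (\<Prod>j<m. \<eta> (x j)))"
    proof (rule AE_I2)
      fix y
      have "integrable ?P (\<lambda>x. ?e y (\<Sum>j<m. x j) * (\<Prod>j<m. \<eta> (x j)))"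
        by (rule Bochner_Integration.integrable_bound[OF P_int])
          (auto simp: norm_mult norm_exp_i_times_real)
      then show "integrable ?P (\<lambda>x. case (y, x) of (y, x) \<Rightarrow> ?e y (\<Sum>j<m. x j) * (\<Prod>j<m. \<eta> (x j)))" by simp
    qed
    show "integrable M (\<lambda>y. \<integral>x. norm (case (y, x) of (y, x) \<Rightarrow> ?e y (\<Sum>j<m. x j) * (\<Prod>j<m. \<eta> (x j))) \<partial>?P)"
      by (simp add: norm_mult norm_exp_i_times_real)
  qed measurable
  have "(\<integral>x. (\<integral>y. ?e y (\<Sum>j<m. x j) \<partial>M) * (\<Prod>j<m. \<eta> (x j)) \<partial>?P)
      = (\<integral>x. (\<integral>y. ?e y (\<Sum>j<m. x j) * (\<Prod>j<m. \<eta> (x j)) \<partial>M) \<partial>?P)"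
    by simp
  also have "\<dots> = (\<integral>y. (\<integral>x. ?e y (\<Sum>j<m. x j) * (\<Prod>j<m. \<eta> (x j)) \<partial>?P) \<partial>M)"
    by (rule MP.Fubini_integral[OF int])
  also have "\<dots> = (\<integral>y. fourier_at \<eta> y ^ m \<partial>M)"
  proof (rule Bochner_Integration.integral_cong[OF refl])
    fix y
    have "?e y (\<Sum>j<m. x j) * (\<Prod>j<m. \<eta> (x j)) = (\<Prod>j<m. \<eta> (x j) * ?e y (x j))" for x :: "nat \<Rightarrow> real"
      by (simp add: prod.distrib exp_sum[symmetric] sum_distrib_left mult.commute)
    then have "(\<integral>x. ?e y (\<Sum>j<m. x j) * (\<Prod>j<m. \<eta> (x j)) \<partial>?P) = (\<integral>x. (\<Prod>j<m. \<eta> (x j) * ?e y (x j)) \<partial>?P)"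
      by simp
    also have "\<dots> = (\<Prod>j<m. fourier_at \<eta> y)"
      unfolding fourier_at_def
    proof (rule ps.product_integral_prod)
      show "integrable lborel (\<lambda>x. \<eta> x * ?e y x)" for i :: nat
        by (rule Bochner_Integration.integrable_bound[OF \<eta>]) (auto simp: norm_mult norm_exp_i_times_real)
    qed simp
    finally show "(\<integral>x. ?e y (\<Sum>j<m. x j) * (\<Prod>j<m. \<eta> (x j)) \<partial>?P) = fourier_at \<eta> y ^ m" by simp
  qed
  finally show ?thesis .
qed

lemma Im_fourier_at_eq_0:
  assumes herm: "AE x in lborel. \<eta> (- x) = cnj (\<eta> x)"
    and [measurable]: "\<eta> \<in> borel_measurable borel"
  shows "Im (fourier_at \<eta> y) = 0"
proof -
  let ?f = "\<lambda>x. \<eta> x * exp (\<i> * complex_of_real (y * x))"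
  have "fourier_at \<eta> y = (\<integral>x. ?f (- x) \<partial>lborel)"
    unfolding fourier_at_def using lborel_integral_real_affine[of "-1" ?f 0] by simp
  also have "\<dots> = (\<integral>x. cnj (?f x) \<partial>lborel)"
  proof (rule integral_cong_AE)
    show "AE x in lborel. ?f (- x) = cnj (?f x)"
      using herm by eventually_elim (simp add: exp_cnj)
  qed measurable
  also have "\<dots> = cnj (fourier_at \<eta> y)"
    unfolding fourier_at_def by (rule Bochner_Integration.integral_cnj)
  finally have "Im (fourier_at \<eta> y) = Im (cnj (fourier_at \<eta> y))" by (rule arg_cong)
  then show ?thesis by simp
qed

lemma fourier_at_hermitian:
  fixes \<eta> :: "real \<Rightarrow> complex"
  assumes herm: "AE x in lborel. \<eta> (- x) = cnj (\<eta> x)" and \<eta>: "integrable lborel \<eta>"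
  shows "fourier_at \<eta> y = complex_of_real ((\<integral>x. Re (\<eta> x) * cos (y * x) \<partial>lborel) - (\<integral>x. Im (\<eta> x) * sin (y * x) \<partial>lborel))"
proof -
  have [measurable]: "\<eta> \<in> borel_measurable borel" using \<eta> by auto
  have int: "integrable lborel (\<lambda>x. \<eta> x * exp (\<i> * complex_of_real (y * x)))"
    by (rule Bochner_Integration.integrable_bound[OF \<eta>]) (auto simp: norm_mult norm_exp_i_times_real)
  have "integrable lborel (\<lambda>x. Re (\<eta> x) * cos (y * x))"
    by (rule Bochner_Integration.integrable_bound[OF integrable_Re[OF \<eta>]])
      (auto simp: abs_mult mult_left_le)
  moreover have "integrable lborel (\<lambda>x. Im (\<eta> x) * sin (y * x))"
    by (rule Bochner_Integration.integrable_bound[OF integrable_Im[OF \<eta>]])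
      (auto simp: abs_mult mult_left_le)
  moreover have "Re (fourier_at \<eta> y) = (\<integral>x. Re (\<eta> x) * cos (y * x) - Im (\<eta> x) * sin (y * x) \<partial>lborel)"
    unfolding fourier_at_def by (subst integral_Re[OF int, symmetric]) (simp add: Re_exp Im_exp)
  moreover have "Im (fourier_at \<eta> y) = 0"
    by (rule Im_fourier_at_eq_0[OF herm]) measurable
  ultimately show ?thesis by (simp add: complex_eq_iff)
qed

lemma hermitian_L2D:
  assumes "\<xi> \<in> hermitian_L2"
  shows "\<xi> \<in> borel_measurable borel" "integrable lborel (\<lambda>x. (cmod (\<xi> x))\<^sup>2)"
    "AE x in lborel. \<xi> (- x) = cnj (\<xi> x)"
    "integrable lborel (\<lambda>x. (Re (\<xi> x))\<^sup>2)" "integrable lborel (\<lambda>x. (Im (\<xi> x))\<^sup>2)"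
    "herm_norm \<xi> = sqrt ((\<integral>x. (Re (\<xi> x))\<^sup>2 \<partial>lborel) + (\<integral>x. (Im (\<xi> x))\<^sup>2 \<partial>lborel))"
proof -
  show 1[measurable]: "\<xi> \<in> borel_measurable borel" and 2: "integrable lborel (\<lambda>x. (cmod (\<xi> x))\<^sup>2)"
    and "AE x in lborel. \<xi> (- x) = cnj (\<xi> x)"
    using assms by (auto simp: hermitian_L2_def)
  show 3: "integrable lborel (\<lambda>x. (Re (\<xi> x))\<^sup>2)"
    by (rule Bochner_Integration.integrable_bound[OF 2]) (auto simp: cmod_power2)
  show 4: "integrable lborel (\<lambda>x. (Im (\<xi> x))\<^sup>2)"
    by (rule Bochner_Integration.integrable_bound[OF 2]) (auto simp: cmod_power2)
  have "(\<integral>x. \<xi> x * cnj (\<xi> x) \<partial>lborel) = (\<integral>x. complex_of_real ((cmod (\<xi> x))\<^sup>2) \<partial>lborel)"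
    by (simp only: complex_norm_square)
  then have "herm_inner \<xi> \<xi> = (\<integral>x. (cmod (\<xi> x))\<^sup>2 \<partial>lborel)"
    unfolding herm_inner_def by (simp only: integral_complex_of_real Re_complex_of_real)
  moreover have "(\<integral>x. (cmod (\<xi> x))\<^sup>2 \<partial>lborel) = (\<integral>x. (Re (\<xi> x))\<^sup>2 \<partial>lborel) + (\<integral>x. (Im (\<xi> x))\<^sup>2 \<partial>lborel)"
    unfolding cmod_power2 using 3 4 by simp
  ultimately show "herm_norm \<xi> = sqrt ((\<integral>x. (Re (\<xi> x))\<^sup>2 \<partial>lborel) + (\<integral>x. (Im (\<xi> x))\<^sup>2 \<partial>lborel))"
    by (simp add: herm_norm_def)
qed

text \<open>Moves each weight factor from the kernel to the matching factor of \<xi>, leaving a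
  product of values of one function of one variable.\<close>

lemma tensor_pairing_Q1:
  fixes \<xi> :: "real \<Rightarrow> complex"
  shows "tensor_pairing m (Q1 \<epsilon> m \<alpha> d) \<xi> = C_const \<epsilon> m \<alpha> d *
    Re (\<integral>x. (\<integral>y. exp (\<i> * complex_of_real (y * (\<Sum>j<m. x j))) \<partial>mu d) *
        (\<Prod>j<m. complex_of_real (\<bar>x j\<bar> powr ((\<alpha> - 1) / 2)) * cnj (\<xi> (x j))) \<partial>(\<Pi>\<^sub>M j\<in>{..<m}. lborel))"
proof -
  have "(LINT y:{0..1}|lborel. complex_of_real (y powr (- d)) * exp (\<i> * complex_of_real (y * s)))
     = (\<integral>y. exp (\<i> * complex_of_real (y * s)) \<partial>mu d)" for s
    by (subst integral_mu) (auto simp: scaleR_conv_of_real)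
  note inner = this
  have "Q1 \<epsilon> m \<alpha> d x * (\<Prod>j<m. cnj (\<xi> (x j))) = complex_of_real (C_const \<epsilon> m \<alpha> d) *
     ((\<integral>y. exp (\<i> * complex_of_real (y * (\<Sum>j<m. x j))) \<partial>mu d) *
        (\<Prod>j<m. complex_of_real (\<bar>x j\<bar> powr ((\<alpha> - 1) / 2)) * cnj (\<xi> (x j))))" for x
    unfolding Q1_def inner prod.distrib of_real_prod by (simp only: mult_ac)
  then show ?thesis
    by (simp add: tensor_pairing_def)
qed

section \<open>Removal of the cutoff and the strict upper bound\<close>

context riesz_params
begin

lemma cut_pairing_norm_le:
  assumes r: "r > 0" and \<xi>: "\<xi> \<in> hermitian_L2" and norm: "herm_norm \<xi> \<le> 1"
    and S: "\<And>p q. 0 \<le> p \<Longrightarrow> 0 \<le> q \<Longrightarrow> p\<^sup>2 + q\<^sup>2 \<le> 1 \<Longrightarrow>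
      (\<Sum>k\<le>m. real (m choose k) * (p ^ k * q ^ (m - k) * sqrt (parity_energy m \<alpha> d k))) \<le> S"
  shows "norm (\<integral>x. (\<integral>y. exp (\<i> * complex_of_real (y * (\<Sum>j<m. x j))) \<partial>mu d) *
      (\<Prod>j<m. complex_of_real (wcut_sqrt \<alpha> r (x j)) * cnj (\<xi> (x j))) \<partial>(\<Pi>\<^sub>M j\<in>{..<m}. lborel)) \<le> S"
proof -
  note h = hermitian_L2D[OF \<xi>]
  note [measurable] = h(1)
  define \<eta> where "\<eta> = (\<lambda>x. complex_of_real (wcut_sqrt \<alpha> r x) * cnj (\<xi> x))"
  have [measurable]: "\<eta> \<in> borel_measurable borel" unfolding \<eta>_def by measurable
  \<comment> \<open>The truncated weight is integrable, so its root is square-integrable and the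
    product with \<xi> is integrable.\<close>
  have \<eta>_int: "integrable lborel \<eta>"
  proof (rule Bochner_Integration.integrable_bound)
    show "integrable lborel (\<lambda>x. wcut_sqrt \<alpha> r x * cmod (\<xi> x))"
      by (rule integrable_mult_L2[OF _ _ wcut_sqrt_sq_integrable[OF r] h(2)]) auto
  qed (auto simp: \<eta>_def norm_mult)
  have "AE x in lborel. \<eta> (- x) = cnj (\<eta> x)"
    using h(3) by eventually_elim (simp add: \<eta>_def wcut_sqrt_def wcut_def)
  from fourier_at_hermitian[OF this \<eta>_int]
  \<comment> \<open>The conjugate on \<xi> turns the minus sign of
    \<open>fourier_at_hermitian\<close> into a plus.\<close>
  have four: "fourier_at \<eta> y = complex_of_real ((\<integral>x. wcut_sqrt \<alpha> r x * cos (y * x) * Re (\<xi> x) \<partial>lborel)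
      + (\<integral>x. wcut_sqrt \<alpha> r x * sin (y * x) * Im (\<xi> x) \<partial>lborel))" for y
    by (simp add: \<eta>_def mult_ac)
  have "(\<integral>x. (\<integral>y. exp (\<i> * complex_of_real (y * (\<Sum>j<m. x j))) \<partial>mu d) *
      (\<Prod>j<m. \<eta> (x j)) \<partial>(\<Pi>\<^sub>M j\<in>{..<m}. lborel)) = (\<integral>y. fourier_at \<eta> y ^ m \<partial>mu d)"
    by (rule pairing_fubini[OF finite_measure_mu[OF d_less] sets_mu \<eta>_int])
  also have "\<dots> = complex_of_real (\<integral>y. ((\<integral>x. wcut_sqrt \<alpha> r x * cos (y * x) * Re (\<xi> x) \<partial>lborel)
      + (\<integral>x. wcut_sqrt \<alpha> r x * sin (y * x) * Im (\<xi> x) \<partial>lborel)) ^ m \<partial>mu d)"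
    unfolding four of_real_power[symmetric] by (rule integral_complex_of_real)
  finally have "norm (\<integral>x. (\<integral>y. exp (\<i> * complex_of_real (y * (\<Sum>j<m. x j))) \<partial>mu d) *
      (\<Prod>j<m. \<eta> (x j)) \<partial>(\<Pi>\<^sub>M j\<in>{..<m}. lborel)) = \<bar>\<integral>y. ((\<integral>x. wcut_sqrt \<alpha> r x * cos (y * x) * Re (\<xi> x) \<partial>lborel)
      + (\<integral>x. wcut_sqrt \<alpha> r x * sin (y * x) * Im (\<xi> x) \<partial>lborel)) ^ m \<partial>mu d\<bar>"
    by (simp only: norm_of_real)
  also have "\<dots> \<le> (\<Sum>k\<le>m. real (m choose k) * (sqrt (\<integral>x. (Re (\<xi> x))\<^sup>2 \<partial>lborel) ^ k * sqrt (\<integral>x. (Im (\<xi> x))\<^sup>2 \<partial>lborel) ^ (m - k)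
        * sqrt (parity_energy m \<alpha> d k)))"
    by (rule cut_moment_bound[OF r _ h(4) _ h(5)]) measurable
  also have "\<dots> \<le> S"
  proof (rule S)
    show "(sqrt (\<integral>x. (Re (\<xi> x))\<^sup>2 \<partial>lborel))\<^sup>2 + (sqrt (\<integral>x. (Im (\<xi> x))\<^sup>2 \<partial>lborel))\<^sup>2 \<le> 1"
      using norm by (simp add: h(6))
  qed auto
  finally show ?thesis by (simp only: \<eta>_def)
qed

text \<open>The truncated integrands are dominated by the full one, because the root weight lies
  below its limit. If the full integrand is integrable, dominated convergence carries the bound
  over; if not, its Bochner integral is 0 by convention. Square integrability of \<open>Q1\<close>
  thus never has to be established.\<close>

lemma tensor_pairing_le:
  assumes \<xi>: "\<xi> \<in> hermitian_L2" and norm: "herm_norm \<xi> \<le> 1"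
    and S: "\<And>p q. 0 \<le> p \<Longrightarrow> 0 \<le> q \<Longrightarrow> p\<^sup>2 + q\<^sup>2 \<le> 1 \<Longrightarrow>
      (\<Sum>k\<le>m. real (m choose k) * (p ^ k * q ^ (m - k) * sqrt (parity_energy m \<alpha> d k))) \<le> S"
  shows "\<bar>tensor_pairing m (Q1 \<epsilon> m \<alpha> d) \<xi>\<bar> \<le> \<bar>C_const \<epsilon> m \<alpha> d\<bar> * S"
proof -
  let ?P = "\<Pi>\<^sub>M j\<in>{..<m}. (lborel :: real measure)"
  define \<Psi> where "\<Psi> = (\<lambda>s. \<integral>y. exp (\<i> * complex_of_real (y * s)) \<partial>mu d)"
  have [measurable]: "\<Psi> \<in> borel_measurable borel"
    unfolding \<Psi>_def by (rule M.borel_measurable_lebesgue_integral) measurable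
  define r where "r = (\<lambda>n. inverse (real (Suc n)))"
  have r: "r n > 0" for n by (simp add: r_def)
  note [measurable] = hermitian_L2D(1)[OF \<xi>]
  let ?f = "\<lambda>x. \<Psi> (\<Sum>j<m. x j) * (\<Prod>j<m. complex_of_real (\<bar>x j\<bar> powr ((\<alpha> - 1) / 2)) * cnj (\<xi> (x j)))"
  let ?fn = "\<lambda>n x. \<Psi> (\<Sum>j<m. x j) * (\<Prod>j<m. complex_of_real (wcut_sqrt \<alpha> (r n) (x j)) * cnj (\<xi> (x j)))"
  have fn: "norm (\<integral>x. ?fn n x \<partial>?P) \<le> S" for n
    unfolding \<Psi>_def by (rule cut_pairing_norm_le[OF r \<xi> norm S])
  have "norm (\<integral>x. ?f x \<partial>?P) \<le> S"
  proof (cases "integrable ?P ?f")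
    case True
    have "(\<lambda>n. \<integral>x. ?fn n x \<partial>?P) \<longlonglongrightarrow> (\<integral>x. ?f x \<partial>?P)"
    proof (rule integral_dominated_convergence)
      show "integrable ?P (\<lambda>x. norm (?f x))" using True by (rule integrable_norm)
      show "AE x in ?P. (\<lambda>n. ?fn n x) \<longlonglongrightarrow> ?f x"
        unfolding r_def by (intro AE_I2 tendsto_intros wcut_sqrt_tendsto)
      show "AE x in ?P. norm (?fn n x) \<le> norm (?f x)" for n
        unfolding norm_mult prod_norm[symmetric] norm_of_real
        using wcut_sqrt_nonneg wcut_sqrt_le[OF r]
        by (intro AE_I2 mult_left_mono prod_mono conjI mult_nonneg_nonneg mult_right_mono) auto
    qed measurable
    then have "(\<lambda>n. norm (\<integral>x. ?fn n x \<partial>?P)) \<longlonglongrightarrow> norm (\<integral>x. ?f x \<partial>?P)" by (rule tendsto_norm)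
    then show ?thesis by (rule LIMSEQ_le_const2) (use fn in blast)
  next
    case False
    \<comment> \<open>At p = q = 0 every term of the bound vanishes, since k and m - k cannot both
      be 0.\<close>
    have "0 \<le> S" using S[of 0 0] parity_energy_nonneg m by (simp add: power_0_left sum.neutral)
    with False show ?thesis by (simp add: not_integrable_integral_eq)
  qed
  then have "\<bar>Re (\<integral>x. ?f x \<partial>?P)\<bar> \<le> S" using abs_Re_le_cmod order_trans by blast
  then show ?thesis
    unfolding tensor_pairing_Q1 abs_mult \<Psi>_def by (rule mult_left_mono) simp
qed

text \<open>The constant S does not depend on \<xi>, so its gap below the root of the total energy
  survives the supremum. Multiplying that root by the modulus of \<open>C_const\<close> cancels the
  energy and leaves only the factorial.\<close>

lemma Lambda_sup_less:
  assumes \<epsilon>: "\<epsilon> \<in> {- 1, 1}"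
  shows "Lambda_sup \<epsilon> m \<alpha> d < ereal (fact m powr (- 1 / 2))"
proof -
  let ?B = "c_alpha \<alpha> ^ m * I_const m \<alpha> d"
  obtain S where S: "S < sqrt ?B" and le: "\<And>p q. 0 \<le> p \<Longrightarrow> 0 \<le> q \<Longrightarrow> p\<^sup>2 + q\<^sup>2 \<le> 1 \<Longrightarrow>
      (\<Sum>k\<le>m. real (m choose k) * (p ^ k * q ^ (m - k) * sqrt (parity_energy m \<alpha> d k))) \<le> S"
    using parity_energy_strict by blast
  have C: "\<bar>C_const \<epsilon> m \<alpha> d\<bar> = (fact m * ?B) powr (- 1 / 2)"
    using \<epsilon> by (auto simp: C_const_def abs_mult mult.assoc)
  have "Lambda_sup \<epsilon> m \<alpha> d \<le> ereal (\<bar>C_const \<epsilon> m \<alpha> d\<bar> * S)"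
    unfolding Lambda_sup_def by (rule SUP_least) (use tensor_pairing_le[OF _ _ le] in auto)
  also have "\<bar>C_const \<epsilon> m \<alpha> d\<bar> * S < \<bar>C_const \<epsilon> m \<alpha> d\<bar> * sqrt ?B"
  proof (rule mult_strict_left_mono[OF S])
    have "fact m * ?B > 0" by (rule mult_pos_pos[OF _ energy_pos]) simp
    then show "0 < \<bar>C_const \<epsilon> m \<alpha> d\<bar>" unfolding C by (metis powr_gt_zero less_irrefl)
  qed
  also have "\<dots> = fact m powr (- 1 / 2)"
  proof -
    have "sqrt ?B = ?B powr (1 / 2)" using energy_pos by (simp add: powr_half_sqrt)
    then have "\<bar>C_const \<epsilon> m \<alpha> d\<bar> * sqrt ?B = fact m powr (- 1 / 2) * (?B powr (- 1 / 2) * ?B powr (1 / 2))"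
      unfolding C using energy_pos by (simp add: powr_mult)
    also have "?B powr (- 1 / 2) * ?B powr (1 / 2) = 1"
    proof -
      have "b powr (- 1 / 2) * b powr (1 / 2) = 1" if "b > 0" for b :: real
        using that by (simp add: powr_add[symmetric])
      from this[OF energy_pos] show ?thesis .
    qed
    finally show ?thesis by simp
  qed
  finally show ?thesis by simp
qed

end

section \<open>The lower bound\<close>

text \<open>Real and imaginary part of the Fourier transform of the indicator of [0, 1]. They are
  kept as integrals so that Fubini applies directly; the closed forms, valid away from 0, serve only
  for decay.\<close>

definition unit_cos :: "real \<Rightarrow> real" where "unit_cos x = (\<integral>z. cos (z * x) \<partial>mu 0)"
definition unit_sin :: "real \<Rightarrow> real" where "unit_sin x = (\<integral>z. sin (z * x) \<partial>mu 0)"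

interpretation mu0: finite_measure "mu 0"
  by (rule finite_measure_mu) simp

lemma unit_cos_measurable [measurable]: "unit_cos \<in> borel_measurable borel"
  unfolding unit_cos_def by (rule mu0.borel_measurable_lebesgue_integral) measurable

lemma unit_sin_measurable [measurable]: "unit_sin \<in> borel_measurable borel"
  unfolding unit_sin_def by (rule mu0.borel_measurable_lebesgue_integral) measurable

lemma integral_mu0:
  fixes f :: "real \<Rightarrow> real"
  assumes [measurable]: "f \<in> borel_measurable borel"
  shows "(\<integral>y. f y \<partial>mu 0) = (LBINT y:{0..1}. f y)"
  unfolding set_lebesgue_integral_def mu_def
proof (subst integral_density)
  \<comment> \<open>Since \<open>0 powr 0 = 0\<close>, the two densities disagree at the origin, a
    null set.\<close>
  show "(\<integral>x. (indicator {0..1} x * x powr (- 0)) *\<^sub>R f x \<partial>lborel) = (\<integral>x. indicator {0..1} x *\<^sub>R f x \<partial>lborel)"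
  proof (rule integral_cong_AE)
    show "AE x in lborel. (indicator {0..1} x * x powr (- 0)) *\<^sub>R f x = indicator {0..1} x *\<^sub>R f x"
      using AE_lborel_singleton[of "0::real"] by eventually_elim (auto simp: indicator_def)
  qed measurable
qed auto

lemma measure_mu0: "measure (mu 0) UNIV = 1"
proof -
  show ?thesis using integral_mu0[of "\<lambda>_. 1"] by (simp add: set_lebesgue_integral_def)
qed

lemma unit_cos_eq: "x \<noteq> 0 \<Longrightarrow> unit_cos x = sin x / x"
  unfolding unit_cos_def
  by (subst integral_mu0, simp, subst set_borel_integral_eq_integral(2))
     (auto intro!: borel_integrable_atLeastAtMost' continuous_intros integral_unique
       fundamental_theorem_of_calculus[of 0 1 "\<lambda>z. sin (z * x) / x", simplified]
       derivative_eq_intros simp: has_real_derivative_iff_has_vector_derivative[symmetric])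

lemma unit_sin_eq: "x \<noteq> 0 \<Longrightarrow> unit_sin x = (1 - cos x) / x"
  unfolding unit_sin_def
  by (subst integral_mu0, simp, subst set_borel_integral_eq_integral(2))
     (auto intro!: borel_integrable_atLeastAtMost' continuous_intros integral_unique
       fundamental_theorem_of_calculus[of 0 1 "\<lambda>z. (1 - cos (z * x)) / x", simplified]
       derivative_eq_intros simp: has_real_derivative_iff_has_vector_derivative[symmetric])

lemma abs_integral_mu0_le:
  fixes f :: "real \<Rightarrow> real"
  assumes "\<And>z. \<bar>f z\<bar> \<le> 1"
  shows "\<bar>\<integral>z. f z \<partial>mu 0\<bar> \<le> 1"
proof -
  have "\<bar>\<integral>z. f z \<partial>mu 0\<bar> \<le> (\<integral>z. 1 \<partial>mu 0)"
    by (rule order_trans[OF integral_abs_bound integral_mono']) (use assms in auto)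
  then show ?thesis by (simp add: measure_mu0)
qed

lemma unit_trig_le:
  "\<bar>unit_cos x\<bar> \<le> 2 * min 1 (1 / \<bar>x\<bar>)" "\<bar>unit_sin x\<bar> \<le> 2 * min 1 (1 / \<bar>x\<bar>)" if "x \<noteq> 0"
proof -
  have "\<bar>unit_cos x\<bar> \<le> 1" "\<bar>unit_sin x\<bar> \<le> 1"
    unfolding unit_cos_def unit_sin_def by (auto intro!: abs_integral_mu0_le)
  moreover have "\<bar>unit_cos x\<bar> \<le> 2 / \<bar>x\<bar>"
    unfolding unit_cos_eq[OF that] abs_divide
    using abs_sin_le_one[of x] by (intro divide_right_mono) (linarith, simp)
  moreover have "\<bar>unit_sin x\<bar> \<le> 2 / \<bar>x\<bar>"
    unfolding unit_sin_eq[OF that] abs_divide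
    using abs_cos_le_one[of x] by (intro divide_right_mono) (linarith, simp)
  ultimately show "\<bar>unit_cos x\<bar> \<le> 2 * min 1 (1 / \<bar>x\<bar>)" "\<bar>unit_sin x\<bar> \<le> 2 * min 1 (1 / \<bar>x\<bar>)"
    by (auto simp: min_def)
qed

text \<open>The transform of the interval decays like 1/|x|. Against the weight this gives exponent
  \<open>\<alpha> - 1\<close> near 0 and \<open>\<alpha> - 2\<close> at infinity, both integrable;
  hence the test function can be treated with the full weight.\<close>

lemma weight_decay_integrable:
  fixes \<alpha> :: real
  assumes \<alpha>: "0 < \<alpha>" "\<alpha> < 1"
  shows "integrable lborel (\<lambda>x. \<bar>x\<bar> powr (\<alpha> - 1) * min 1 (1 / \<bar>x\<bar>))"
proof -
  have "integrable lborel (\<lambda>x. indicator {0..1} x * x powr (\<alpha> - 1))"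
    using has_bochner_integral_powr_unit[of "\<alpha> - 1"] \<alpha> by (simp add: has_bochner_integral_iff)
  moreover have "integrable lborel (\<lambda>x. indicator {1..} x * x powr (\<alpha> - 2))"
  proof -
    have "((\<lambda>x. x powr (\<alpha> - 2)) has_integral - (1 powr (\<alpha> - 2 + 1)) / (\<alpha> - 2 + 1)) {1..}"
      by (rule has_integral_powr_to_inf) (use \<alpha> in auto)
    from has_bochner_integral_nonneg_has_integral[OF _ _ _ this]
    show ?thesis by (simp add: has_bochner_integral_iff)
  qed
  ultimately have half: "integrable lborel (\<lambda>x. indicator {0..1} x * x powr (\<alpha> - 1) + indicator {1..} x * x powr (\<alpha> - 2))"
    by (rule Bochner_Integration.integrable_add)
  then have "integrable lborel (\<lambda>x. (indicator {0..1} x * x powr (\<alpha> - 1) + indicator {1..} x * x powr (\<alpha> - 2))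
     + (indicator {0..1} (- x) * (- x) powr (\<alpha> - 1) + indicator {1..} (- x) * (- x) powr (\<alpha> - 2)))"
    using lborel_integrable_real_affine[OF half, of "-1" 0] by simp
  then show ?thesis
  proof (rule Bochner_Integration.integrable_bound)
    have key: "\<bar>x\<bar> powr (\<alpha> - 1) * min 1 (1 / \<bar>x\<bar>) \<le> indicator {0..1} \<bar>x\<bar> * \<bar>x\<bar> powr (\<alpha> - 1) + indicator {1..} \<bar>x\<bar> * \<bar>x\<bar> powr (\<alpha> - 2)"
      for x :: real
    proof (cases "\<bar>x\<bar> \<le> 1")
      case True
      then have "\<bar>x\<bar> powr (\<alpha> - 1) * min 1 (1 / \<bar>x\<bar>) \<le> \<bar>x\<bar> powr (\<alpha> - 1)"
        by (intro mult_left_le) auto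
      with True show ?thesis by (auto simp: indicator_def)
    next
      case False
      have "\<bar>x\<bar> powr (\<alpha> - 2) = \<bar>x\<bar> powr ((\<alpha> - 1) - 1)" by simp
      also have "\<dots> = \<bar>x\<bar> powr (\<alpha> - 1) / \<bar>x\<bar>"
        using False by (subst powr_diff) auto
      finally have "\<bar>x\<bar> powr (\<alpha> - 2) = \<bar>x\<bar> powr (\<alpha> - 1) / \<bar>x\<bar>" .
      moreover have "min 1 (1 / \<bar>x\<bar>) \<le> 1 / \<bar>x\<bar>" by simp
      then have "\<bar>x\<bar> powr (\<alpha> - 1) * min 1 (1 / \<bar>x\<bar>) \<le> \<bar>x\<bar> powr (\<alpha> - 1) * (1 / \<bar>x\<bar>)"
        by (intro mult_left_mono) auto
      ultimately show ?thesis using False by (simp add: indicator_def)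
    qed
    show "AE x in lborel. norm (\<bar>x\<bar> powr (\<alpha> - 1) * min 1 (1 / \<bar>x\<bar>)) \<le>
       norm ((indicator {0..1} x * x powr (\<alpha> - 1) + indicator {1..} x * x powr (\<alpha> - 2))
     + (indicator {0..1} (- x) * (- x) powr (\<alpha> - 1) + indicator {1..} (- x) * (- x) powr (\<alpha> - 2)))"
    proof (rule AE_I2)
      fix x :: real
      have nn: "0 \<le> indicator {0..1} y * y powr (\<alpha> - 1) + indicator {1..} y * y powr (\<alpha> - 2)" for y :: real
        by simp
      have "norm (\<bar>x\<bar> powr (\<alpha> - 1) * min 1 (1 / \<bar>x\<bar>)) = \<bar>x\<bar> powr (\<alpha> - 1) * min 1 (1 / \<bar>x\<bar>)"
        by simp
      also note key[of x]
      also have "indicator {0..1} \<bar>x\<bar> * \<bar>x\<bar> powr (\<alpha> - 1) + indicator {1..} \<bar>x\<bar> * \<bar>x\<bar> powr (\<alpha> - 2)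
        \<le> (indicator {0..1} x * x powr (\<alpha> - 1) + indicator {1..} x * x powr (\<alpha> - 2))
        + (indicator {0..1} (- x) * (- x) powr (\<alpha> - 1) + indicator {1..} (- x) * (- x) powr (\<alpha> - 2))"
        using nn[of x] nn[of "- x"] by (cases "x \<ge> 0") (simp_all add: abs_if)
      also have "\<dots> \<le> norm \<dots>" by simp
      finally show "norm (\<bar>x\<bar> powr (\<alpha> - 1) * min 1 (1 / \<bar>x\<bar>)) \<le>
         norm ((indicator {0..1} x * x powr (\<alpha> - 1) + indicator {1..} x * x powr (\<alpha> - 2))
       + (indicator {0..1} (- x) * (- x) powr (\<alpha> - 1) + indicator {1..} (- x) * (- x) powr (\<alpha> - 2)))" .
    qed
  qed measurable
qed

text \<open>By the subtraction formula, the average of cos((y - z)x) over z in [0, 1]. Integrated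
  against the weight it becomes the Riesz potential of the interval at y.\<close>

definition unit_cos2 :: "real \<Rightarrow> real \<Rightarrow> real" where
  "unit_cos2 y x = unit_cos x * cos (y * x) + unit_sin x * sin (y * x)"

lemma unit_cos2_measurable [measurable]:
  "(\<lambda>p. unit_cos2 (fst p) (snd p)) \<in> borel_measurable (borel \<Otimes>\<^sub>M borel)"
  unfolding unit_cos2_def by measurable

lemma unit_cos2_measurable' [measurable]: "unit_cos2 y \<in> borel_measurable borel"
  unfolding unit_cos2_def by measurable

lemma mu0_integrable_trig: "integrable (mu 0) (\<lambda>z. cos (z * x))" "integrable (mu 0) (\<lambda>z. sin (z * x))"
  by (auto intro!: mu0.integrable_const_bound[where B = 1])

lemma unit_cos2_eq: "unit_cos2 y x = (\<integral>z. cos ((y - z) * x) \<partial>mu 0)"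
proof -
  have "(\<lambda>z. cos ((y - z) * x)) = (\<lambda>z. cos (z * x) * cos (y * x) + sin (z * x) * sin (y * x))"
    by (rule ext)
      (simp only: left_diff_distrib cos_diff mult.commute[of "cos (y * x)"] mult.commute[of "sin (y * x)"])
  then show ?thesis
    using mu0_integrable_trig[of x] by (simp add: unit_cos2_def unit_cos_def unit_sin_def)
qed

lemma unit_cos2_le:
  assumes "x \<noteq> 0"
  shows "\<bar>unit_cos2 y x\<bar> \<le> 4 * min 1 (1 / \<bar>x\<bar>)"
proof -
  have "\<bar>unit_cos x * cos (y * x)\<bar> \<le> 2 * min 1 (1 / \<bar>x\<bar>) * 1"
    unfolding abs_mult by (intro mult_mono unit_trig_le[OF assms]) auto
  moreover have "\<bar>unit_sin x * sin (y * x)\<bar> \<le> 2 * min 1 (1 / \<bar>x\<bar>) * 1"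
    unfolding abs_mult by (intro mult_mono unit_trig_le[OF assms]) auto
  ultimately show ?thesis unfolding unit_cos2_def by linarith
qed

section \<open>The Riesz potential of the unit interval\<close>

context
  fixes \<alpha> :: real
  assumes \<alpha>: "0 < \<alpha>" "\<alpha> < 1"
begin

lemma weight_unit_cos2_le: "\<bar>\<bar>x\<bar> powr (\<alpha> - 1) * unit_cos2 y x\<bar> \<le> 4 * (\<bar>x\<bar> powr (\<alpha> - 1) * min 1 (1 / \<bar>x\<bar>))"
proof (cases "x = 0")
  case False
  then have "\<bar>x\<bar> powr (\<alpha> - 1) * \<bar>unit_cos2 y x\<bar> \<le> \<bar>x\<bar> powr (\<alpha> - 1) * (4 * min 1 (1 / \<bar>x\<bar>))"
    by (intro mult_left_mono unit_cos2_le) auto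
  then show ?thesis by (simp add: abs_mult mult_ac)
qed simp

text \<open>The interval is split at the singularity z = y. The resulting sum of two powers is what
  the binomial theorem later expands into the Beta values of \<open>L_const\<close>.\<close>

lemma has_bochner_integral_rieszK_mu0:
  assumes y: "0 < y" "y < 1"
  shows "has_bochner_integral (mu 0) (\<lambda>z. rieszK \<alpha> (y - z))
    (c_alpha \<alpha> / (1 - \<alpha>) * (y powr (1 - \<alpha>) + (1 - y) powr (1 - \<alpha>)))"
proof -
  have half: "has_bochner_integral lborel (\<lambda>t. indicator {0..c} t * t powr (- \<alpha>)) (c powr (1 - \<alpha>) / (1 - \<alpha>))"
    if "c \<ge> 0" for c
  proof -
    have "((\<lambda>t. t powr (- \<alpha>)) has_integral (c powr (- \<alpha> + 1) / (- \<alpha> + 1))) {0..c}"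
      by (rule has_integral_powr_from_0) (use \<alpha> that in auto)
    from has_bochner_integral_nonneg_has_integral[OF _ _ _ this] show ?thesis by (simp add: add.commute)
  qed
  have left: "has_bochner_integral lborel (\<lambda>z. indicator {0..y} (y + - 1 * z) * (y + - 1 * z) powr (- \<alpha>))
      (y powr (1 - \<alpha>) / (1 - \<alpha>))"
    using iffD1[OF lborel_has_bochner_integral_real_affine_iff[where c = "- 1" and t = y] half[of y]] y by simp
  have right: "has_bochner_integral lborel (\<lambda>z. indicator {0..1 - y} (- y + 1 * z) * (- y + 1 * z) powr (- \<alpha>))
      ((1 - y) powr (1 - \<alpha>) / (1 - \<alpha>))"
    using iffD1[OF lborel_has_bochner_integral_real_affine_iff[where c = 1 and t = "- y"] half[of "1 - y"]] y by simp
  have "has_bochner_integral lborel (\<lambda>z. c_alpha \<alpha> * (indicator {0..y} (y + - 1 * z) * (y + - 1 * z) powr (- \<alpha>)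
      + indicator {0..1 - y} (- y + 1 * z) * (- y + 1 * z) powr (- \<alpha>)))
      (c_alpha \<alpha> * (y powr (1 - \<alpha>) / (1 - \<alpha>) + (1 - y) powr (1 - \<alpha>) / (1 - \<alpha>)))"
    by (intro has_bochner_integral_mult_right has_bochner_integral_add left right)
  also have "c_alpha \<alpha> * (y powr (1 - \<alpha>) / (1 - \<alpha>) + (1 - y) powr (1 - \<alpha>) / (1 - \<alpha>)) =
      c_alpha \<alpha> / (1 - \<alpha>) * (y powr (1 - \<alpha>) + (1 - y) powr (1 - \<alpha>))"
    by (simp add: add_divide_distrib[symmetric])
  finally have hb: "has_bochner_integral lborel (\<lambda>z. c_alpha \<alpha> * (indicator {0..y} (y + - 1 * z) * (y + - 1 * z) powr (- \<alpha>)
      + indicator {0..1 - y} (- y + 1 * z) * (- y + 1 * z) powr (- \<alpha>)))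
      (c_alpha \<alpha> / (1 - \<alpha>) * (y powr (1 - \<alpha>) + (1 - y) powr (1 - \<alpha>)))" .
  show ?thesis
    unfolding mu_def
  proof (rule has_bochner_integral_density)
    show "has_bochner_integral lborel (\<lambda>z. (indicator {0..1} z * z powr (- 0)) *\<^sub>R rieszK \<alpha> (y - z))
      (c_alpha \<alpha> / (1 - \<alpha>) * (y powr (1 - \<alpha>) + (1 - y) powr (1 - \<alpha>)))"
    proof (rule has_bochner_integralI_AE[OF hb])
      show "AE z in lborel. c_alpha \<alpha> * (indicator {0..y} (y + - 1 * z) * (y + - 1 * z) powr (- \<alpha>)
          + indicator {0..1 - y} (- y + 1 * z) * (- y + 1 * z) powr (- \<alpha>)) =
          (indicator {0..1} z * z powr (- 0)) *\<^sub>R rieszK \<alpha> (y - z)"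
        using AE_lborel_singleton[of "0::real"] AE_lborel_singleton[of y]
      proof eventually_elim
        case (elim z)
        then show ?case
          using y by (cases "z < y") (auto simp: rieszK_def indicator_def)
      qed
    qed measurable
  qed auto
qed

lemma cut_unit_cos2:
  assumes r: "r > 0"
  shows "(\<integral>x. wcut \<alpha> r x * unit_cos2 y x \<partial>lborel) = (\<integral>z. Kcut \<alpha> r (y - z) \<partial>mu 0)"
proof -
  interpret P: pair_sigma_finite "mu 0" "lborel :: real measure" ..
  have int: "integrable (mu 0 \<Otimes>\<^sub>M lborel) (\<lambda>(z, x). wcut \<alpha> r x * cos ((y - z) * x))"
  proof (rule P.Fubini_integrable)
    have hb: "integrable lborel (\<lambda>x. wcut \<alpha> r x * cos ((y - z) * x))" for z
      using wcut_cos[OF \<alpha> r] by (simp add: has_bochner_integral_iff)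
    then show "AE z in mu 0. integrable lborel (\<lambda>x. case (z, x) of (z, x) \<Rightarrow> wcut \<alpha> r x * cos ((y - z) * x))"
      by simp
    show "integrable (mu 0) (\<lambda>z. \<integral>x. norm (case (z, x) of (z, x) \<Rightarrow> wcut \<alpha> r x * cos ((y - z) * x)) \<partial>lborel)"
    proof (rule mu0.integrable_const_bound[where B = "\<integral>x. wcut \<alpha> r x \<partial>lborel"])
      have "(\<integral>x. \<bar>wcut \<alpha> r x * cos ((y - z) * x)\<bar> \<partial>lborel) \<le> (\<integral>x. wcut \<alpha> r x \<partial>lborel)" for z
        using wcut_nonneg[OF \<alpha>]
        by (intro integral_mono'[OF wcut_integrable[OF \<alpha> r]]) (auto simp: abs_mult mult_left_le)
      then show "AE z in mu 0. norm (\<integral>x. norm (case (z, x) of (z, x) \<Rightarrow> wcut \<alpha> r x * cos ((y - z) * x)) \<partial>lborel) \<le> (\<integral>x. wcut \<alpha> r x \<partial>lborel)"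
        by simp
    qed measurable
  qed measurable
  have "(\<integral>x. wcut \<alpha> r x * unit_cos2 y x \<partial>lborel) = (\<integral>x. (\<integral>z. wcut \<alpha> r x * cos ((y - z) * x) \<partial>mu 0) \<partial>lborel)"
    unfolding unit_cos2_eq by simp
  also have "\<dots> = (\<integral>z. (\<integral>x. wcut \<alpha> r x * cos ((y - z) * x) \<partial>lborel) \<partial>mu 0)"
    by (rule P.Fubini_integral[OF int])
  also have "\<dots> = (\<integral>z. Kcut \<alpha> r (y - z) \<partial>mu 0)"
    unfolding has_bochner_integral_integral_eq[OF wcut_cos[OF \<alpha> r]] ..
  finally show ?thesis .
qed

text \<open>Both sides are limits of the truncated identity \<open>cut_unit_cos2\<close>. In x the
  dominating function comes from the decay of the interval's transform, in z it is the Riesz kernel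
  itself.\<close>

lemma weight_unit_cos2_integral:
  assumes y: "0 < y" "y < 1"
  shows "(\<integral>x. \<bar>x\<bar> powr (\<alpha> - 1) * unit_cos2 y x \<partial>lborel) =
    c_alpha \<alpha> / (1 - \<alpha>) * (y powr (1 - \<alpha>) + (1 - y) powr (1 - \<alpha>))"
proof -
  define r where "r = (\<lambda>n. inverse (real (Suc n)))"
  have r: "r n > 0" for n by (simp add: r_def)
  have "(\<lambda>n. \<integral>x. wcut \<alpha> (r n) x * unit_cos2 y x \<partial>lborel) \<longlonglongrightarrow> (\<integral>x. \<bar>x\<bar> powr (\<alpha> - 1) * unit_cos2 y x \<partial>lborel)"
  proof (rule integral_dominated_convergence)
    show "integrable lborel (\<lambda>x. 4 * (\<bar>x\<bar> powr (\<alpha> - 1) * min 1 (1 / \<bar>x\<bar>)))"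
      using weight_decay_integrable[OF \<alpha>] by simp
    show "AE x in lborel. (\<lambda>n. wcut \<alpha> (r n) x * unit_cos2 y x) \<longlonglongrightarrow> \<bar>x\<bar> powr (\<alpha> - 1) * unit_cos2 y x"
      using AE_lborel_singleton[of "0::real"] unfolding r_def
      by eventually_elim (intro tendsto_intros wcut_tendsto[OF \<alpha>])
    show "AE x in lborel. norm (wcut \<alpha> (r n) x * unit_cos2 y x) \<le> 4 * (\<bar>x\<bar> powr (\<alpha> - 1) * min 1 (1 / \<bar>x\<bar>))" for n
      using AE_lborel_singleton[of "0::real"]
    proof eventually_elim
      case (elim x)
      have "norm (wcut \<alpha> (r n) x * unit_cos2 y x) \<le> \<bar>\<bar>x\<bar> powr (\<alpha> - 1) * unit_cos2 y x\<bar>"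
        using wcut_nonneg[OF \<alpha>] wcut_le[OF \<alpha> less_imp_le[OF r] elim]
        by (auto simp: abs_mult intro!: mult_right_mono)
      also note weight_unit_cos2_le
      finally show ?case .
    qed
  qed measurable
  moreover have "(\<lambda>n. \<integral>z. Kcut \<alpha> (r n) (y - z) \<partial>mu 0) \<longlonglongrightarrow> (\<integral>z. rieszK \<alpha> (y - z) \<partial>mu 0)"
  proof (rule integral_dominated_convergence)
    show "integrable (mu 0) (\<lambda>z. rieszK \<alpha> (y - z))"
      using has_bochner_integral_rieszK_mu0[OF y] by (simp add: has_bochner_integral_iff)
    show "AE z in mu 0. (\<lambda>n. Kcut \<alpha> (r n) (y - z)) \<longlonglongrightarrow> rieszK \<alpha> (y - z)"
      using AE_mu_neq[of y 0] unfolding r_def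
      by eventually_elim (intro Kcut_tendsto[OF \<alpha>], simp)
    show "AE z in mu 0. norm (Kcut \<alpha> (r n) (y - z)) \<le> rieszK \<alpha> (y - z)" for n
      using AE_mu_neq[of y 0] by eventually_elim (use Kcut_nonneg[OF \<alpha>] Kcut_le[OF \<alpha> r] in simp)
  qed measurable
  ultimately have "(\<integral>x. \<bar>x\<bar> powr (\<alpha> - 1) * unit_cos2 y x \<partial>lborel) = (\<integral>z. rieszK \<alpha> (y - z) \<partial>mu 0)"
    unfolding cut_unit_cos2[OF r] by (rule LIMSEQ_unique)
  also have "\<dots> = c_alpha \<alpha> / (1 - \<alpha>) * (y powr (1 - \<alpha>) + (1 - y) powr (1 - \<alpha>))"
    by (rule has_bochner_integral_integral_eq[OF has_bochner_integral_rieszK_mu0[OF y]])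
  finally show ?thesis .
qed

end

section \<open>Beta moments and the Riesz energy of the interval\<close>

lemma Beta_1_left:
  fixes b :: real
  assumes "b > 0"
  shows "Beta 1 b = 1 / b"
proof -
  have "Gamma b \<noteq> 0" using Gamma_real_pos[OF assms] by linarith
  moreover have "Gamma (1 + b) = b * Gamma b"
    using assms Gamma_plus1[of b] by (simp add: add.commute nonpos_Ints_def)
  ultimately show ?thesis by (simp add: Beta_def)
qed

lemma has_bochner_integral_mu_Beta:
  assumes "d < 1" "a > -1 + d" "b > -1"
  shows "has_bochner_integral (mu d) (\<lambda>y. y powr a * (1 - y) powr b) (Beta (1 - d + a) (1 + b))"
  unfolding mu_def
proof (rule has_bochner_integral_density)
  have "((\<lambda>t. t powr (1 - d + a - 1) * (1 - t) powr (1 + b - 1)) has_integral Beta (1 - d + a) (1 + b)) {0..1}"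
    by (rule has_integral_Beta_real) (use assms in auto)
  from has_bochner_integral_nonneg_has_integral[OF _ _ _ this]
  have hb: "has_bochner_integral lborel (\<lambda>t. indicator {0..1} t * (t powr (1 - d + a - 1) * (1 - t) powr (1 + b - 1)))
      (Beta (1 - d + a) (1 + b))"
    by simp
  have "(\<lambda>y. (indicator {0..1} y * y powr (- d)) *\<^sub>R (y powr a * (1 - y) powr b)) =
      (\<lambda>t. indicator {0..1} t * (t powr (1 - d + a - 1) * (1 - t) powr (1 + b - 1)))"
  proof
    fix y :: real
    have "1 - d + a - 1 = - d + a" by simp
    then have "y powr (1 - d + a - 1) = y powr (- d) * y powr a" by (simp only: powr_add)
    then show "(indicator {0..1} y * y powr (- d)) *\<^sub>R (y powr a * (1 - y) powr b) =
      indicator {0..1} y * (y powr (1 - d + a - 1) * (1 - y) powr (1 + b - 1))"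
      by (simp add: mult.assoc)
  qed
  with hb show "has_bochner_integral lborel (\<lambda>y. (indicator {0..1} y * y powr (- d)) *\<^sub>R (y powr a * (1 - y) powr b))
      (Beta (1 - d + a) (1 + b))"
    by simp
qed auto

lemma integral_binomial_Beta:
  fixes d s :: real
  assumes d: "d < 1" and s: "s > 0"
  shows "(\<integral>y. (y powr s + (1 - y) powr s) ^ m \<partial>mu d) =
    (\<Sum>k\<le>m. real (m choose k) * Beta (1 - d + s * real k) (1 + s * (real m - real k)))"
proof -
  have hb: "has_bochner_integral (mu d) (\<lambda>y. y powr (s * real k) * (1 - y) powr (s * (real m - real k)))
      (Beta (1 - d + s * real k) (1 + s * (real m - real k)))" if "k \<le> m" for k
  proof (rule has_bochner_integral_mu_Beta[OF d])
    have "0 \<le> s * real k" "0 \<le> s * (real m - real k)" using s that by simp_all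
    then show "- 1 + d < s * real k" "- 1 < s * (real m - real k)" using d by linarith+
  qed
  have "(\<integral>y. (y powr s + (1 - y) powr s) ^ m \<partial>mu d) =
      (\<integral>y. (\<Sum>k\<le>m. real (m choose k) * (y powr (s * real k) * (1 - y) powr (s * (real m - real k)))) \<partial>mu d)"
  proof (rule integral_cong_AE)
    show "AE y in mu d. (y powr s + (1 - y) powr s) ^ m =
        (\<Sum>k\<le>m. real (m choose k) * (y powr (s * real k) * (1 - y) powr (s * (real m - real k))))"
      using AE_mu_unit[of d]
    proof eventually_elim
      case (elim y)
      have "(t powr s) ^ n = t powr (s * real n)" if "t > 0" for t :: real and n
        using that by (simp add: powr_realpow[symmetric] powr_powr)
      then show ?case
        unfolding binomial_ring using elim
        by (intro sum.cong) (auto simp: of_nat_diff)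
    qed
  qed measurable
  also have "\<dots> = (\<Sum>k\<le>m. real (m choose k) * Beta (1 - d + s * real k) (1 + s * (real m - real k)))"
    using hb by (subst Bochner_Integration.integral_sum) (auto simp: has_bochner_integral_iff)
  finally show ?thesis .
qed

context
  fixes \<alpha> :: real
  assumes \<alpha>: "0 < \<alpha>" "\<alpha> < 1"
begin

text \<open>Averaging \<open>unit_cos2 y x\<close> over y in [0, 1] gives the sum of the two
  squares, so the integral is the Riesz energy of the interval. Its value is the case d = 0, b =
  \<alpha> of the energy formula, where \<open>Beta 1 (1 - \<alpha>)\<close> supplies the factor
  \<open>1 / (1 - \<alpha>)\<close>.\<close>

lemma unit_trig_energy:
  "has_bochner_integral lborel (\<lambda>x. \<bar>x\<bar> powr (\<alpha> - 1) * ((unit_cos x)\<^sup>2 + (unit_sin x)\<^sup>2))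
    (2 * c_alpha \<alpha> / ((1 - \<alpha>) * (2 - \<alpha>)))"
proof -
  interpret P: pair_sigma_finite "mu 0" "lborel :: real measure" ..
  interpret MM: pair_sigma_finite "mu 0" "mu 0" ..
  have int: "integrable (mu 0 \<Otimes>\<^sub>M lborel) (\<lambda>(y, x). \<bar>x\<bar> powr (\<alpha> - 1) * unit_cos2 y x)"
  proof (rule Bochner_Integration.integrable_bound)
    show "integrable (mu 0 \<Otimes>\<^sub>M lborel) (\<lambda>(y, x). 4 * (\<bar>x\<bar> powr (\<alpha> - 1) * min 1 (1 / \<bar>x\<bar>)))"
      by (rule P.Fubini_integrable) (use weight_decay_integrable[OF \<alpha>] in auto)
    show "AE p in mu 0 \<Otimes>\<^sub>M lborel. norm (case p of (y, x) \<Rightarrow> \<bar>x\<bar> powr (\<alpha> - 1) * unit_cos2 y x)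
       \<le> norm (case p of (y, x) \<Rightarrow> 4 * (\<bar>x\<bar> powr (\<alpha> - 1) * min 1 (1 / \<bar>x\<bar>)))"
    proof (intro AE_I2, clarify)
      fix y x :: real
      show "norm (\<bar>x\<bar> powr (\<alpha> - 1) * unit_cos2 y x) \<le> norm (4 * (\<bar>x\<bar> powr (\<alpha> - 1) * min 1 (1 / \<bar>x\<bar>)))"
        using order_trans[OF weight_unit_cos2_le[OF \<alpha>] abs_ge_self, of x y] by (simp only: real_norm_def)
    qed
  qed measurable
  have eq: "\<bar>x\<bar> powr (\<alpha> - 1) * ((unit_cos x)\<^sup>2 + (unit_sin x)\<^sup>2) = (\<integral>y. \<bar>x\<bar> powr (\<alpha> - 1) * unit_cos2 y x \<partial>mu 0)" for x
    using mu0_integrable_trig[of x]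
    by (simp add: unit_cos2_def power2_eq_square unit_cos_def unit_sin_def)
  have "(\<integral>x. \<bar>x\<bar> powr (\<alpha> - 1) * ((unit_cos x)\<^sup>2 + (unit_sin x)\<^sup>2) \<partial>lborel)
      = (\<integral>y. (\<integral>x. \<bar>x\<bar> powr (\<alpha> - 1) * unit_cos2 y x \<partial>lborel) \<partial>mu 0)"
    unfolding eq by (rule P.Fubini_integral[OF int])
  also have "\<dots> = (\<integral>y. (\<integral>z. rieszK \<alpha> (y - z) \<partial>mu 0) \<partial>mu 0)"
  proof (rule integral_cong_AE)
    show "AE y in mu 0. (\<integral>x. \<bar>x\<bar> powr (\<alpha> - 1) * unit_cos2 y x \<partial>lborel) = (\<integral>z. rieszK \<alpha> (y - z) \<partial>mu 0)"
      using AE_mu_unit[of 0]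
    proof eventually_elim
      case (elim y)
      then have y: "0 < y" "y < 1" by auto
      show ?case
        unfolding weight_unit_cos2_integral[OF \<alpha> y]
        by (rule has_bochner_integral_integral_eq[OF has_bochner_integral_rieszK_mu0[OF \<alpha> y], symmetric])
    qed
    show "(\<lambda>y. \<integral>z. rieszK \<alpha> (y - z) \<partial>mu 0) \<in> borel_measurable (mu 0)"
      by (rule mu0.borel_measurable_lebesgue_integral) measurable
  qed measurable
  also have "\<dots> = c_alpha \<alpha> * (2 * Beta (1 - 0) (1 - \<alpha>) / (2 - 2 * 0 - \<alpha>))"
  proof -
    have "has_bochner_integral (mu 0 \<Otimes>\<^sub>M mu 0) (\<lambda>p. c_alpha \<alpha> * \<bar>fst p - snd p\<bar> powr (- \<alpha>))
        (c_alpha \<alpha> * (2 * Beta (1 - 0) (1 - \<alpha>) / (2 - 2 * 0 - \<alpha>)))"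
      by (intro has_bochner_integral_mult_right has_bochner_integral_riesz_energy) (use \<alpha> in auto)
    then have hb: "has_bochner_integral (mu 0 \<Otimes>\<^sub>M mu 0) (\<lambda>p. rieszK \<alpha> (fst p - snd p))
        (c_alpha \<alpha> * (2 * Beta (1 - 0) (1 - \<alpha>) / (2 - 2 * 0 - \<alpha>)))"
      by (simp only: rieszK_def)
    have "integrable (mu 0 \<Otimes>\<^sub>M mu 0) (\<lambda>p. rieszK \<alpha> (fst p - snd p))"
      using hb by (simp only: has_bochner_integral_iff)
    from MM.integral_fst'[OF this]
    show ?thesis using has_bochner_integral_integral_eq[OF hb] by (simp only: fst_conv snd_conv)
  qed
  finally have "(\<integral>x. \<bar>x\<bar> powr (\<alpha> - 1) * ((unit_cos x)\<^sup>2 + (unit_sin x)\<^sup>2) \<partial>lborel)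
     = 2 * c_alpha \<alpha> / ((1 - \<alpha>) * (2 - \<alpha>))"
    using \<alpha> Beta_1_left[of "1 - \<alpha>"] by (simp add: field_simps)
  moreover have "integrable lborel (\<lambda>x. \<bar>x\<bar> powr (\<alpha> - 1) * ((unit_cos x)\<^sup>2 + (unit_sin x)\<^sup>2))"
    unfolding eq by (rule P.integrable_snd[OF int])
  ultimately show ?thesis by (simp add: has_bochner_integral_iff)
qed

end

lemma unit_cos_minus: "unit_cos (- x) = unit_cos x"
  by (simp add: unit_cos_def)

lemma unit_sin_minus: "unit_sin (- x) = - unit_sin x"
  by (simp add: unit_sin_def)

section \<open>The test function and its pairing\<close>

context riesz_params
begin

text \<open>The root of the Riesz energy of the interval, which is the norm of the test function
  before normalisation.\<close>

definition norm_const :: real where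
  "norm_const = sqrt (2 * c_alpha \<alpha> / ((1 - \<alpha>) * (2 - \<alpha>)))"

lemma norm_const_pos: "norm_const > 0"
  using c_alpha_pos[OF \<alpha>] \<alpha> by (simp add: norm_const_def)

text \<open>
  The normalized image of the indicator of \<open>[0, 1]\<close> under the adjoint of \<open>\<xi> \<mapsto> g\<close>, where \<open>g\<close> is the
  Fourier transform of \<open>\<bar>x\<bar> powr ((\<alpha> - 1) / 2) * cnj (\<xi> x)\<close>.
\<close>

definition test_fun :: "real \<Rightarrow> complex" where
  "test_fun x = complex_of_real (\<bar>x\<bar> powr ((\<alpha> - 1) / 2) / norm_const) * Complex (unit_cos x) (unit_sin x)"

lemma Complex_measurable:
  assumes [measurable]: "f \<in> borel_measurable M" "g \<in> borel_measurable M"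
  shows "(\<lambda>x. Complex (f x) (g x)) \<in> borel_measurable M"
proof -
  have "(\<lambda>x. Complex (f x) (g x)) = (\<lambda>x. complex_of_real (f x) + \<i> * complex_of_real (g x))"
    by (simp add: Complex_eq)
  then show ?thesis by simp
qed

lemma weight_sq: "(\<bar>x\<bar> powr ((\<alpha> - 1) / 2))\<^sup>2 = \<bar>x\<bar> powr (\<alpha> - 1)"
  by (simp add: powr_half_eq_sqrt)

lemma test_fun_measurable [measurable]: "test_fun \<in> borel_measurable borel"
  unfolding test_fun_def by (intro borel_measurable_times Complex_measurable) measurable

lemma test_fun_sq: "(cmod (test_fun x))\<^sup>2 =
    \<bar>x\<bar> powr (\<alpha> - 1) * ((unit_cos x)\<^sup>2 + (unit_sin x)\<^sup>2) / norm_const\<^sup>2"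
  unfolding test_fun_def norm_mult power_mult_distrib cmod_power2[of "Complex _ _"] complex.sel norm_of_real
    power2_abs power_divide weight_sq by simp

lemma test_fun_norm: "has_bochner_integral lborel (\<lambda>x. (cmod (test_fun x))\<^sup>2) 1"
proof -
  have "has_bochner_integral lborel (\<lambda>x. \<bar>x\<bar> powr (\<alpha> - 1) * ((unit_cos x)\<^sup>2 + (unit_sin x)\<^sup>2) / norm_const\<^sup>2)
     (2 * c_alpha \<alpha> / ((1 - \<alpha>) * (2 - \<alpha>)) / norm_const\<^sup>2)"
    by (rule has_bochner_integral_divide_zero) (rule unit_trig_energy[OF \<alpha>])
  also have "norm_const\<^sup>2 = 2 * c_alpha \<alpha> / ((1 - \<alpha>) * (2 - \<alpha>))"
    using c_alpha_pos[OF \<alpha>] \<alpha> by (simp add: norm_const_def)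
  finally show ?thesis
    unfolding test_fun_sq using norm_const_pos c_alpha_pos[OF \<alpha>] \<alpha> by (simp add: norm_const_def)
qed

lemma test_fun_hermitian: "test_fun \<in> hermitian_L2"
  unfolding hermitian_L2_def using test_fun_norm
  by (auto simp: has_bochner_integral_iff test_fun_def unit_cos_minus unit_sin_minus complex_cnj)

lemma herm_norm_test_fun: "herm_norm test_fun = 1"
proof -
  note h = hermitian_L2D[OF test_fun_hermitian]
  have "(\<integral>x. (Re (test_fun x))\<^sup>2 \<partial>lborel) + (\<integral>x. (Im (test_fun x))\<^sup>2 \<partial>lborel) = (\<integral>x. (cmod (test_fun x))\<^sup>2 \<partial>lborel)"
    unfolding cmod_power2 using h(4,5) by simp
  also have "\<dots> = 1" using test_fun_norm by (simp add: has_bochner_integral_iff)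
  finally show ?thesis by (simp add: h(6))
qed

text \<open>The half weight of the kernel and the half weight inside \<open>test_fun\<close>
  multiply to the full weight, and conjugation makes the sine terms add. What remains is the
  integral of \<open>unit_cos2\<close>, known for interior y, hence for almost every y under
  \<open>mu d\<close>.\<close>

lemma fourier_test_fun:
  defines "\<eta> \<equiv> \<lambda>x. complex_of_real (\<bar>x\<bar> powr ((\<alpha> - 1) / 2)) * cnj (test_fun x)"
  shows "integrable lborel \<eta>"
    and "0 < y \<Longrightarrow> y < 1 \<Longrightarrow> fourier_at \<eta> y =
      complex_of_real (c_alpha \<alpha> / (1 - \<alpha>) / norm_const * (y powr (1 - \<alpha>) + (1 - y) powr (1 - \<alpha>)))"
proof -
  let ?w = "\<lambda>x::real. \<bar>x\<bar> powr (\<alpha> - 1)"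
  have \<eta>_eq: "\<eta> x = complex_of_real (?w x / norm_const) * Complex (unit_cos x) (- unit_sin x)" for x
    unfolding \<eta>_def test_fun_def weight_sq[symmetric]
    by (simp add: power2_eq_square complex_cnj mult_ac)
  have [measurable]: "\<eta> \<in> borel_measurable borel"
    unfolding \<eta>_def by measurable
  have trig: "\<bar>?w x * unit_cos x\<bar> \<le> 2 * (?w x * min 1 (1 / \<bar>x\<bar>))"
    "\<bar>?w x * unit_sin x\<bar> \<le> 2 * (?w x * min 1 (1 / \<bar>x\<bar>))" for x
  proof -
    have "?w x * \<bar>unit_cos x\<bar> \<le> ?w x * (2 * min 1 (1 / \<bar>x\<bar>))"
      "?w x * \<bar>unit_sin x\<bar> \<le> ?w x * (2 * min 1 (1 / \<bar>x\<bar>))"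
      using unit_trig_le[of x] by (cases "x = 0"; simp add: mult_left_mono)+
    then show "\<bar>?w x * unit_cos x\<bar> \<le> 2 * (?w x * min 1 (1 / \<bar>x\<bar>))"
      "\<bar>?w x * unit_sin x\<bar> \<le> 2 * (?w x * min 1 (1 / \<bar>x\<bar>))"
      by (simp_all add: abs_mult mult_ac)
  qed
  have D: "integrable lborel (\<lambda>x. 2 * (?w x * min 1 (1 / \<bar>x\<bar>)))"
    using weight_decay_integrable[OF \<alpha>] by simp
  have wc: "integrable lborel (\<lambda>x. ?w x * unit_cos x)"
    by (rule Bochner_Integration.integrable_bound[OF D])
       (use order_trans[OF trig(1) abs_ge_self] in \<open>auto simp only: real_norm_def intro!: AE_I2\<close>, measurable)
  have ws: "integrable lborel (\<lambda>x. ?w x * unit_sin x)"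
    by (rule Bochner_Integration.integrable_bound[OF D])
       (use order_trans[OF trig(2) abs_ge_self] in \<open>auto simp only: real_norm_def intro!: AE_I2\<close>, measurable)
  have "integrable lborel (\<lambda>x. complex_of_real (?w x * unit_cos x / norm_const)
      - \<i> * complex_of_real (?w x * unit_sin x / norm_const))"
    using wc ws by (intro Bochner_Integration.integrable_diff integrable_mult_right integrable_of_real integrable_divide) auto
  also have "(\<lambda>x. complex_of_real (?w x * unit_cos x / norm_const)
      - \<i> * complex_of_real (?w x * unit_sin x / norm_const)) = \<eta>"
    by (rule ext) (simp add: \<eta>_eq complex_eq_iff)
  finally show \<eta>_int: "integrable lborel \<eta>" .
  assume y: "0 < y" "y < 1"
  have "AE x in lborel. \<eta> (- x) = cnj (\<eta> x)"
    unfolding \<eta>_eq by (auto simp: unit_cos_minus unit_sin_minus complex_cnj)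
  from fourier_at_hermitian[OF this \<eta>_int]
  have "fourier_at \<eta> y = complex_of_real ((\<integral>x. (?w x * unit_cos x * cos (y * x)) / norm_const \<partial>lborel)
      + (\<integral>x. (?w x * unit_sin x * sin (y * x)) / norm_const \<partial>lborel))"
    unfolding \<eta>_eq by simp
  also have "(\<integral>x. (?w x * unit_cos x * cos (y * x)) / norm_const \<partial>lborel)
      + (\<integral>x. (?w x * unit_sin x * sin (y * x)) / norm_const \<partial>lborel) = (\<integral>x. ?w x * unit_cos2 y x \<partial>lborel) / norm_const"
  proof -
    have "integrable lborel (\<lambda>x. ?w x * unit_cos x * cos (y * x))"
      by (rule Bochner_Integration.integrable_bound[OF wc]) (auto simp: abs_mult intro!: mult_left_le)
    moreover have "integrable lborel (\<lambda>x. ?w x * unit_sin x * sin (y * x))"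
      by (rule Bochner_Integration.integrable_bound[OF ws]) (auto simp: abs_mult intro!: mult_left_le)
    ultimately show ?thesis
      by (simp add: unit_cos2_def distrib_left mult.assoc add_divide_distrib)
  qed
  also have "(\<integral>x. ?w x * unit_cos2 y x \<partial>lborel) = c_alpha \<alpha> / (1 - \<alpha>) * (y powr (1 - \<alpha>) + (1 - y) powr (1 - \<alpha>))"
    by (rule weight_unit_cos2_integral[OF \<alpha> y])
  finally show "fourier_at \<eta> y =
      complex_of_real (c_alpha \<alpha> / (1 - \<alpha>) / norm_const * (y powr (1 - \<alpha>) + (1 - y) powr (1 - \<alpha>)))"
    by simp
qed

abbreviation Beta_sum :: real where
  "Beta_sum \<equiv> \<Sum>k\<le>m. real (m choose k) * Beta (1 - d + (1 - \<alpha>) * real k) (1 + (1 - \<alpha>) * (real m - real k))"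

lemma tensor_pairing_test_fun:
  "tensor_pairing m (Q1 \<epsilon> m \<alpha> d) test_fun = C_const \<epsilon> m \<alpha> d * ((c_alpha \<alpha> / (1 - \<alpha>) / norm_const) ^ m * Beta_sum)"
proof -
  let ?g = "\<lambda>y. c_alpha \<alpha> / (1 - \<alpha>) / norm_const * (y powr (1 - \<alpha>) + (1 - y) powr (1 - \<alpha>))"
  let ?\<eta> = "\<lambda>x. complex_of_real (\<bar>x\<bar> powr ((\<alpha> - 1) / 2)) * cnj (test_fun x)"
  have [measurable]: "fourier_at ?\<eta> \<in> borel_measurable borel"
    unfolding fourier_at_def by (rule lborel.borel_measurable_lebesgue_integral) measurable
  have "(\<integral>x. (\<integral>y. exp (\<i> * complex_of_real (y * (\<Sum>j<m. x j))) \<partial>mu d) *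
        (\<Prod>j<m. ?\<eta> (x j)) \<partial>(\<Pi>\<^sub>M j\<in>{..<m}. lborel)) = (\<integral>y. fourier_at ?\<eta> y ^ m \<partial>mu d)"
    by (rule pairing_fubini[OF finite_measure_mu[OF d_less] sets_mu fourier_test_fun(1)])
  also have "\<dots> = (\<integral>y. complex_of_real (?g y ^ m) \<partial>mu d)"
  proof (rule integral_cong_AE)
    show "AE y in mu d. fourier_at ?\<eta> y ^ m = complex_of_real (?g y ^ m)"
      using AE_mu_unit[of d]
    proof eventually_elim
      case (elim y)
      then show ?case by (simp only: fourier_test_fun(2) of_real_power)
    qed
  qed measurable
  also have "\<dots> = complex_of_real (\<integral>y. ?g y ^ m \<partial>mu d)" by (rule integral_complex_of_real)
  also have "(\<integral>y. ?g y ^ m \<partial>mu d) = (c_alpha \<alpha> / (1 - \<alpha>) / norm_const) ^ m * Beta_sum"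
    unfolding power_mult_distrib using \<alpha>
    by (simp add: integral_binomial_Beta[OF d_less, of "1 - \<alpha>" m])
  finally show ?thesis
    unfolding tensor_pairing_Q1 by (simp only: Re_complex_of_real)
qed

lemma Beta_sum_pos: "Beta_sum > 0"
proof (rule sum_pos)
  fix k assume k: "k \<in> {..m}"
  have "0 \<le> (1 - \<alpha>) * real k" "0 \<le> (1 - \<alpha>) * (real m - real k)" using \<alpha> k by simp_all
  then have "Beta (1 - d + (1 - \<alpha>) * real k) (1 + (1 - \<alpha>) * (real m - real k)) > 0"
    using d_less by (intro Beta_real_pos) linarith+
  with k show "0 < real (m choose k) * Beta (1 - d + (1 - \<alpha>) * real k) (1 + (1 - \<alpha>) * (real m - real k))"
    by (simp add: zero_less_binomial)
qed auto

lemma L_const_alt: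
  "L_const m \<alpha> d = ((2 - \<alpha>) / (2 * (1 - \<alpha>))) powr (real m / 2) * Beta_sum / (fact m * I_const m \<alpha> d) powr (1 / 2)"
  by (simp add: L_const_def atMost_atLeast0)

lemma I_pos: "I_const m \<alpha> d > 0"
  using I_const_pos[of d \<alpha> m] d_less \<alpha>m d\<alpha> by simp

lemma L_const_pos: "L_const m \<alpha> d > 0"
  unfolding L_const_alt using Beta_sum_pos I_pos \<alpha>
  by (intro divide_pos_pos mult_pos_pos) auto

text \<open>The Fourier constant drops out: the transform of the test function contributes
  \<open>sqrt c\<close> per factor, and \<open>C_const\<close> contains the inverse of its m-th
  power. The sign disappears in the absolute value.\<close>

lemma L_const_eq:
  assumes \<epsilon>: "\<epsilon> \<in> {- 1, 1}"
  shows "\<bar>tensor_pairing m (Q1 \<epsilon> m \<alpha> d) test_fun\<bar> = L_const m \<alpha> d"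
proof -
  define c where "c = c_alpha \<alpha>"
  define T where "T = (2 - \<alpha>) / (2 * (1 - \<alpha>))"
  have c: "c > 0" using c_alpha_pos[OF \<alpha>] by (simp add: c_def)
  have T: "T > 0" using \<alpha> by (simp add: T_def)
  have A: "fact m * I_const m \<alpha> d > 0" using I_pos by simp
  \<comment> \<open>Origin of the base in \<open>L_const\<close>: the square of the potential's
    prefactor divided by the energy of the interval is c times T.\<close>
  have "c / (1 - \<alpha>) / norm_const = sqrt c * sqrt T"
  proof (rule power2_eq_imp_eq)
    have "norm_const\<^sup>2 = 2 * c / ((1 - \<alpha>) * (2 - \<alpha>))"
      using c \<alpha> by (simp add: norm_const_def c_def)
    then have "(c / (1 - \<alpha>) / norm_const)\<^sup>2 = (c / (1 - \<alpha>))\<^sup>2 / (2 * c / ((1 - \<alpha>) * (2 - \<alpha>)))"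
      by (simp only: power_divide[of _ norm_const])
    also have "\<dots> = c * T"
    proof -
      have "(c / a)\<^sup>2 / (2 * c / (a * b)) = c * (b / (2 * a))" if "a > 0" "b > 0" for a b :: real
        using c that by (simp add: power2_eq_square field_simps)
      then show ?thesis using \<alpha> unfolding T_def by simp
    qed
    finally show "(c / (1 - \<alpha>) / norm_const)\<^sup>2 = (sqrt c * sqrt T)\<^sup>2"
      using c T by (simp add: power_mult_distrib)
  qed (use c T \<alpha> norm_const_pos in auto)
  then have G: "(c / (1 - \<alpha>) / norm_const) ^ m = sqrt c ^ m * T powr (real m / 2)"
  proof -
    have "sqrt T ^ m = T powr (real m / 2)"
      using T by (simp add: powr_half_sqrt[symmetric] powr_realpow[symmetric] powr_powr)
    then show ?thesis using \<open>c / (1 - \<alpha>) / norm_const = sqrt c * sqrt T\<close> by (simp add: power_mult_distrib)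
  qed
  have C: "\<bar>C_const \<epsilon> m \<alpha> d\<bar> = (c ^ m * (fact m * I_const m \<alpha> d)) powr (- 1 / 2)"
    using \<epsilon> by (auto simp: C_const_def abs_mult c_def mult_ac)
  also have "\<dots> = (c ^ m) powr (- 1 / 2) * (fact m * I_const m \<alpha> d) powr (- 1 / 2)"
    by (rule powr_mult)
  also have "(c ^ m) powr (- 1 / 2) = 1 / sqrt c ^ m"
    using c by (simp add: powr_minus_divide powr_half_sqrt real_sqrt_power)
  also have "(fact m * I_const m \<alpha> d) powr (- 1 / 2) = 1 / (fact m * I_const m \<alpha> d) powr (1 / 2)"
    using A by (simp add: powr_minus_divide)
  finally have C': "\<bar>C_const \<epsilon> m \<alpha> d\<bar> = 1 / sqrt c ^ m * (1 / (fact m * I_const m \<alpha> d) powr (1 / 2))" .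
  have "\<bar>tensor_pairing m (Q1 \<epsilon> m \<alpha> d) test_fun\<bar> = \<bar>C_const \<epsilon> m \<alpha> d\<bar> * (sqrt c ^ m * T powr (real m / 2) * Beta_sum)"
    unfolding tensor_pairing_test_fun abs_mult c_def[symmetric] G using Beta_sum_pos c by simp
  also have "\<dots> = T powr (real m / 2) * Beta_sum / (fact m * I_const m \<alpha> d) powr (1 / 2)"
    unfolding C' using c by simp
  finally show ?thesis unfolding L_const_alt T_def .
qed

lemma L_const_le_Lambda_sup:
  assumes "\<epsilon> \<in> {- 1, 1}"
  shows "ereal (L_const m \<alpha> d) \<le> Lambda_sup \<epsilon> m \<alpha> d"
  unfolding Lambda_sup_def L_const_eq[OF assms, symmetric]
  by (rule SUP_upper) (simp add: test_fun_hermitian herm_norm_test_fun)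

end

theorem mainTheorem7:
  fixes m :: nat and \<alpha> d \<epsilon> :: real
  assumes "m \<ge> 2"
    and "0 < \<alpha>" and "\<alpha> < 1"
    and "\<alpha> * real m < 1"
    and "2 * d + \<alpha> * real m < 1"
    and "\<epsilon> \<in> {- 1, 1}"
  shows "I_const m \<alpha> d = 2 * Beta (1 - d) (1 - \<alpha> * real m) / (2 - 2 * d - \<alpha> * real m)
    \<and> 0 < L_const m \<alpha> d
    \<and> ereal (L_const m \<alpha> d) \<le> Lambda_sup \<epsilon> m \<alpha> d
    \<and> Lambda_sup \<epsilon> m \<alpha> d < ereal (fact m powr (- 1 / 2))"
proof -
  interpret riesz_params m \<alpha> d
    using assms by unfold_locales auto
  show ?thesis
    using I_const_formula[OF d_less \<alpha>m] d\<alpha> L_const_pos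
      L_const_le_Lambda_sup[OF assms(6)] Lambda_sup_less[OF assms(6)]
    by simp
qed

end
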